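(* Let $\mathcal{C}$ be a unital C$^*$-algebra and $n\ge1$. The space $C^\infty(\mathcal{U})$ of smooth vectors for the unitary representation $\mathcal{U}$ of the Heisenberg group $H_{2n+1}(\mathbb{R})$ on $E_n$ coincides with $\mathcal{S}^\mathcal{C}(\mathbb{R}^n)$.
   Context: $\mathcal{S}^\mathcal{C}(\mathbb{R}^n)$: $\mathcal{C}$-valued Schwartz functions on $\mathbb{R}^n$, regarded as a (dense) subspace of $E_n$, the Hilbert $\mathcal{C}$-module completion of $\mathcal{S}^\mathcal{C}(\mathbb{R}^n)$ in the norm $\|f\|_2=\|\int_{\mathbb{R}^n}f(x)^*f(x)\,dx\|_\mathcal{C}^{1/2}$. The Heisenberg group $H_{2n+1}(\mathbb{R})$ consists of the matrices $\begin{bmatrix}1&a^T&c\\0&I_n&b\\0&0&1\end{bmatrix}$, $a,b\in\mathbb{R}^n$, $c\in\mathbb{R}$, and $\mathcal{U}$ is the strongly continuous unitary representation on $E_n$ given by the continuous extension of $\mathcal{U}_{a,b,c}(f)(x)=e^{ic}e^{i\langle b,x\rangle}f(x-a)$ for $f\in\mathcal{S}^\mathcal{C}(\mathbb{R}^n)$. A vector $\phi\in E_n$ is smooth for $\mathcal{U}$ if $g\mapsto\mathcal{U}(g)\phi$ is a $C^\infty$ map from $H_{2n+1}(\mathbb{R})$ to $E_n$. *)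

theory Defs
  imports "HOL-Analysis.Analysis"
begin

text \<open>A unital C*-algebra is modelled as a real Banach algebra with unit of norm 1
 (type class constraint on the carrier type) together with a complex scalar
 multiplication extending the real one and an involution satisfying the C*-identity.\<close>

definition cstar_algebra ::
  "(complex \<Rightarrow> 'a::{real_normed_algebra_1,banach} \<Rightarrow> 'a) \<Rightarrow> ('a \<Rightarrow> 'a) \<Rightarrow> bool" where
  "cstar_algebra csc st \<longleftrightarrow>
     (\<forall>r x. csc (complex_of_real r) x = r *\<^sub>R x) \<and>
     (\<forall>c d x. csc (c + d) x = csc c x + csc d x) \<and>
     (\<forall>c x y. csc c (x + y) = csc c x + csc c y) \<and>
     (\<forall>c d x. csc (c * d) x = csc c (csc d x)) \<and>
     (\<forall>c x y. csc c (x * y) = csc c x * y) \<and>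
     (\<forall>c x y. csc c (x * y) = x * csc c y) \<and>
     (\<forall>c x. norm (csc c x) = cmod c * norm x) \<and>
     (\<forall>x y. st (x + y) = st x + st y) \<and>
     (\<forall>c x. st (csc c x) = csc (cnj c) (st x)) \<and>
     (\<forall>x y. st (x * y) = st y * st x) \<and>
     (\<forall>x. st (st x) = x) \<and>
     (\<forall>x. norm (st x * x) = (norm x)\<^sup>2)"

definition dir_deriv :: "'v::euclidean_space \<Rightarrow> ('v \<Rightarrow> 'b::real_normed_vector) \<Rightarrow> 'v \<Rightarrow> 'b" where
  "dir_deriv v f x = vector_derivative (\<lambda>t. f (x + t *\<^sub>R v)) (at 0)"

fun iter_partial :: "'v::euclidean_space list \<Rightarrow> ('v \<Rightarrow> 'b::real_normed_vector) \<Rightarrow> 'v \<Rightarrow> 'b" where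
  "iter_partial [] f = f"
| "iter_partial (v # vs) f = dir_deriv v (iter_partial vs f)"

definition smooth_map :: "('v::euclidean_space \<Rightarrow> 'b::real_normed_vector) \<Rightarrow> bool" where
  "smooth_map f \<longleftrightarrow>
     (\<forall>vs. set vs \<subseteq> Basis \<longrightarrow>
        continuous_on UNIV (iter_partial vs f) \<and>
        (\<forall>v\<in>Basis. \<forall>x. (\<lambda>t. iter_partial vs f (x + t *\<^sub>R v)) differentiable (at 0)))"

definition schwartz :: "(real^'n \<Rightarrow> 'a::real_normed_vector) \<Rightarrow> bool" where
  "schwartz f \<longleftrightarrow> smooth_map f \<and>
     (\<forall>vs k. set vs \<subseteq> Basis \<longrightarrow>
        bounded (range (\<lambda>x. (1 + norm x) ^ k *\<^sub>R iter_partial vs f x)))"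

definition l2norm :: "('a::{real_normed_algebra_1,banach} \<Rightarrow> 'a) \<Rightarrow> (real^'n \<Rightarrow> 'a) \<Rightarrow> real" where
  "l2norm st f = sqrt (norm (integral UNIV (\<lambda>x. st (f x) * f x)))"

definition is_completion ::
  "('a::{real_normed_algebra_1,banach} \<Rightarrow> 'a) \<Rightarrow> ((real^'n \<Rightarrow> 'a) \<Rightarrow> 'e::banach) \<Rightarrow> bool" where
  "is_completion st \<iota> \<longleftrightarrow>
     (\<forall>f g. schwartz f \<longrightarrow> schwartz g \<longrightarrow> \<iota> (\<lambda>x. f x + g x) = \<iota> f + \<iota> g) \<and>
     (\<forall>r f. schwartz f \<longrightarrow> \<iota> (\<lambda>x. r *\<^sub>R f x) = r *\<^sub>R \<iota> f) \<and>
     (\<forall>f. schwartz f \<longrightarrow> norm (\<iota> f) = l2norm st f) \<and>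
     closure (\<iota> ` {f. schwartz f}) = UNIV"

definition heis_act ::
  "(complex \<Rightarrow> 'a \<Rightarrow> 'a) \<Rightarrow> (real^'n) \<times> (real^'n) \<times> real \<Rightarrow> (real^'n \<Rightarrow> 'a) \<Rightarrow> real^'n \<Rightarrow> 'a" where
  "heis_act csc g f = (case g of (a, b, c) \<Rightarrow> (\<lambda>x. csc (cis c * cis (b \<bullet> x)) (f (x - a))))"

end

theory Submission
  imports Defs
begin

text \<open>
  Schwartz functions are smooth vectors because the maps \<open>g \<mapsto> m \<cdot> U\<^sub>g h\<close>, with \<open>m\<close> a tempered
  multiplier and \<open>h\<close> a Schwartz function, are stable under the partial derivatives in \<open>g\<close>.

  Conversely let \<open>A\<^sub>j\<close> and \<open>B\<^sub>j\<close> be the generators of the translations and of the modulations, so that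
  \<open>1 - A\<^sub>j\<close> acts as \<open>1 + \<partial>\<^sub>j\<close> and \<open>1 - B\<^sub>j\<close> as multiplication by \<open>1 - \<i> x\<^sub>j\<close>. They preserve the smooth vectors,
  both operators are bounded below by \<open>1\<close> since \<open>U\<close> is isometric, and both are invertible on Schwartz
  functions. The identity \<open>f 0 = \<integral> K \<cdot> (\<Prod>\<^sub>j (1 + \<partial>\<^sub>j)) f\<close> with a square integrable product kernel \<open>K\<close> and the
  Cauchy-Schwarz inequality of the Hilbert module bound the supremum norm of \<open>f\<close> by the module norm
  of \<open>(\<Prod>\<^sub>j (1 + \<partial>\<^sub>j)) f\<close>. Hence a smooth vector \<open>\<phi>\<close> is approximated by Schwartz functions both in the module
  norm and uniformly, and the uniform limit is a function \<open>f\<close> determined by \<open>\<phi>\<close>. The vectors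
  \<open>\<phi> - A\<^sub>j \<phi>\<close> and \<open>\<phi> - B\<^sub>j \<phi>\<close> correspond to \<open>f + \<partial>\<^sub>j f\<close> and \<open>(1 - \<i> x\<^sub>j) f\<close>, so \<open>f\<close> is smooth and rapidly
  decreasing together with all its derivatives.
\<close>

section \<open>Positivity in C*-algebras\<close>

text \<open>Elements of the completion have no point values, so every statement about them passes
  through Schwartz approximants. A smooth vector is not approximated directly: its image under the
  product of all \<open>1 - A_j\<close> is approximated, and the approximants are pulled back. The
  lower bound \<open>1\<close> turns convergence of the images into convergence of the pull-backs,
  and one derivative per coordinate pays for uniform convergence. A product of first-order operators
  is convenient here because its inverse is an iterated Laplace integral and its kernel a product of
  one-dimensional ones.

  Two obstacles shape the rest. The axioms give only the norm identity for \<open>st x * x\<close>,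
  while Cauchy-Schwarz in the module needs an order with monotone norm; positivity and square roots
  are therefore built from norm estimates. And the values lie in an arbitrary Banach algebra, so
  integrals are handled by gauge sums, scalar domination and translation invariance, and derivatives
  are moved through integrals and through \<open>\<iota>\<close> by second-order Taylor remainders
  with explicit bounds.\<close>

locale cstar =
  fixes csc :: "complex \<Rightarrow> 'a::{real_normed_algebra_1,banach} \<Rightarrow> 'a"
    and st :: "'a \<Rightarrow> 'a"
  assumes cstar: "cstar_algebra csc st"
begin

lemma csc_of_real: "csc (complex_of_real r) x = r *\<^sub>R x"
  and csc_add_left: "csc (c + d) x = csc c x + csc d x"
  and csc_add_right: "csc c (x + y) = csc c x + csc c y"
  and csc_csc: "csc c (csc d x) = csc (c * d) x"
  and csc_mult_left: "csc c x * y = csc c (x * y)"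
  and csc_mult_right: "x * csc c y = csc c (x * y)"
  and norm_csc: "norm (csc c x) = cmod c * norm x"
  and st_add: "st (x + y) = st x + st y"
  and st_csc: "st (csc c x) = csc (cnj c) (st x)"
  and st_mult: "st (x * y) = st y * st x"
  and st_st: "st (st x) = x"
  and norm_st_mult_self: "norm (st x * x) = (norm x)\<^sup>2"
  using cstar unfolding cstar_algebra_def by metis+

lemma csc_1: "csc 1 x = x"
  using csc_of_real[of 1 x] by simp

lemma st_scaleR: "st (r *\<^sub>R x) = r *\<^sub>R st x"
  using st_csc[of "complex_of_real r" x] by (simp add: csc_of_real)

lemma csc_scaleR: "csc c (r *\<^sub>R x) = r *\<^sub>R csc c x"
  by (metis csc_csc csc_of_real mult.commute)

lemma csc_real_mult: "csc (complex_of_real r * c) x = r *\<^sub>R csc c x"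
  by (metis csc_csc csc_of_real)

lemma norm_st: "norm (st x) = norm x"
proof -
  have *: "norm x \<le> norm (st x)" for x
  proof (cases "x = 0")
    case False
    have "norm x * norm x \<le> norm (st x) * norm x"
      using norm_st_mult_self[of x] norm_mult_ineq[of "st x" x] by (simp add: power2_eq_square)
    then show ?thesis using False by simp
  qed simp
  from *[of x] *[of "st x"] show ?thesis by (simp add: st_st)
qed

lemma bounded_linear_st: "bounded_linear st"
  by (rule bounded_linear_intro[where K = 1]) (simp_all add: st_add st_scaleR norm_st)

lemma bounded_linear_csc: "bounded_linear (csc c)"
  by (rule bounded_linear_intro[where K = "cmod c"])
    (simp_all add: csc_add_right csc_scaleR norm_csc mult.commute)

lemmas st_simps = linear_0[OF bounded_linear.linear[OF bounded_linear_st]]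
  linear_neg[OF bounded_linear.linear[OF bounded_linear_st]]
  linear_diff[OF bounded_linear.linear[OF bounded_linear_st]]
  st_add st_scaleR st_mult st_st st_csc

lemmas csc_simps = linear_0[OF bounded_linear.linear[OF bounded_linear_csc]]
  linear_neg[OF bounded_linear.linear[OF bounded_linear_csc]]
  linear_diff[OF bounded_linear.linear[OF bounded_linear_csc]]
  csc_add_right csc_scaleR csc_mult_left csc_mult_right csc_csc csc_1

lemma csc_minus_left: "csc (- c) x = - csc c x"
  by (metis csc_csc csc_of_real mult_minus1 of_real_1 of_real_minus scaleR_minus1_left)



lemma csc_diff_left: "csc (c - d) x = csc c x - csc d x"
  using csc_add_left[of c "- d" x] by (simp add: csc_minus_left)

lemma st_1: "st 1 = 1"
  by (metis mult.right_neutral st_mult st_st)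

lemma bounded_bilinear_csc: "bounded_bilinear csc"
proof
  show "\<exists>K. \<forall>a b. norm (csc a b) \<le> norm a * norm b * K"
    by (rule exI[of _ 1]) (simp add: norm_csc)
qed (simp_all add: csc_add_left csc_add_right csc_scaleR scaleR_conv_of_real[where 'a = complex] csc_real_mult)

lemma norm_square_selfadjoint: "st k = k \<Longrightarrow> norm (k * k) = (norm k)\<^sup>2"
  using norm_st_mult_self[of k] by simp

text \<open>Applying the norm identity twice gives
  \<open>norm (a * a * (a * a)) = (norm a) ^ 4\<close>. This replaces the spectral argument that a
  self-adjoint nilpotent vanishes.\<close>

lemma selfadjoint_cube_zero:
  assumes "st a = a" "a * a * a = 0"
  shows "a = 0"
proof -
  have "st (a * a) = a * a" using assms by (simp add: st_simps)
  from norm_square_selfadjoint[OF this] norm_square_selfadjoint[OF assms(1)]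
  have "norm (a * a * (a * a)) = (norm a) ^ 4" by (simp add: power_mult[symmetric])
  moreover have "a * a * (a * a) = 0" using assms(2) by (metis mult.assoc mult_zero_left)
  ultimately show ?thesis by simp
qed

text \<open>With \<open>w\<close> written for \<open>1 - \<surd>(1 - z)\<close> the equation reads \<open>w = (z + w\<^sup>2) / 2\<close>. Its fixed point
  iteration is dominated by the scalar iteration for \<open>z = 1\<close>, which increases to \<open>1\<close>; hence it
  converges even on the boundary of the unit ball.\<close>

lemma sqrt_one_minus:
  assumes z: "norm z \<le> 1"
  obtains w where "norm w \<le> 1" "(1 - w) * (1 - w) = 1 - z"
    "\<And>y. y * z = z * y \<Longrightarrow> y * w = w * y" "st z = z \<Longrightarrow> st w = w"
proof -
  define W where "W = rec_nat (0::'a) (\<lambda>_ w. (1/2) *\<^sub>R (z + w * w))"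
  define r where "r = rec_nat (0::real) (\<lambda>_ s. (1 + s * s) / 2)"
  have W0: "W 0 = 0" and WS: "W (Suc n) = (1/2) *\<^sub>R (z + W n * W n)" for n
    by (simp_all add: W_def)
  have r0: "r 0 = 0" and rS: "r (Suc n) = (1 + r n * r n) / 2" for n
    by (simp_all add: r_def)
  have comm: "y * z = z * y \<Longrightarrow> y * W n = W n * y" for y n
  proof (induction n)
    case (Suc n)
    have "y * (W n * W n) = W n * W n * y"
      using Suc by (metis mult.assoc)
    then show ?case using Suc by (simp add: WS distrib_left distrib_right)
  qed (simp add: W0)
  have sa: "st z = z \<Longrightarrow> st (W n) = W n" for n
    by (induction n) (simp_all add: W0 WS st_simps)
  have rb: "0 \<le> r n \<and> r n \<le> 1" for n
  proof (induction n)
    case (Suc n)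
    then have "r n * r n \<le> 1" by (simp add: mult_le_one)
    with Suc show ?case by (simp add: rS)
  qed (simp add: r0)
  have nW: "norm (W n) \<le> r n" for n
  proof (induction n)
    case (Suc n)
    have "norm (z + W n * W n) \<le> 1 + r n * r n"
      using z norm_mult_ineq[of "W n" "W n"] mult_mono[OF Suc Suc] rb[of n]
      by (intro norm_triangle_le) auto
    then show ?case by (simp add: WS rS)
  qed (simp add: W0 r0)
  have step: "norm (W (Suc n) - W n) \<le> r (Suc n) - r n" for n
  proof (induction n)
    case 0
    then show ?case using z by (simp add: W0 WS r0 rS)
  next
    case (Suc n)
    \<comment> \<open>The iterates are polynomials in \<open>z\<close>, so they commute and the
      difference of their squares factors.\<close>
    have c: "W (Suc n) * W n = W n * W (Suc n)"
      using comm[OF comm[of z "Suc n", OF refl, symmetric], of n] .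
    have "W (Suc (Suc n)) - W (Suc n) = (1/2) *\<^sub>R (W (Suc n) * W (Suc n) - W n * W n)"
      by (simp only: WS[of "Suc n"] WS[of n] flip: scaleR_diff_right) (simp add: algebra_simps)
    also have "W (Suc n) * W (Suc n) - W n * W n = (W (Suc n) - W n) * (W (Suc n) + W n)"
      using c by (simp add: algebra_simps)
    finally have "norm (W (Suc (Suc n)) - W (Suc n))
        \<le> 1/2 * ((r (Suc n) - r n) * (r (Suc n) + r n))"
      using norm_mult_ineq[of "W (Suc n) - W n" "W (Suc n) + W n"]
        mult_mono[OF Suc.IH order_trans[OF norm_triangle_ineq add_mono[OF nW nW]], of "Suc n" n]
        order_trans[OF norm_ge_zero Suc.IH] by simp
    also have "\<dots> = r (Suc (Suc n)) - r (Suc n)"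
      by (simp only: rS[of "Suc n"] rS[of n]) (simp add: field_simps)
    finally show ?case .
  qed
  have "incseq r" using step order_trans[OF norm_ge_zero step] by (intro incseq_SucI) simp
  then obtain l where l: "r \<longlonglongrightarrow> l"
    using incseq_convergent[of r 1] rb by blast
  have "summable (\<lambda>n. W (Suc n) - W n)"
    by (rule summable_comparison_test'[OF sums_summable[OF telescope_sums[OF l]] step])
  then have "convergent (\<lambda>n. \<Sum>k<n. W (Suc k) - W k)"
    by (simp add: summable_iff_convergent)
  then have "convergent W"
    by (simp add: sum_lessThan_telescope W0)
  then obtain w where w: "W \<longlonglongrightarrow> w" by (auto simp: convergent_def)
  show thesis
  proof
    show "norm w \<le> 1"
      using order_trans[OF nW] rb by (intro Lim_norm_ubound[OF _ w]) auto
    have "(\<lambda>n. (1/2) *\<^sub>R (z + W n * W n)) \<longlonglongrightarrow> (1/2) *\<^sub>R (z + w * w)"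
      by (intro tendsto_intros w)
    moreover have "(\<lambda>n. (1/2) *\<^sub>R (z + W n * W n)) \<longlonglongrightarrow> w"
      using LIMSEQ_Suc[OF w] by (simp add: WS)
    ultimately have "w = (1/2) *\<^sub>R (z + w * w)" using LIMSEQ_unique by blast
    then have "2 *\<^sub>R w = 2 *\<^sub>R ((1/2) *\<^sub>R (z + w * w))" by (rule arg_cong)
    also have "\<dots> = z + w * w" by (simp only: scaleR_scaleR) simp
    finally show "(1 - w) * (1 - w) = 1 - z" by (simp add: algebra_simps scaleR_2)
    show "y * w = w * y" if "y * z = z * y" for y
    proof (rule LIMSEQ_unique)
      show "(\<lambda>n. y * W n) \<longlonglongrightarrow> y * w" by (intro tendsto_intros w)
      show "(\<lambda>n. y * W n) \<longlonglongrightarrow> w * y" unfolding comm[OF that] by (intro tendsto_intros w)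
    qed
    show "st w = w" if "st z = z"
      using bounded_linear.tendsto[OF bounded_linear_st w] w LIMSEQ_unique
      unfolding sa[OF that] by blast
  qed
qed

section \<open>Positive elements and their square roots\<close>

text \<open>For self-adjoint \<open>h\<close> the norm condition says that the spectrum lies in
  \<open>[0, 2 * t]\<close>. Positivity is thus expressed by norms alone.\<close>

definition psd :: "'a \<Rightarrow> bool"
  where "psd h \<longleftrightarrow> st h = h \<and> (\<exists>t\<ge>0. norm (t *\<^sub>R 1 - h) \<le> t)"

lemma psd_selfadjoint: "psd h \<Longrightarrow> st h = h"
  by (simp add: psd_def)

lemma psd_0: "psd 0"
  by (auto simp: psd_def st_simps intro: exI[of _ 0])

text \<open>Rescaling by the witness \<open>t\<close> writes \<open>h\<close> as \<open>t\<close>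
  times \<open>1 - z\<close> with \<open>z\<close> in the closed unit ball, where the square root is
  available. The commutation clause is what makes roots of commuting elements commute.\<close>

lemma psd_sqrt:
  assumes "psd h"
  obtains k where "psd k" "k * k = h" "\<And>y. y * h = h * y \<Longrightarrow> y * k = k * y"
proof -
  obtain t where h: "st h = h" and t: "t \<ge> 0" "norm (t *\<^sub>R 1 - h) \<le> t"
    using assms by (auto simp: psd_def)
  show thesis
  proof (cases "t = 0")
    case True
    then show thesis using t that[of 0] by (simp add: psd_0)
  next
    case False
    define z where "z = 1 - (1/t) *\<^sub>R h"
    have "z = (1/t) *\<^sub>R (t *\<^sub>R 1 - h)" using False by (simp add: z_def algebra_simps)
    then have "norm z \<le> 1" using t False by (simp add: divide_simps)
    then obtain w where w: "norm w \<le> 1" "(1 - w) * (1 - w) = 1 - z"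
      "\<And>y. y * z = z * y \<Longrightarrow> y * w = w * y" "st z = z \<Longrightarrow> st w = w"
      using sqrt_one_minus by blast
    have w': "st w = w" by (intro w) (simp add: z_def st_simps st_1 h)
    define k where "k = sqrt t *\<^sub>R (1 - w)"
    show thesis
    proof
      have "sqrt t *\<^sub>R 1 - k = sqrt t *\<^sub>R w" by (simp add: k_def algebra_simps)
      then have "norm (sqrt t *\<^sub>R 1 - k) \<le> sqrt t"
        using w(1) t(1) by (simp add: mult_left_le)
      then show "psd k" unfolding psd_def using t(1)
        by (auto simp: k_def st_simps st_1 w' intro!: exI[of _ "sqrt t"])
      show "k * k = h" using t(1) False by (simp add: k_def w(2) z_def)
      show "y * k = k * y" if "y * h = h * y" for y
      proof -
        have "y * w = w * y" by (rule w(3)) (simp add: z_def algebra_simps that)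
        then show ?thesis by (simp add: k_def algebra_simps)
      qed
    qed
  qed
qed

text \<open>The element \<open>k + \<i> m\<close> is \<open>\<surd>t\<close> times a unitary.\<close>

lemma norm_le_of_sum_squares:
  assumes "st k = k" "st m = m" "k * m = m * k" "k * k + m * m = t *\<^sub>R 1" "t \<ge> 0"
  shows "(norm k)\<^sup>2 \<le> t"
proof -
  define x where "x = k + csc \<i> m"
  have sx: "st x = k - csc \<i> m" by (simp add: x_def st_simps assms csc_minus_left)
  have "st x * x = k * k - csc (-1) (m * m)"
    unfolding sx unfolding x_def
    by (simp add: algebra_simps csc_simps assms(3))
  also have "\<dots> = t *\<^sub>R 1" using assms(4) by (simp add: csc_minus_left csc_1)
  finally have nx: "(norm x)\<^sup>2 = t" using norm_st_mult_self[of x] assms(5) by simp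
  have "2 *\<^sub>R k = x + st x" unfolding sx unfolding x_def by (simp add: scaleR_2)
  then have "2 * norm k \<le> norm x + norm (st x)"
    by (metis norm_triangle_ineq norm_scaleR abs_numeral)
  then have "norm k \<le> norm x" by (simp add: norm_st)
  then show ?thesis unfolding nx[symmetric] by (simp add: power_mono)
qed

lemma psd_norm_minus: "st h = h \<Longrightarrow> norm h \<le> t \<Longrightarrow> psd (t *\<^sub>R 1 - h)"
  unfolding psd_def using order_trans[OF norm_ge_zero, of h t]
  by (auto simp: st_simps st_1 intro!: exI[of _ t])

text \<open>The root \<open>m\<close> of \<open>t *\<^sub>R 1 - k * k\<close> commutes with
  \<open>k\<close>, so \<open>k\<close> and \<open>m\<close> enter
  \<open>norm_le_of_sum_squares\<close> symmetrically and the bound applies to \<open>m\<close>.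
  This is what makes squares positive.\<close>

lemma norm_minus_square_le:
  assumes "st k = k" "norm (k * k) \<le> t"
  shows "norm (t *\<^sub>R 1 - k * k) \<le> t"
proof -
  have "psd (t *\<^sub>R 1 - k * k)" using assms by (intro psd_norm_minus) (simp_all add: st_simps)
  then obtain m where m: "psd m" "m * m = t *\<^sub>R 1 - k * k"
    "\<And>y. y * (t *\<^sub>R 1 - k * k) = (t *\<^sub>R 1 - k * k) * y \<Longrightarrow> y * m = m * y"
    using psd_sqrt by blast
  have "k * m = m * k" by (rule m(3)) (simp add: algebra_simps)
  then have "(norm m)\<^sup>2 \<le> t"
    using assms m(1,2) order_trans[OF norm_ge_zero assms(2)]
    by (intro norm_le_of_sum_squares[where m = k]) (auto simp: psd_selfadjoint)
  then show ?thesis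
    using norm_square_selfadjoint[OF psd_selfadjoint[OF m(1)]] m(2) by simp
qed

lemma psd_square: "st k = k \<Longrightarrow> psd (k * k)"
  unfolding psd_def using norm_minus_square_le[of k "norm (k * k)"]
  by (auto simp: st_simps intro!: exI[of _ "norm (k * k)"])

text \<open>The witness can always be \<open>norm h\<close>. Once the existential is gone, the
  condition is continuous in \<open>h\<close>, which gives closedness of the cone.\<close>

lemma psd_iff_norm: "psd h \<longleftrightarrow> st h = h \<and> norm (norm h *\<^sub>R 1 - h) \<le> norm h"
proof
  assume h: "psd h"
  then obtain k where "psd k" "k * k = h" using psd_sqrt by blast
  then show "st h = h \<and> norm (norm h *\<^sub>R 1 - h) \<le> norm h"
    using norm_minus_square_le[of k "norm h"] h by (auto simp: psd_selfadjoint)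
qed (auto simp: psd_def intro!: exI[of _ "norm h"])

lemma closed_psd: "closed {h. psd h}"
  unfolding psd_iff_norm
  by (intro closed_Collect_conj closed_Collect_eq closed_Collect_le continuous_intros
      linear_continuous_on bounded_linear_st)

lemma psd_add:
  assumes "psd g" "psd h"
  shows "psd (g + h)"
proof -
  obtain s t where "s \<ge> 0" "norm (s *\<^sub>R 1 - g) \<le> s" "t \<ge> 0" "norm (t *\<^sub>R 1 - h) \<le> t"
    using assms unfolding psd_def by auto
  moreover have "(s + t) *\<^sub>R 1 - (g + h) = (s *\<^sub>R 1 - g) + (t *\<^sub>R 1 - h)"
    by (simp add: algebra_simps)
  ultimately have "norm ((s + t) *\<^sub>R 1 - (g + h)) \<le> s + t"
    by (metis norm_triangle_mono)
  with \<open>s \<ge> 0\<close> \<open>t \<ge> 0\<close> assms show ?thesis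
    unfolding psd_def by (auto simp: st_simps intro!: exI[of _ "s + t"])
qed

lemma psd_scaleR:
  assumes "psd h" "c \<ge> 0"
  shows "psd (c *\<^sub>R h)"
proof -
  obtain t where t: "t \<ge> 0" "norm (t *\<^sub>R 1 - h) \<le> t" using assms unfolding psd_def by auto
  have "(c * t) *\<^sub>R 1 - c *\<^sub>R h = c *\<^sub>R (t *\<^sub>R 1 - h)" by (simp add: algebra_simps)
  then have "norm ((c * t) *\<^sub>R 1 - c *\<^sub>R h) \<le> c * t" using t assms by (simp add: mult_left_mono)
  with assms t show ?thesis
    unfolding psd_def by (auto simp: st_simps intro!: exI[of _ "c * t"])
qed

text \<open>Commuting elements have commuting roots \<open>k\<close> and \<open>m\<close>, and the
  product is the square of \<open>k * m\<close>.\<close>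

lemma psd_mult_commute:
  assumes "psd p" "psd q" "p * q = q * p"
  shows "psd (p * q)"
proof -
  obtain k where k: "psd k" "k * k = p" "\<And>y. y * p = p * y \<Longrightarrow> y * k = k * y"
    using psd_sqrt assms(1) by blast
  obtain m where m: "psd m" "m * m = q" "\<And>y. y * q = q * y \<Longrightarrow> y * m = m * y"
    using psd_sqrt assms(2) by blast
  have "q * k = k * q" by (rule k(3)) (simp add: assms(3))
  then have km: "k * m = m * k" by (intro m(3)) simp
  then have "p * q = (k * m) * (k * m)" by (metis k(2) m(2) mult.assoc)
  then show ?thesis
    using psd_square[of "k * m"] km k(1) m(1) by (simp add: st_simps psd_selfadjoint)
qed

text \<open>Adding \<open>norm b - b\<close> and \<open>b - a\<close> shows that
  \<open>norm b - a\<close> is positive. Its root and the root of \<open>a\<close> commute, and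
  their squares add up to \<open>norm b\<close>.\<close>

lemma psd_norm_mono:
  assumes "psd a" "psd (b - a)"
  shows "norm a \<le> norm b"
proof -
  have "st b = b" using assms by (metis diff_add_cancel psd_selfadjoint st_add)
  then have "psd (norm b *\<^sub>R 1 - b)" by (intro psd_norm_minus) simp_all
  from psd_add[OF this assms(2)] have "psd (norm b *\<^sub>R 1 - a)" by simp
  then obtain m where m: "psd m" "m * m = norm b *\<^sub>R 1 - a"
    "\<And>y. y * (norm b *\<^sub>R 1 - a) = (norm b *\<^sub>R 1 - a) * y \<Longrightarrow> y * m = m * y"
    using psd_sqrt by blast
  obtain k where k: "psd k" "k * k = a" using psd_sqrt assms(1) by blast
  have "k * a = a * k" unfolding k(2)[symmetric] by (simp add: mult.assoc)
  then have "k * m = m * k" by (intro m(3)) (simp add: algebra_simps)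
  then have "(norm k)\<^sup>2 \<le> norm b"
    using k m(1,2) by (intro norm_le_of_sum_squares[where m = m]) (auto simp: psd_selfadjoint)
  then show ?thesis
    using norm_square_selfadjoint[OF psd_selfadjoint[OF k(1)]] k(2) by simp
qed

section \<open>Positivity of \<open>st x * x\<close>\<close>

text \<open>Up to a factor, \<open>p\<close> and \<open>q\<close> are the real and imaginary parts
  of \<open>y\<close>; the mixed terms cancel in the sum of their squares.\<close>

lemma psd_star_self_add: "psd (st y * y + y * st y)"
proof -
  define p where "p = y + st y"
  define q where "q = csc \<i> (st y - y)"
  have "st p = p" "st q = q"
    by (simp_all add: p_def q_def st_simps csc_simps csc_minus_left)
  then have "psd ((1/2) *\<^sub>R (p * p + q * q))"
    by (intro psd_scaleR psd_add psd_square) simp_all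
  moreover have "q * q = - ((st y - y) * (st y - y))"
    by (simp add: q_def csc_mult_left csc_mult_right csc_csc csc_minus_left csc_1)
  then have "p * p + q * q = 2 *\<^sub>R (st y * y + y * st y)"
    by (simp add: p_def algebra_simps scaleR_2)
  ultimately show ?thesis by simp
qed

text \<open>Here \<open>a = y y\<^sup>*\<close> is positive and \<open>b = y\<^sup>* y\<close> negative. Since \<open>y\<close> intertwines \<open>a\<close> and \<open>b\<close>, the
  growing sequence \<open>a (1 + a)\<^sup>n a \<ge> n a\<^sup>3\<close> equals the bounded one \<open>y b (1 + b)\<^sup>n y\<^sup>*\<close>.\<close>

lemma star_mult_self_not_negative:
  assumes "psd (- (st y * y))" "norm y \<le> 1"
  shows "y = 0"
proof -
  define a where "a = y * st y"
  define b where "b = st y * y"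
  have a: "psd a" using psd_add[OF psd_star_self_add[of y] assms(1)] by (simp add: a_def)
  have nb: "norm b \<le> 1"
    using assms(2) by (simp add: b_def norm_st_mult_self power_le_one)
  obtain m where m: "psd m" "m * m = - b" using psd_sqrt assms(1) b_def by blast
  have "norm (1 *\<^sub>R 1 - m * m) \<le> 1"
    using m nb by (intro norm_minus_square_le) (auto simp: psd_selfadjoint)
  then have n1b: "norm (1 + b) \<le> 1" using m by simp
  have inter: "y * (1 + b) ^ n = (1 + a) ^ n * y" for n
  proof (induction n)
    case (Suc n)
    have "y * (1 + b) = (1 + a) * y" by (simp add: a_def b_def algebra_simps)
    then have "y * (1 + b) ^ Suc n = (1 + a) * (y * (1 + b) ^ n)"
      by (metis mult.assoc power_Suc)
    then show ?case by (simp add: Suc mult.assoc)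
  qed simp
  have eq: "a * (1 + a) ^ n * a = y * (b * (1 + b) ^ n) * st y" for n
  proof -
    have "y * (b * (1 + b) ^ n) * st y = a * (y * (1 + b) ^ n) * st y"
      by (simp add: a_def b_def mult.assoc)
    then show ?thesis by (simp add: inter mult.assoc a_def)
  qed
  have bnd: "norm (a * (1 + a) ^ n * a) \<le> 1" for n
  proof -
    have "norm (y * (b * (1 + b) ^ n) * st y) \<le> norm y * (norm b * norm ((1 + b) ^ n)) * norm (st y)"
      by (meson mult_left_mono mult_right_mono norm_ge_zero norm_mult_ineq order_trans)
    also have "\<dots> \<le> 1 * (1 * 1) * 1"
      using assms(2) nb norm_power_ineq[of "1 + b" n] power_le_one[OF norm_ge_zero n1b, of n]
      by (intro mult_mono) (auto simp: norm_st intro: order_trans)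
    finally show ?thesis by (simp add: eq)
  qed
  have ca: "a * (1 + a) ^ n = (1 + a) ^ n * a" for n
    by (rule power_commuting_commutes[symmetric]) (simp add: algebra_simps)
  have p1: "psd ((1 + a) ^ n - 1)" for n
  proof (induction n)
    case (Suc n)
    have "(1 + a) ^ Suc n - 1 = ((1 + a) ^ n - 1) + ((1 + a) ^ n - 1) * a + a"
      by (simp add: algebra_simps ca)
    moreover have "psd (((1 + a) ^ n - 1) * a)"
      by (intro psd_mult_commute Suc a) (simp add: algebra_simps ca)
    ultimately show ?case using Suc a by (simp only:) (intro psd_add)
  qed (simp add: psd_0)
  \<comment> \<open>Bernoulli's inequality in the operator order. Multiplied by \<open>a * a\<close>
    it makes the bounded sequence dominate \<open>n\<close> times the cube of
    \<open>a\<close>.\<close>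
  have p2: "psd ((1 + a) ^ n - real n *\<^sub>R a)" for n
  proof (induction n)
    case 0
    show ?case using psd_square[of 1] by (simp add: st_1)
  next
    case (Suc n)
    have "(1 + a) ^ Suc n - real (Suc n) *\<^sub>R a
        = ((1 + a) ^ n - real n *\<^sub>R a) + ((1 + a) ^ n - 1) * a"
      by (simp add: algebra_simps ca)
    moreover have "psd (((1 + a) ^ n - 1) * a)"
      by (intro psd_mult_commute p1 a) (simp add: algebra_simps ca)
    ultimately show ?case using Suc by (simp only:) (intro psd_add)
  qed
  have aa: "psd (a * a)" using a by (intro psd_square psd_selfadjoint)
  have aaa: "psd (a * a * a)" using aa a by (intro psd_mult_commute) (simp_all add: mult.assoc)
  have "real n * norm (a * a * a) \<le> 1" for n
  proof -
    have "psd (((1 + a) ^ n - real n *\<^sub>R a) * (a * a))"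
      by (intro psd_mult_commute p2 aa) (simp add: algebra_simps ca, metis ca mult.assoc)
    also have "((1 + a) ^ n - real n *\<^sub>R a) * (a * a) = a * (1 + a) ^ n * a - real n *\<^sub>R (a * a * a)"
      by (simp add: algebra_simps ca)
    finally have "norm (real n *\<^sub>R (a * a * a)) \<le> norm (a * (1 + a) ^ n * a)"
      using aaa by (intro psd_norm_mono psd_scaleR) simp_all
    then show ?thesis using bnd[of n] by simp
  qed
  then have "norm (a * a * a) = 0"
    using reals_Archimedean3[of "norm (a * a * a)"] by (force simp: not_le[symmetric])
  then have "a * a * a = 0" by (simp only: norm_eq_zero)
  then have "a = 0" by (rule selfadjoint_cube_zero[OF psd_selfadjoint[OF a]])
  then show "y = 0" using norm_st_mult_self[of "st y"] by (simp add: a_def st_st norm_st)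
qed

text \<open>For \<open>h = x\<^sup>* x\<close>, \<open>a = \<bar>h\<bar>\<close> and \<open>d = a - h\<close>, the element \<open>y = x d\<close> satisfies \<open>y\<^sup>* y = - a d\<^sup>2\<close>.\<close>

lemma psd_star_mult_self: "psd (st x * x)"
proof -
  define h where "h = st x * x"
  have h: "st h = h" by (simp add: h_def st_simps)
  then obtain a where a: "psd a" "a * a = h * h" "\<And>y. y * (h * h) = (h * h) * y \<Longrightarrow> y * a = a * y"
    using psd_sqrt psd_square by blast
  have ha: "h * a = a * h" by (rule a(3)) (simp add: mult.assoc)
  \<comment> \<open>\<open>d\<close> is twice the negative part of \<open>h\<close>; the goal is
    that it vanishes.\<close>
  define d where "d = a - h"
  have d: "st d = d" using a(1) h by (simp add: d_def st_simps psd_selfadjoint)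
  have da: "d * a = a * d" by (simp add: d_def algebra_simps ha)
  have dd: "d * d = 2 *\<^sub>R (a * d)" by (simp add: d_def algebra_simps ha a(2) scaleR_2)
  have "d * h * d = d * a * d - d * (d * d)" by (simp add: d_def algebra_simps)
  also have "d * (d * d) = 2 *\<^sub>R (d * a * d)" by (simp add: dd mult.assoc)
  finally have dhd: "d * h * d = - (a * (d * d))"
    by (simp add: scaleR_2 da mult.assoc)
  have add: "psd (a * (d * d))"
  proof (rule psd_mult_commute[OF a(1) psd_square[OF d]])
    have "a * (d * d) = d * a * d" by (simp add: da mult.assoc[symmetric])
    also have "\<dots> = d * d * a" by (simp only: mult.assoc da[symmetric])
    finally show "a * (d * d) = d * d * a" .
  qed
  define y where "y = x * d"
  have yy: "st y * y = - (a * (d * d))"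
    by (simp add: y_def st_simps d flip: dhd) (simp add: h_def mult.assoc)
  \<comment> \<open>Scaling moves \<open>y\<close> into the unit ball, where the previous lemma
    applies.\<close>
  define c where "c = inverse (norm y + 1)"
  have c: "c > 0" by (simp add: c_def add_pos_nonneg add_nonneg_pos)
  have "c *\<^sub>R y = 0"
  proof (rule star_mult_self_not_negative)
    show "psd (- (st (c *\<^sub>R y) * (c *\<^sub>R y)))"
      using psd_scaleR[OF add, of "c * c"] c by (simp add: st_simps yy)
    show "norm (c *\<^sub>R y) \<le> 1" using c by (simp add: c_def field_simps)
  qed
  then have "a * (d * d) = 0" using c yy by (simp add: st_simps)
  then have "d * d * d = 0" by (simp add: dd mult.assoc)
  then have "d = 0" using d by (rule selfadjoint_cube_zero[rotated])
  then show ?thesis using a(1) by (simp add: d_def h_def)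
qed

end

section \<open>Integrals of vector-valued functions\<close>

text \<open>Gauge Riemann sums are nonnegative combinations of values, so they stay in the cone, and
  closedness keeps their limits there. Applied to \<open>psd\<close> this makes the module inner
  product of a function with itself positive.\<close>

lemma has_integral_closed_cone:
  fixes f :: "'v::euclidean_space \<Rightarrow> 'b::banach"
  assumes K: "closed K" "0 \<in> K" "\<And>x y. x \<in> K \<Longrightarrow> y \<in> K \<Longrightarrow> x + y \<in> K"
      "\<And>c x. c \<ge> 0 \<Longrightarrow> x \<in> K \<Longrightarrow> c *\<^sub>R x \<in> K"
    and f: "\<And>x. f x \<in> K" and y: "(f has_integral y) UNIV"
  shows "y \<in> K"
proof -
  have sum: "(\<Sum>i\<in>I. h i) \<in> K" if "\<And>i. i \<in> I \<Longrightarrow> h i \<in> K" for h :: "_ \<Rightarrow> 'b" and I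
    using that by (induction I rule: infinite_finite_induct) (auto intro: K)
  have box: "z \<in> K" if z: "(f has_integral z) (cbox a b)" for z a b
  proof -
    have "\<exists>y\<in>K. dist y z < e" if "e > 0" for e
    proof -
      obtain \<gamma> where g: "gauge \<gamma>" "\<And>\<D>. \<D> tagged_division_of (cbox a b) \<Longrightarrow> \<gamma> fine \<D> \<Longrightarrow>
          norm ((\<Sum>(x,k)\<in>\<D>. Henstock_Kurzweil_Integration.content k *\<^sub>R f x) - z) < e"
        using has_integralD[OF z \<open>e > 0\<close>] by blast
      obtain p where p: "p tagged_division_of (cbox a b)" "\<gamma> fine p"
        using fine_division_exists[OF g(1)] by blast
      have "(\<Sum>(x,k)\<in>p. Henstock_Kurzweil_Integration.content k *\<^sub>R f x) \<in> K"
        by (rule sum) (auto intro: K f)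
      then show ?thesis using g(2)[OF p] by (auto simp: dist_norm)
    qed
    then show ?thesis using K(1) by (metis closure_approachable closure_closed)
  qed
  have "\<exists>z\<in>K. dist z y < e" if e: "e > 0" for e
  proof -
    from y have int: "f integrable_on cbox a b" for a b
      using integrable_on_subcbox[of f UNIV a b] by auto
    have "\<exists>B>0. \<forall>a b. ball 0 B \<subseteq> cbox a b \<longrightarrow> norm (integral (cbox a b) f - y) < e"
      using y e unfolding has_integral_alt' by simp
    then obtain B where B: "\<And>a b. ball 0 B \<subseteq> cbox a b \<Longrightarrow> norm (integral (cbox a b) f - y) < e"
      by blast
    obtain a :: 'v where "ball 0 B \<subseteq> cbox (- a) a"
      using bounded_subset_cbox_symmetric[OF bounded_ball] by blast
    from B[OF this] box[OF integrable_integral[OF int]] show ?thesis by (auto simp: dist_norm)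
  qed
  then show ?thesis using K(1) by (metis closure_approachable closure_closed)
qed

lemma has_integral_translate_UNIV:
  fixes f :: "'v::euclidean_space \<Rightarrow> 'b::banach"
  assumes f: "(f has_integral y) UNIV"
  shows "((\<lambda>x. f (x + c)) has_integral y) UNIV"
proof -
  have box: "((\<lambda>x. f (x + c)) has_integral integral (cbox (a + c) (b + c)) f) (cbox a b)" for a b
  proof -
    have "f integrable_on cbox (a + c) (b + c)"
      using f integrable_on_subcbox[of f UNIV] by auto
    then have "(f has_integral integral (cbox (a + c) (b + c)) f) (cbox (a + c) (b + c))"
      by (rule integrable_integral)
    then show ?thesis
      using has_integral_shift_cbox_iff[of f c _ a b] by (simp add: o_def add.commute)
  qed
  show ?thesis
    unfolding has_integral_alt'
  proof (intro conjI allI impI)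
    show "(\<lambda>x. if x \<in> UNIV then f (x + c) else 0) integrable_on cbox a b" for a b
      using box by auto
    fix e :: real
    assume "e > 0"
    then obtain B where B: "B > 0" "\<And>a b. ball 0 B \<subseteq> cbox a b \<Longrightarrow> norm (integral (cbox a b) f - y) < e"
      using f unfolding has_integral_alt' by auto
    \<comment> \<open>Enlarging the radius by \<open>norm c\<close> keeps \<open>ball 0 B\<close>
      inside the shifted box.\<close>
    have "norm (integral (cbox a b) (\<lambda>x. f (x + c)) - y) < e" if "ball 0 (B + norm c) \<subseteq> cbox a b" for a b
    proof -
      have "ball 0 B \<subseteq> cbox (a + c) (b + c)"
      proof
        fix x :: 'v assume "x \<in> ball 0 B"
        then have "x - c \<in> ball 0 (B + norm c)" using norm_triangle_ineq4[of x c] by simp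
        then have "x - c \<in> cbox a b" using that by blast
        then show "x \<in> cbox (a + c) (b + c)" by (auto simp: mem_box algebra_simps)
      qed
      then show ?thesis using B(2) integral_unique[OF box] by simp
    qed
    then show "\<exists>B>0. \<forall>a b. ball 0 B \<subseteq> cbox a b \<longrightarrow>
        norm (integral (cbox a b) (\<lambda>x. if x \<in> UNIV then f (x + c) else 0) - y) < e"
      using B(1) by (intro exI[of _ "B + norm c"]) (auto simp: add_pos_nonneg)
  qed
qed

lemma integral_translate_UNIV:
  fixes f :: "'v::euclidean_space \<Rightarrow> 'b::banach"
  assumes "f integrable_on UNIV"
  shows "integral UNIV (\<lambda>x. f (x + c)) = integral UNIV f"
  using has_integral_translate_UNIV[OF integrable_integral[OF assms]] by (rule integral_unique)

section \<open>A product weight as universal dominating function\<close>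

definition weight :: "real^'n \<Rightarrow> real"
  where "weight x = (\<Prod>i\<in>UNIV. 1 / (1 + (x $ i)\<^sup>2))"

lemma weight_pos: "weight x > 0"
  by (auto simp: weight_def intro!: prod_pos add_pos_nonneg)

text \<open>The product form makes the weight integrable one coordinate at a time and fits product
  kernels; this comparison shows that decay of order \<open>2 * CARD('n)\<close> is enough to be
  dominated by it.\<close>

lemma inverse_power_le_weight:
  fixes x :: "real^'n"
  shows "1 / (1 + norm x) ^ (2 * CARD('n)) \<le> weight x"
proof -
  have "(\<Prod>i\<in>UNIV. 1 + (x $ i)\<^sup>2) \<le> (\<Prod>i\<in>(UNIV::'n set). (1 + norm x)\<^sup>2)"
  proof (rule prod_mono)
    fix i
    have "(x $ i)\<^sup>2 \<le> (norm x)\<^sup>2" by (metis abs_le_square_iff abs_norm_cancel component_le_norm_cart)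
    then show "0 \<le> 1 + (x $ i)\<^sup>2 \<and> 1 + (x $ i)\<^sup>2 \<le> (1 + norm x)\<^sup>2"
      by (simp add: power2_sum add_increasing2)
  qed
  moreover have "(\<Prod>i\<in>UNIV. 1 + (x $ i)\<^sup>2) > 0" by (auto intro!: prod_pos add_pos_nonneg)
  ultimately show ?thesis
    by (simp add: weight_def prod_dividef power_mult frac_le)
qed

lemma nn_integral_inverse_one_plus_square: "(\<integral>\<^sup>+s. ennreal (1 / (1 + s\<^sup>2)) \<partial>lborel) < \<infinity>"
proof -
  define g where "g s = ennreal (1 / (1 + s\<^sup>2)) * indicator {0..} s" for s :: real
  have [measurable]: "g \<in> borel_measurable borel" unfolding g_def by measurable
  have g: "(\<integral>\<^sup>+s. g s \<partial>lborel) = ennreal (pi / 2 - arctan 0)"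
    unfolding g_def
  proof (rule nn_integral_FTC_atLeast)
    show "(arctan has_real_derivative 1 / (1 + x\<^sup>2)) (at x)" for x
      using DERIV_arctan[of x] by (simp add: inverse_eq_divide)
    show "(arctan \<longlongrightarrow> pi / 2) at_top" by (rule tendsto_arctan_at_top)
  qed auto
  have "(\<integral>\<^sup>+s. g (- s) \<partial>lborel) = (\<integral>\<^sup>+s. g s \<partial>lborel)"
    using nn_integral_real_affine[of g "-1" 0] by simp
  then have "(\<integral>\<^sup>+s. g s + g (- s) \<partial>lborel) < \<infinity>"
    by (simp add: nn_integral_add g)
  moreover have "(\<integral>\<^sup>+s. ennreal (1 / (1 + s\<^sup>2)) \<partial>lborel) \<le> (\<integral>\<^sup>+s. g s + g (- s) \<partial>lborel)"
    by (intro nn_integral_mono) (auto simp: g_def indicator_def)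
  ultimately show ?thesis by order
qed

lemma weight_integrable: "(weight :: real^'n \<Rightarrow> real) integrable_on UNIV"
proof -
  have w: "weight x = (\<Prod>b\<in>Basis. 1 / (1 + (x \<bullet> b)\<^sup>2))" for x :: "real^'n"
  proof -
    have inj: "inj (\<lambda>i::'n. axis i (1::real))" by (auto simp: inj_def axis_eq_axis)
    have Basis: "Basis = (\<lambda>i::'n. axis i (1::real)) ` UNIV" by (auto simp: Basis_vec_def)
    show ?thesis unfolding Basis prod.reindex[OF inj] by (simp add: weight_def inner_axis)
  qed
  have "integrable lborel (weight :: real^'n \<Rightarrow> real)"
  proof (rule integrableI_bounded)
    show "(weight :: real^'n \<Rightarrow> real) \<in> borel_measurable lborel" unfolding w by measurable
    have "(\<integral>\<^sup>+x. ennreal (norm (weight (x::real^'n))) \<partial>lborel)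
        = (\<integral>\<^sup>+x. (\<Prod>b\<in>Basis. ennreal (1 / (1 + ((x::real^'n) \<bullet> b)\<^sup>2))) \<partial>lborel)"
      by (intro nn_integral_cong) (simp add: less_imp_le[OF weight_pos], simp add: w prod_ennreal)
    also have "\<dots> = (\<Prod>b\<in>(Basis :: (real^'n) set). \<integral>\<^sup>+s. ennreal (1 / (1 + s\<^sup>2)) \<partial>lborel)"
      by (rule nn_integral_lborel_prod) auto
    also have "\<dots> < \<infinity>"
      using nn_integral_inverse_one_plus_square
      by (simp only: prod_constant power_less_top_ennreal infinity_ennreal_def) simp
    finally show "(\<integral>\<^sup>+x. ennreal (norm (weight (x::real^'n))) \<partial>lborel) < \<infinity>" .
  qed
  then show ?thesis by (rule integrable_on_lborel)
qed

text \<open>Continuity gives integrability on boxes and scalar domination extends it to the whole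
  space, so measurability of vector-valued functions is never discussed.\<close>

lemma integrable_of_weight_bound:
  fixes f :: "real^'n \<Rightarrow> 'b::banach"
  assumes "continuous_on UNIV f" "\<And>x. norm (f x) \<le> B * weight x"
  shows "f integrable_on UNIV" "norm (integral UNIV f) \<le> B * integral UNIV (weight :: real^'n \<Rightarrow> real)"
proof -
  have w: "(\<lambda>x::real^'n. B * weight x) integrable_on UNIV"
    by (intro integrable_on_mult_right weight_integrable)
  show f: "f integrable_on UNIV"
  proof (rule integrable_on_all_intervals_integrable_bound[OF _ _ w])
    show "(\<lambda>x. if x \<in> UNIV then f x else 0) integrable_on cbox a b" for a b
      using assms(1) by (simp add: integrable_continuous continuous_on_subset)
  qed (use assms in auto)
  have "norm (integral UNIV f) \<le> integral UNIV (\<lambda>x::real^'n. B * weight x)"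
    by (rule Henstock_Kurzweil_Integration.integral_norm_bound_integral[OF f w]) (rule assms(2))
  then show "norm (integral UNIV f) \<le> B * integral UNIV (weight :: real^'n \<Rightarrow> real)" by simp
qed

lemma integral_weight_nonneg: "integral UNIV (weight :: real^'n \<Rightarrow> real) \<ge> 0"
  by (intro integral_nonneg weight_integrable less_imp_le[OF weight_pos])

lemma integrable_exp_minus:
  fixes G :: "real \<Rightarrow> 'b::banach"
  assumes "continuous_on {0..} G" "\<And>s. s \<ge> 0 \<Longrightarrow> norm (G s) \<le> M"
  shows "(\<lambda>s. exp (- s) *\<^sub>R G s) integrable_on {0..}"
    and "norm (integral {0..} (\<lambda>s. exp (- s) *\<^sub>R G s)) \<le> M"
proof -
  have e: "((\<lambda>s::real. exp (- s) * M) has_integral M) {0..}"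
    using has_integral_mult_left[OF has_integral_exp_minus_to_infinity[of 1 0], of M] by simp
  show i: "(\<lambda>s. exp (- s) *\<^sub>R G s) integrable_on {0..}"
  proof (rule integrable_on_all_intervals_integrable_bound)
    show "(\<lambda>s. if s \<in> {0..} then exp (- s) *\<^sub>R G s else 0) integrable_on cbox a b" for a b
    proof -
      have "{0..} \<inter> cbox a b = cbox (max 0 a) b" by auto
      moreover have "(\<lambda>s. exp (- s) *\<^sub>R G s) integrable_on cbox (max 0 a) b"
        by (intro integrable_continuous continuous_intros continuous_on_subset[OF assms(1)]) auto
      ultimately show ?thesis by (simp only: Henstock_Kurzweil_Integration.integrable_restrict_Int)
    qed
    show "(\<lambda>s. exp (- s) * M) integrable_on {0..}" using e by blast
    show "norm (exp (- s) *\<^sub>R G s) \<le> exp (- s) * M" if "s \<in> {0..}" for s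
      using that assms(2) by simp
  qed
  have "norm (integral {0..} (\<lambda>s. exp (- s) *\<^sub>R G s)) \<le> integral {0..} (\<lambda>s. exp (- s) * M)"
    using assms(2)
    by (intro Henstock_Kurzweil_Integration.integral_norm_bound_integral[OF i has_integral_integrable[OF e]]) auto
  then show "norm (integral {0..} (\<lambda>s. exp (- s) *\<^sub>R G s)) \<le> M"
    unfolding integral_unique[OF e] .
qed

text \<open>The integrand is the derivative of \<open>- (exp (- s) *\<^sub>R G s)\<close>, and the
  boundary term at infinity vanishes because \<open>G\<close> is bounded.\<close>

lemma has_integral_exp_minus_FTC:
  fixes G :: "real \<Rightarrow> 'b::banach"
  assumes G: "\<And>s. (G has_vector_derivative G' s) (at s)" and M: "\<And>s. norm (G s) \<le> M"
    and G': "continuous_on UNIV G'"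
  shows "((\<lambda>s. exp (- s) *\<^sub>R (G s - G' s)) has_integral G 0) {0..}"
proof -
  have cG: "continuous_on UNIV G"
    by (intro continuous_at_imp_continuous_on ballI has_vector_derivative_continuous[OF G])
  have fin: "((\<lambda>s. exp (- s) *\<^sub>R (G s - G' s)) has_integral G 0 - exp (- b) *\<^sub>R G b) {0..b}"
    if "b \<ge> 0" for b
  proof -
    have "((\<lambda>s. exp (- s) *\<^sub>R (G s - G' s)) has_integral
        - (exp (- b) *\<^sub>R G b) - - (exp (- 0) *\<^sub>R G 0)) {0..b}"
    proof (rule fundamental_theorem_of_calculus[OF that])
      show "((\<lambda>s. - (exp (- s) *\<^sub>R G s)) has_vector_derivative exp (- x) *\<^sub>R (G x - G' x))
          (at x within {0..b})" for x
        by (rule has_vector_derivative_at_within)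
          (auto intro!: derivative_eq_intros G simp: algebra_simps)
    qed
    then show ?thesis by simp
  qed
  have "M \<ge> 0" using M[of 0] norm_ge_zero order_trans by blast
  have box: "{0..} \<inter> cbox a b = {0..b}" if "ball 0 B \<subseteq> cbox a b" "B > 0" for a b B :: real
  proof -
    have "0 \<in> cbox a b" using that centre_in_ball by blast
    then show ?thesis by auto
  qed
  show ?thesis
    unfolding has_integral_alt'
  proof (intro conjI allI impI)
    show "(\<lambda>x. if x \<in> {0..} then exp (- x) *\<^sub>R (G x - G' x) else 0) integrable_on cbox a b" for a b
    proof -
      have "{0..} \<inter> cbox a b = cbox (max 0 a) b" by auto
      moreover have "(\<lambda>s. exp (- s) *\<^sub>R (G s - G' s)) integrable_on cbox (max 0 a) b"
        by (intro integrable_continuous continuous_intros continuous_on_subset[OF cG]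
          continuous_on_subset[OF G']) auto
      ultimately show ?thesis by (simp only: Henstock_Kurzweil_Integration.integrable_restrict_Int)
    qed
    fix e :: real
    assume "e > 0"
    \<comment> \<open>A box containing the open ball of radius \<open>B\<close> has right end at
      least \<open>B - 1/2\<close>. The logarithm makes \<open>exp (- b) * (M + 1)\<close> smaller
      than \<open>e\<close> there, and \<open>max 1\<close> keeps the right end nonnegative.\<close>
    define B where "B = max 1 (ln ((M + 1) / e) + 1)"
    have "norm (integral (cbox a b) (\<lambda>x. if x \<in> {0..} then exp (- x) *\<^sub>R (G x - G' x) else 0) - G 0) < e"
      if ab: "ball 0 B \<subseteq> cbox a b" for a b
    proof -
      have "B > 0" by (simp add: B_def)
      have "B - 1 / 2 \<in> ball 0 B" by (auto simp: B_def dist_real_def)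
      then have "B - 1/2 \<in> cbox a b" using ab by blast
      then have b: "b \<ge> B - 1/2" by simp
      have "b \<ge> 0" using b by (auto simp: B_def)
      have "ln ((M + 1) / e) < b" using b unfolding B_def by linarith
      then have "(M + 1) / e < exp b"
        using \<open>M \<ge> 0\<close> \<open>e > 0\<close> by (metis add_nonneg_pos divide_pos_pos exp_less_cancel_iff exp_ln zero_less_one)
      then have "exp (- b) * (M + 1) < e" using \<open>e > 0\<close> by (simp add: exp_minus field_simps)
      moreover have "exp (- b) * norm (G b) \<le> exp (- b) * (M + 1)" using M[of b] by (intro mult_left_mono) auto
      ultimately have "norm (exp (- b) *\<^sub>R G b) < e" unfolding norm_scaleR abs_exp_cancel by linarith
      then show ?thesis
        using integral_unique[OF fin[OF \<open>b \<ge> 0\<close>]] box[OF ab \<open>B > 0\<close>]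
        by (simp only: Henstock_Kurzweil_Integration.integral_restrict_Int) simp
    qed
    then show "\<exists>B>0. \<forall>a b. ball 0 B \<subseteq> cbox a b \<longrightarrow>
      norm (integral (cbox a b) (\<lambda>x. if x \<in> {0..} then exp (- x) *\<^sub>R (G x - G' x) else 0) - G 0) < e"
      by (intro exI[of _ B]) (auto simp: B_def)
  qed
qed

section \<open>Schwartz functions\<close>

text \<open>A relational companion of \<open>dir_deriv\<close>: \<open>vector_derivative\<close> is
  a choice operator and says nothing about existence, so existence and value are kept
  together.\<close>

definition has_dir_deriv :: "'v::euclidean_space \<Rightarrow> ('v \<Rightarrow> 'b::real_normed_vector) \<Rightarrow> ('v \<Rightarrow> 'b) \<Rightarrow> bool"
  where "has_dir_deriv v f f' \<longleftrightarrow> (\<forall>x. ((\<lambda>t. f (x + t *\<^sub>R v)) has_vector_derivative f' x) (at 0))"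

lemma has_dir_derivD:
  assumes "has_dir_deriv v f f'"
  shows "((\<lambda>t. f (x + t *\<^sub>R v)) has_vector_derivative f' (x + s *\<^sub>R v)) (at s)"
proof -
  have "((\<lambda>t. t - s) has_vector_derivative 1) (at s)"
    by (auto intro!: derivative_eq_intros)
  moreover have "((\<lambda>t. f (x + s *\<^sub>R v + t *\<^sub>R v)) has_vector_derivative f' (x + s *\<^sub>R v)) (at (s - s))"
    using assms by (simp add: has_dir_deriv_def)
  ultimately have "(((\<lambda>t. f (x + s *\<^sub>R v + t *\<^sub>R v)) \<circ> (\<lambda>t. t - s)) has_vector_derivative
      1 *\<^sub>R f' (x + s *\<^sub>R v)) (at s)"
    by (rule vector_diff_chain_at)
  then show ?thesis by (simp add: o_def algebra_simps)
qed

lemma has_dir_deriv_dir_deriv: "has_dir_deriv v f f' \<Longrightarrow> dir_deriv v f = f'"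
  by (auto simp: has_dir_deriv_def dir_deriv_def fun_eq_iff intro: vector_derivative_at)

lemma has_dir_deriv_bound:
  assumes f: "has_dir_deriv v f f'" and B: "\<And>t. \<bar>t\<bar> \<le> \<bar>s\<bar> \<Longrightarrow> norm (f' (x + t *\<^sub>R v)) \<le> B"
  shows "norm (f (x + s *\<^sub>R v) - f x) \<le> B * \<bar>s\<bar>"
proof -
  have "norm (f (x + s *\<^sub>R v) - f (x + 0 *\<^sub>R v)) \<le> B * norm (s - 0)"
  proof (rule differentiable_bound[where S = "{- \<bar>s\<bar>..\<bar>s\<bar>}" and f = "\<lambda>t. f (x + t *\<^sub>R v)"])
    fix t assume "t \<in> {- \<bar>s\<bar>..\<bar>s\<bar>}"
    then have t: "\<bar>t\<bar> \<le> \<bar>s\<bar>" by auto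
    show "((\<lambda>t. f (x + t *\<^sub>R v)) has_derivative (\<lambda>h. h *\<^sub>R f' (x + t *\<^sub>R v)))
        (at t within {- \<bar>s\<bar>..\<bar>s\<bar>})"
      using has_vector_derivative_at_within[OF has_dir_derivD[OF f]]
      by (simp add: has_vector_derivative_def)
    show "onorm (\<lambda>h. h *\<^sub>R f' (x + t *\<^sub>R v)) \<le> B"
      using B[OF t] by (intro onorm_le) (simp add: mult.commute[of B] mult_left_mono)
  qed auto
  then show ?thesis by simp
qed

lemma has_dir_deriv_diff_const:
  assumes "has_dir_deriv v f f'"
  shows "((\<lambda>t. f (x + t *\<^sub>R v) - t *\<^sub>R c) has_vector_derivative f' (x + s *\<^sub>R v) - c) (at s)"
  by (intro has_vector_derivative_diff has_dir_derivD[OF assms])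
    (simp add: has_vector_derivative_def bounded_linear_imp_has_derivative bounded_linear_scaleR_left)

lemma has_dir_deriv_remainder:
  assumes f: "has_dir_deriv v f f'"
    and B: "\<And>t. \<bar>t\<bar> \<le> \<bar>s\<bar> \<Longrightarrow> norm (f' (x + t *\<^sub>R v) - f' x) \<le> B"
  shows "norm (f (x + s *\<^sub>R v) - f x - s *\<^sub>R f' x) \<le> B * \<bar>s\<bar>"
proof -
  have "norm ((f (x + s *\<^sub>R v) - s *\<^sub>R f' x) - (f (x + 0 *\<^sub>R v) - 0 *\<^sub>R f' x)) \<le> B * norm (s - 0)"
  proof (rule differentiable_bound[where S = "{- \<bar>s\<bar>..\<bar>s\<bar>}" and f = "\<lambda>t. f (x + t *\<^sub>R v) - t *\<^sub>R f' x"])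
    fix t assume "t \<in> {- \<bar>s\<bar>..\<bar>s\<bar>}"
    then have t: "\<bar>t\<bar> \<le> \<bar>s\<bar>" by auto
    show "((\<lambda>t. f (x + t *\<^sub>R v) - t *\<^sub>R f' x) has_derivative (\<lambda>h. h *\<^sub>R (f' (x + t *\<^sub>R v) - f' x)))
        (at t within {- \<bar>s\<bar>..\<bar>s\<bar>})"
      using has_vector_derivative_at_within[OF has_dir_deriv_diff_const[OF f]]
      by (simp add: has_vector_derivative_def)
    show "onorm (\<lambda>h. h *\<^sub>R (f' (x + t *\<^sub>R v) - f' x)) \<le> B"
      using B[OF t] by (intro onorm_le) (simp add: mult.commute[of B] mult_left_mono)
  qed auto
  then show ?thesis by (simp add: algebra_simps)
qed

lemma has_dir_deriv_taylor:
  assumes f: "has_dir_deriv v f f'" and f': "has_dir_deriv v f' f''"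
    and B: "\<And>t. \<bar>t\<bar> \<le> \<bar>s\<bar> \<Longrightarrow> norm (f'' (x + t *\<^sub>R v)) \<le> B"
  shows "norm (f (x + s *\<^sub>R v) - f x - s *\<^sub>R f' x) \<le> B * s\<^sup>2"
proof -
  have "B \<ge> 0" by (rule order_trans[OF norm_ge_zero B[of 0]]) simp
  have "norm (f (x + s *\<^sub>R v) - f x - s *\<^sub>R f' x) \<le> (B * \<bar>s\<bar>) * \<bar>s\<bar>"
  proof (rule has_dir_deriv_remainder[OF f])
    fix t assume t: "\<bar>t\<bar> \<le> \<bar>s\<bar>"
    have "norm (f' (x + t *\<^sub>R v) - f' x) \<le> B * \<bar>t\<bar>"
      using t by (intro has_dir_deriv_bound[OF f'] B) simp
    also have "\<dots> \<le> B * \<bar>s\<bar>" using t \<open>B \<ge> 0\<close> by (rule mult_left_mono)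
    finally show "norm (f' (x + t *\<^sub>R v) - f' x) \<le> B * \<bar>s\<bar>" .
  qed
  then show ?thesis by (simp add: power2_eq_square mult.assoc)
qed

text \<open>Explicit quadratic remainders survive bounded operations such as the resolvent and
  \<open>\<iota>\<close>. Differentiation under them is reduced to this criterion instead of a
  dominated convergence theorem.\<close>

lemma has_vector_derivative_quadratic:
  fixes F :: "real \<Rightarrow> 'b::real_normed_vector"
  assumes "\<And>t. \<bar>t\<bar> \<le> 1 \<Longrightarrow> norm (F t - F 0 - t *\<^sub>R D) \<le> B * t\<^sup>2"
  shows "(F has_vector_derivative D) (at 0)"
  unfolding has_vector_derivative_def has_derivative_at_alt
proof (intro conjI allI impI)
  show "bounded_linear (\<lambda>h. h *\<^sub>R D)" by (rule bounded_linear_scaleR_left)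
  fix e :: real
  assume e: "e > 0"
  define d where "d = min 1 (e / (\<bar>B\<bar> + 1))"
  have "norm (F t - F 0 - (t - 0) *\<^sub>R D) \<le> e * norm (t - 0)" if "norm (t - 0) < d" for t
  proof -
    have t: "\<bar>t\<bar> \<le> 1" "\<bar>t\<bar> \<le> e / (\<bar>B\<bar> + 1)" using that by (auto simp: d_def)
    have "norm (F t - F 0 - t *\<^sub>R D) \<le> B * t\<^sup>2" by (rule assms[OF t(1)])
    also have "\<dots> \<le> ((\<bar>B\<bar> + 1) * \<bar>t\<bar>) * \<bar>t\<bar>"
      using mult_right_mono[of B "\<bar>B\<bar> + 1" "t\<^sup>2"] by (simp add: power2_eq_square mult.assoc)
    also have "\<dots> \<le> e * \<bar>t\<bar>"
      using t(2) by (intro mult_right_mono) (auto simp: field_simps)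
    finally show ?thesis by simp
  qed
  then show "\<exists>d>0. \<forall>y. norm (y - 0) < d \<longrightarrow> norm (F y - F 0 - (y - 0) *\<^sub>R D) \<le> e * norm (y - 0)"
    using e by (intro exI[of _ d]) (auto simp: d_def)
qed

text \<open>The path from \<open>x\<close> to \<open>x + h\<close> changes one coordinate at a time.
  Its points may leave the ball of radius \<open>norm h\<close> around \<open>x\<close>, which is
  why the bound is required on a ball larger by the factor \<open>DIM('v)\<close>.\<close>

lemma lipschitz_of_dir_derivs:
  fixes f :: "'v::euclidean_space \<Rightarrow> 'b::real_normed_vector"
  assumes f: "\<And>v. v \<in> Basis \<Longrightarrow> has_dir_deriv v f (F v)"
    and B: "\<And>v y. v \<in> Basis \<Longrightarrow> norm (y - x) \<le> DIM('v) * norm h \<Longrightarrow> norm (F v y) \<le> B"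
  shows "norm (f (x + h) - f x) \<le> B * (DIM('v) * norm h)"
proof -
  have B0: "B \<ge> 0"
    using B[OF SOME_Basis, of x] norm_ge_zero order_trans by (metis diff_self mult_nonneg_nonneg norm_zero of_nat_0_le_iff)
  have *: "norm (f (x + (\<Sum>b\<in>I. (h \<bullet> b) *\<^sub>R b)) - f x) \<le> B * (\<Sum>b\<in>I. \<bar>h \<bullet> b\<bar>)" if "I \<subseteq> Basis" for I
    using finite_subset[OF that finite_Basis] that
  proof (induction I rule: finite_induct)
    case (insert b I)
    define z where "z = x + (\<Sum>b\<in>I. (h \<bullet> b) *\<^sub>R b)"
    have "norm (f (z + (h \<bullet> b) *\<^sub>R b) - f z) \<le> B * \<bar>h \<bullet> b\<bar>"
    proof (rule has_dir_deriv_bound[OF f])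
      show "b \<in> Basis" using insert by auto
      fix t assume t: "\<bar>t\<bar> \<le> \<bar>h \<bullet> b\<bar>"
      have "norm (z + t *\<^sub>R b - x) \<le> norm (\<Sum>b\<in>I. (h \<bullet> b) *\<^sub>R b) + \<bar>t\<bar> * norm b"
        unfolding z_def using norm_triangle_ineq[of "\<Sum>b\<in>I. (h \<bullet> b) *\<^sub>R b" "t *\<^sub>R b"]
        by (simp add: algebra_simps)
      also have "\<dots> \<le> (\<Sum>b\<in>I. norm h) + norm h"
      proof (intro add_mono sum_norm_le)
        show "norm ((h \<bullet> c) *\<^sub>R c) \<le> norm h" if "c \<in> I" for c
          using that insert.prems by (auto simp: Basis_le_norm)
        have "\<bar>t\<bar> * norm b \<le> \<bar>h \<bullet> b\<bar> * 1" using t insert.prems by (intro mult_mono) auto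
        then show "\<bar>t\<bar> * norm b \<le> norm h" using Basis_le_norm[of b h] insert.prems by auto
      qed
      also have "\<dots> = card (insert b I) * norm h" using insert by (simp add: algebra_simps)
      also have "\<dots> \<le> DIM('v) * norm h"
        using card_mono[OF finite_Basis insert.prems] by (intro mult_right_mono) auto
      finally show "norm (F b (z + t *\<^sub>R b)) \<le> B" using insert.prems by (intro B) auto
    qed
    then have "norm (f (z + (h \<bullet> b) *\<^sub>R b) - f x) \<le> B * \<bar>h \<bullet> b\<bar> + B * (\<Sum>b\<in>I. \<bar>h \<bullet> b\<bar>)"
      using insert.IH insert.prems norm_triangle_ineq[of "f (z + (h \<bullet> b) *\<^sub>R b) - f z" "f z - f x"]
      by (simp add: z_def)
    moreover have "z + (h \<bullet> b) *\<^sub>R b = x + (\<Sum>b\<in>insert b I. (h \<bullet> b) *\<^sub>R b)"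
      using insert.hyps by (simp add: z_def algebra_simps)
    ultimately show ?case using insert.hyps by (simp add: algebra_simps)
  qed simp
  have "norm (f (x + h) - f x) \<le> B * (\<Sum>b\<in>Basis. \<bar>h \<bullet> b\<bar>)"
    using *[OF order_refl] by (simp add: euclidean_representation)
  also have "\<dots> \<le> B * (DIM('v) * norm h)"
    using B0 sum_bounded_above[of Basis "\<lambda>b. \<bar>h \<bullet> b\<bar>" "norm h"]
    by (intro mult_left_mono) (auto simp: Basis_le_norm)
  finally show ?thesis .
qed

text \<open>Partial derivatives alone do not imply continuity, but locally bounded ones do. This
  spares the coinductions below a separate continuity argument.\<close>

lemma continuous_of_dir_derivs:
  fixes f :: "'v::euclidean_space \<Rightarrow> 'b::real_normed_vector"
  assumes f: "\<And>v. v \<in> Basis \<Longrightarrow> \<exists>f'. has_dir_deriv v f f' \<and> (\<forall>R. \<exists>B. \<forall>y. norm y \<le> R \<longrightarrow> norm (f' y) \<le> B)"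
  shows "continuous_on UNIV f"
proof (rule continuous_at_imp_continuous_on, rule ballI)
  fix x :: 'v
  obtain F where F: "\<And>v. v \<in> Basis \<Longrightarrow> has_dir_deriv v f (F v)"
      "\<And>v R. v \<in> Basis \<Longrightarrow> \<exists>B. \<forall>y. norm y \<le> R \<longrightarrow> norm (F v y) \<le> B"
    using f by metis
  have "\<forall>v\<in>Basis. \<exists>B. \<forall>y. norm y \<le> norm x + DIM('v) \<longrightarrow> norm (F v y) \<le> B" using F(2) by blast
  from bchoice[OF this] obtain b
    where b: "\<And>v y. v \<in> Basis \<Longrightarrow> norm y \<le> norm x + DIM('v) \<Longrightarrow> norm (F v y) \<le> b v" by blast
  define B where "B = (\<Sum>v\<in>Basis. \<bar>b v\<bar>)"
  have B: "norm (F v y) \<le> B" if "v \<in> Basis" "norm y \<le> norm x + DIM('v)" for v y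
    using b[OF that] member_le_sum[of v Basis "\<lambda>v. \<bar>b v\<bar>"] that by (auto simp: B_def)
  have lip: "norm (f (x + h) - f x) \<le> B * (DIM('v) * norm h)" if "norm h \<le> 1" for h
  proof (rule lipschitz_of_dir_derivs[OF F(1)])
    fix v y :: 'v assume v: "v \<in> Basis" and y: "norm (y - x) \<le> DIM('v) * norm h"
    have "DIM('v) * norm h \<le> DIM('v)" using that by (simp add: mult_left_le)
    then show "norm (F v y) \<le> B" using y norm_triangle_sub[of y x] by (intro B v) linarith
  qed
  have "((\<lambda>h. f (x + h) - f x) \<longlongrightarrow> 0) (at 0)"
  proof (rule Lim_null_comparison)
    show "\<forall>\<^sub>F h in at 0. norm (f (x + h) - f x) \<le> B * (DIM('v) * norm h)"
      unfolding eventually_at by (rule exI[of _ 1]) (auto intro: lip)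
    have "((\<lambda>h::'v. B * (DIM('v) * norm h)) \<longlongrightarrow> B * (DIM('v) * norm (0::'v))) (at 0)"
      by (intro tendsto_intros)
    then show "((\<lambda>h::'v. B * (DIM('v) * norm h)) \<longlongrightarrow> 0) (at 0)" by simp
  qed
  then show "isCont f x" by (simp add: isCont_iff LIM_zero_iff)
qed

section \<open>Smoothness and rapid decay by coinduction\<close>

lemma iter_partial_append: "iter_partial (vs @ [v]) f = iter_partial vs (dir_deriv v f)"
  by (induction vs) simp_all

lemma smooth_mapD:
  assumes "smooth_map f" "v \<in> Basis"
  shows "has_dir_deriv v f (dir_deriv v f)" "smooth_map (dir_deriv v f)"
proof -
  have "(\<lambda>t. f (x + t *\<^sub>R v)) differentiable (at 0)" for x
    using assms unfolding smooth_map_def by (force dest: spec[of _ "[]"])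
  then show "has_dir_deriv v f (dir_deriv v f)"
    by (simp add: has_dir_deriv_def dir_deriv_def vector_derivative_works)
  show "smooth_map (dir_deriv v f)"
    unfolding smooth_map_def iter_partial_append[symmetric]
    using assms unfolding smooth_map_def by simp
qed

lemma smooth_map_continuous: "smooth_map f \<Longrightarrow> continuous_on UNIV f"
  unfolding smooth_map_def by (force dest: spec[of _ "[]"])

text \<open>\<open>X\<close> acts as a bisimulation: once a class is closed under partial
  derivatives, nothing has to be computed about higher ones. Each smoothness proof below amounts to
  the choice of a suitable \<open>X\<close>.\<close>

lemma iter_partial_coinduct:
  assumes "X f" "\<And>f v. X f \<Longrightarrow> v \<in> Basis \<Longrightarrow> \<exists>f'. X f' \<and> has_dir_deriv v f f'" "set vs \<subseteq> Basis"
  shows "X (iter_partial vs f)"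
  using assms(3)
proof (induction vs)
  case (Cons v vs)
  then obtain f' where "X f'" "has_dir_deriv v (iter_partial vs f) f'"
    using assms(2)[of "iter_partial vs f" v] by auto
  then show ?case by (simp add: has_dir_deriv_dir_deriv)
qed (simp add: assms(1))

lemma smooth_map_coinduct:
  assumes f: "X f" and X: "\<And>f v. X f \<Longrightarrow> v \<in> Basis \<Longrightarrow> \<exists>f'. X f' \<and> has_dir_deriv v f f'"
    and c: "\<And>f. X f \<Longrightarrow> continuous_on UNIV f"
  shows "smooth_map f"
  unfolding smooth_map_def
proof (intro allI impI conjI ballI)
  fix vs :: "'a list" assume "set vs \<subseteq> Basis"
  then have *: "X (iter_partial vs f)" by (intro iter_partial_coinduct[where X = X and f = f and vs = vs, OF f X])
  then show "continuous_on UNIV (iter_partial vs f)" by (rule c)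
  fix v x :: 'a assume "v \<in> Basis"
  then show "(\<lambda>t. iter_partial vs f (x + t *\<^sub>R v)) differentiable (at 0)"
    using X[OF *, of v] by (auto simp: has_dir_deriv_def intro: differentiableI_vector)
qed

definition rapidly_decreasing :: "('v::euclidean_space \<Rightarrow> 'b::real_normed_vector) \<Rightarrow> bool"
  where "rapidly_decreasing f \<longleftrightarrow> (\<forall>k. \<exists>B. \<forall>x. (1 + norm x) ^ k * norm (f x) \<le> B)"

lemma schwartz_alt:
  fixes f :: "real^'n \<Rightarrow> 'b::real_normed_vector"
  shows "schwartz f \<longleftrightarrow> smooth_map f \<and> (\<forall>vs. set vs \<subseteq> Basis \<longrightarrow> rapidly_decreasing (iter_partial vs f))"
proof -
  have "(1 + norm x) ^ k * norm (g x) = norm ((1 + norm x) ^ k *\<^sub>R g x)" for k x and g :: "real^'n \<Rightarrow> 'b"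
    by (simp add: add_nonneg_nonneg)
  then show ?thesis
    unfolding schwartz_def rapidly_decreasing_def bounded_iff by auto
qed

lemma rapidly_decreasing_bounded:
  "rapidly_decreasing f \<Longrightarrow> \<exists>B. \<forall>x. norm (f x) \<le> B"
  unfolding rapidly_decreasing_def by (drule spec[of _ 0]) simp

text \<open>Rapid decay bounds the first derivatives globally, hence continuity is automatic and
  only closure under derivatives and decay remain to be checked.\<close>

lemma schwartz_coinduct:
  assumes f: "X f" and X: "\<And>f v. X f \<Longrightarrow> v \<in> Basis \<Longrightarrow> \<exists>f'. X f' \<and> has_dir_deriv v f f'"
    and r: "\<And>f. X f \<Longrightarrow> rapidly_decreasing f"
  shows "schwartz f"
  unfolding schwartz_alt
proof (intro conjI allI impI)
  show "smooth_map f"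
  proof (rule smooth_map_coinduct[where X = X, OF f X])
    fix f assume "X f"
    then show "continuous_on UNIV f"
    proof (intro continuous_of_dir_derivs)
      fix v :: "real^'a" assume "v \<in> Basis"
      then obtain f' where f': "X f'" "has_dir_deriv v f f'" using X \<open>X f\<close> by blast
      then show "\<exists>f'. has_dir_deriv v f f' \<and> (\<forall>R. \<exists>B. \<forall>y. norm y \<le> R \<longrightarrow> norm (f' y) \<le> B)"
        using rapidly_decreasing_bounded[OF r[OF f'(1)]] by blast
    qed
  qed
  show "rapidly_decreasing (iter_partial vs f)" if "set vs \<subseteq> Basis" for vs
    by (rule r, rule iter_partial_coinduct[where X = X, OF f X that])
qed

lemma schwartzD:
  assumes "schwartz f"
  shows "rapidly_decreasing f" "continuous_on UNIV f"
    "v \<in> Basis \<Longrightarrow> has_dir_deriv v f (dir_deriv v f)" "v \<in> Basis \<Longrightarrow> schwartz (dir_deriv v f)"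
proof -
  have *: "smooth_map f" "\<And>vs. set vs \<subseteq> Basis \<Longrightarrow> rapidly_decreasing (iter_partial vs f)"
    using assms by (auto simp: schwartz_alt)
  show "rapidly_decreasing f" using *(2)[of "[]"] by simp
  show "continuous_on UNIV f" using * by (simp add: smooth_map_continuous)
  assume v: "v \<in> Basis"
  show "has_dir_deriv v f (dir_deriv v f)" by (rule smooth_mapD[OF *(1) v])
  show "schwartz (dir_deriv v f)"
    unfolding schwartz_alt iter_partial_append[symmetric]
    using *(2) v by (auto intro: smooth_mapD[OF *(1)])
qed



lemma rapidly_decreasing_add:
  assumes "rapidly_decreasing f" "rapidly_decreasing g"
  shows "rapidly_decreasing (\<lambda>x. f x + g x)"
  unfolding rapidly_decreasing_def
proof
  fix k
  obtain A B where "\<And>x. (1 + norm x) ^ k * norm (f x) \<le> A" "\<And>x. (1 + norm x) ^ k * norm (g x) \<le> B"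
    using assms unfolding rapidly_decreasing_def by metis
  moreover have "(1 + norm x) ^ k * norm (f x + g x)
      \<le> (1 + norm x) ^ k * norm (f x) + (1 + norm x) ^ k * norm (g x)" for x
    unfolding distrib_left[symmetric] by (intro mult_left_mono norm_triangle_ineq) simp
  ultimately show "\<exists>B. \<forall>x. (1 + norm x) ^ k * norm (f x + g x) \<le> B"
    by (intro exI[of _ "A + B"]) (meson add_mono order_trans)
qed

lemma has_dir_deriv_add:
  "has_dir_deriv v f f' \<Longrightarrow> has_dir_deriv v g g' \<Longrightarrow> has_dir_deriv v (\<lambda>x. f x + g x) (\<lambda>x. f' x + g' x)"
  unfolding has_dir_deriv_def by (simp add: has_vector_derivative_add)

lemma smooth_map_add:
  assumes "smooth_map f" "smooth_map g"
  shows "smooth_map (\<lambda>x. f x + g x)"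
proof (rule smooth_map_coinduct[where X = "\<lambda>h. \<exists>f g. smooth_map f \<and> smooth_map g \<and> h = (\<lambda>x. f x + g x)"])
  show "\<exists>h'. (\<exists>f g. smooth_map f \<and> smooth_map g \<and> h' = (\<lambda>x. f x + g x)) \<and> has_dir_deriv v h h'"
    if "\<exists>f g. smooth_map f \<and> smooth_map g \<and> h = (\<lambda>x. f x + g x)" "v \<in> Basis" for h v
    using that smooth_mapD has_dir_deriv_add by metis
qed (use assms smooth_map_continuous in \<open>auto intro: continuous_on_add\<close>)

lemma schwartz_add:
  assumes "schwartz f" "schwartz g"
  shows "schwartz (\<lambda>x. f x + g x)"
proof (rule schwartz_coinduct[where X = "\<lambda>h. \<exists>f g. schwartz f \<and> schwartz g \<and> h = (\<lambda>x. f x + g x)"])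
  show "\<exists>h'. (\<exists>f g. schwartz f \<and> schwartz g \<and> h' = (\<lambda>x. f x + g x)) \<and> has_dir_deriv v h h'"
    if "\<exists>f g. schwartz f \<and> schwartz g \<and> h = (\<lambda>x. f x + g x)" "v \<in> Basis" for h v
    using that schwartzD has_dir_deriv_add by metis
qed (use assms in \<open>auto intro: rapidly_decreasing_add schwartzD(1)\<close>)

lemma one_plus_norm_mult: "1 + norm (x + y :: 'v::real_normed_vector) \<le> (1 + norm x) * (1 + norm y)"
  using norm_triangle_ineq[of x y] mult_nonneg_nonneg[OF norm_ge_zero[of x] norm_ge_zero[of y]]
  unfolding distrib_left distrib_right by linarith

text \<open>A Peetre-type inequality: polynomial weights are submultiplicative, so a translation
  costs only a constant factor in decay estimates.\<close>

lemma one_plus_norm_power_mult: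
  "(1 + norm (x + y :: 'v::real_normed_vector)) ^ k \<le> (1 + norm x) ^ k * (1 + norm y) ^ k"
  unfolding power_mult_distrib[symmetric] by (intro power_mono one_plus_norm_mult) simp

lemma schwartz_translate:
  fixes f :: "real^'n \<Rightarrow> 'b::real_normed_vector"
  assumes "schwartz f"
  shows "schwartz (\<lambda>x. f (x - a))"
proof (rule schwartz_coinduct[where X = "\<lambda>h. \<exists>f. schwartz f \<and> h = (\<lambda>x. f (x - a))"])
  fix h :: "real^'n \<Rightarrow> 'b" and v :: "real^'n"
  assume "\<exists>f. schwartz f \<and> h = (\<lambda>x. f (x - a))" "v \<in> Basis"
  then obtain f where f: "schwartz f" "h = (\<lambda>x. f (x - a))" "has_dir_deriv v f (dir_deriv v f)"
    "schwartz (dir_deriv v f)" using schwartzD by blast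
  have "has_dir_deriv v h (\<lambda>x. dir_deriv v f (x - a))"
    using f(3) unfolding has_dir_deriv_def f(2) by (auto simp: algebra_simps dest: spec[of _ "_ - a"])
  with f(4) show "\<exists>h'. (\<exists>f. schwartz f \<and> h' = (\<lambda>x. f (x - a))) \<and> has_dir_deriv v h h'" by blast
next
  fix h :: "real^'n \<Rightarrow> 'b"
  assume "\<exists>f. schwartz f \<and> h = (\<lambda>x. f (x - a))"
  then obtain f where f: "rapidly_decreasing f" "h = (\<lambda>x. f (x - a))" using schwartzD by blast
  show "rapidly_decreasing h" unfolding rapidly_decreasing_def
  proof
    fix k
    obtain B where B: "\<And>x. (1 + norm x) ^ k * norm (f x) \<le> B"
      using f(1) unfolding rapidly_decreasing_def by metis
    have "(1 + norm x) ^ k * norm (h x) \<le> (1 + norm a) ^ k * B" for x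
    proof -
      have "(1 + norm x) ^ k \<le> (1 + norm a) ^ k * (1 + norm (x - a)) ^ k"
        using one_plus_norm_power_mult[of a "x - a" k] by simp
      then have "(1 + norm x) ^ k * norm (h x) \<le> (1 + norm a) ^ k * ((1 + norm (x - a)) ^ k * norm (h x))"
        using mult_right_mono norm_ge_zero by (fastforce simp: mult.assoc)
      also have "\<dots> \<le> (1 + norm a) ^ k * B" using B[of "x - a"] by (intro mult_left_mono) (auto simp: f(2))
      finally show ?thesis .
    qed
    then show "\<exists>B. \<forall>x. (1 + norm x) ^ k * norm (h x) \<le> B" by blast
  qed
qed (use assms in blast)

section \<open>Inverting \<open>1 + \<partial>\<close> on Schwartz functions\<close>

text \<open>The Laplace transform at \<open>1\<close> of the translation semigroup, that is, the
  inverse of \<open>1 + \<partial>\<close> in the direction \<open>v\<close>.\<close>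

definition resolvent :: "'v::euclidean_space \<Rightarrow> ('v \<Rightarrow> 'b::banach) \<Rightarrow> 'v \<Rightarrow> 'b"
  where "resolvent v g x = integral {0..} (\<lambda>s. exp (- s) *\<^sub>R g (x - s *\<^sub>R v))"

lemma resolvent_integrable:
  assumes g: "continuous_on UNIV g" and M: "\<And>x. norm (g x) \<le> M"
  shows "(\<lambda>s. exp (- s) *\<^sub>R g (x - s *\<^sub>R v)) integrable_on {0..}" "norm (resolvent v g x) \<le> M"
proof -
  have "continuous_on {0..} (\<lambda>s. g (x - s *\<^sub>R v))"
    by (rule continuous_on_compose2[OF g]) (auto intro!: continuous_intros)
  from integrable_exp_minus[OF this, of M] M
  show "(\<lambda>s. exp (- s) *\<^sub>R g (x - s *\<^sub>R v)) integrable_on {0..}" "norm (resolvent v g x) \<le> M"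
    by (auto simp: resolvent_def)
qed

lemma schwartz_bounded: "schwartz g \<Longrightarrow> \<exists>M. \<forall>x. norm (g x) \<le> M"
  using schwartzD(1) rapidly_decreasing_bounded by blast

lemma schwartz_resolvent_integrable:
  fixes g :: "real^'n \<Rightarrow> 'b::banach"
  assumes "schwartz g"
  shows "(\<lambda>s. exp (- s) *\<^sub>R g (x - s *\<^sub>R v)) integrable_on {0..}"
proof -
  obtain M where "\<And>x. norm (g x) \<le> M" using schwartz_bounded[OF assms] by blast
  then show ?thesis by (rule resolvent_integrable(1)[OF schwartzD(2)[OF assms]])
qed

text \<open>The resolvent is linear and does not increase supremum bounds, so the uniform Taylor
  remainder of \<open>g\<close> carries over with the same constant.\<close>

lemma resolvent_has_dir_deriv:
  assumes g: "schwartz g" and w: "w \<in> Basis"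
  shows "has_dir_deriv w (resolvent v g) (resolvent v (dir_deriv w g))"
proof -
  let ?g1 = "dir_deriv w g" and ?g2 = "dir_deriv w (dir_deriv w g)"
  have g1: "has_dir_deriv w g ?g1" "schwartz ?g1" using g w by (rule schwartzD)+
  have g2: "has_dir_deriv w ?g1 ?g2" "schwartz ?g2" using g1(2) w by (rule schwartzD)+
  obtain B where B: "\<And>x. norm (?g2 x) \<le> B" using schwartz_bounded[OF g2(2)] by blast
  have "norm (resolvent v g (x + t *\<^sub>R w) - resolvent v g x - t *\<^sub>R resolvent v ?g1 x) \<le> B * t\<^sup>2" for x t
  proof -
    define h where "h y = g (y + t *\<^sub>R w) - g y - t *\<^sub>R ?g1 y" for y
    have "continuous_on UNIV (\<lambda>y. g (y + t *\<^sub>R w))"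
      by (rule continuous_on_compose2[OF schwartzD(2)[OF g]]) (auto intro!: continuous_intros)
    then have "continuous_on UNIV h"
      unfolding h_def
      by (intro continuous_on_diff continuous_on_scaleR continuous_on_const
        schwartzD(2)[OF g] schwartzD(2)[OF g1(2)])
    moreover have "norm (h y) \<le> B * t\<^sup>2" for y
      unfolding h_def by (rule has_dir_deriv_taylor[OF g1(1) g2(1) B])
    ultimately have "norm (resolvent v h x) \<le> B * t\<^sup>2" by (rule resolvent_integrable)
    moreover have "((\<lambda>s. exp (- s) *\<^sub>R g (x + t *\<^sub>R w - s *\<^sub>R v) - exp (- s) *\<^sub>R g (x - s *\<^sub>R v)
        - t *\<^sub>R (exp (- s) *\<^sub>R ?g1 (x - s *\<^sub>R v)))
        has_integral resolvent v g (x + t *\<^sub>R w) - resolvent v g x - t *\<^sub>R resolvent v ?g1 x) {0..}"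
      unfolding resolvent_def
      by (intro has_integral_diff has_integral_cmul integrable_integral schwartz_resolvent_integrable g g1)
    then have "resolvent v h x = resolvent v g (x + t *\<^sub>R w) - resolvent v g x - t *\<^sub>R resolvent v ?g1 x"
      unfolding resolvent_def[of v h] by (intro integral_unique) (simp add: h_def algebra_simps)
    ultimately show ?thesis by simp
  qed
  then show ?thesis
    unfolding has_dir_deriv_def
    by (intro allI has_vector_derivative_quadratic[where B = B]) simp
qed

text \<open>Along the ray \<open>x - s *\<^sub>R v\<close> the derivative of \<open>g\<close> is
  minus its directional derivative, so the exponential fundamental theorem applies with boundary
  value \<open>g x\<close>. Combined with the previous lemma this shows that
  \<open>1 + \<partial>\<close> takes the resolvent of \<open>g\<close> back to
  \<open>g\<close>.\<close>

lemma resolvent_inverse: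
  assumes g: "schwartz g" and v: "v \<in> Basis"
  shows "resolvent v (dir_deriv v g) x = g x - resolvent v g x"
proof -
  let ?g1 = "dir_deriv v g"
  have g1: "has_dir_deriv v g ?g1" "schwartz ?g1" using g v by (rule schwartzD)+
  obtain B where B: "\<And>x. norm (g x) \<le> B" using schwartz_bounded[OF g] by blast
  have "((\<lambda>s. exp (- s) *\<^sub>R (g (x - s *\<^sub>R v) - - ?g1 (x - s *\<^sub>R v))) has_integral g (x - 0 *\<^sub>R v)) {0..}"
  proof (rule has_integral_exp_minus_FTC[OF _ B])
    show "((\<lambda>s. g (x - s *\<^sub>R v)) has_vector_derivative - ?g1 (x - s *\<^sub>R v)) (at s)" for s
    proof -
      have "((\<lambda>s. - s) has_vector_derivative - 1) (at s)" by (auto intro!: derivative_eq_intros)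
      from vector_diff_chain_at[OF this, OF has_dir_derivD[OF g1(1), of x "- s"]]
      show ?thesis by (simp add: o_def)
    qed
    show "continuous_on UNIV (\<lambda>s. - ?g1 (x - s *\<^sub>R v))"
      by (intro continuous_on_minus continuous_on_compose2[OF schwartzD(2)[OF g1(2)]])
        (auto intro!: continuous_intros)
  qed
  then have "integral {0..} (\<lambda>s. exp (- s) *\<^sub>R g (x - s *\<^sub>R v) + exp (- s) *\<^sub>R ?g1 (x - s *\<^sub>R v)) = g x"
    by (intro integral_unique) (simp add: scaleR_add_right)
  then show ?thesis
    unfolding resolvent_def
    by (subst (asm) integral_add) (auto intro: schwartz_resolvent_integrable g g1 simp: algebra_simps)
qed

text \<open>The estimate \<open>y \<le> exp y\<close> for \<open>y = (1 + s) / (2 * k)\<close>,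
  raised to the power \<open>k\<close>. Only half of the exponential is spent on the polynomial
  weight, so the other half remains integrable.\<close>

lemma power_le_exp_half:
  fixes s :: real
  assumes "s \<ge> 0"
  shows "(1 + s) ^ k \<le> (2 * real k) ^ k * exp ((1 + s) / 2)"
proof (cases "k = 0")
  case False
  have "(1 + s) / (2 * k) \<le> exp ((1 + s) / (2 * k))"
    using exp_ge_add_one_self[of "(1 + s) / (2 * k)"] by linarith
  then have "((1 + s) / (2 * k)) ^ k \<le> exp ((1 + s) / (2 * k)) ^ k"
    using assms by (intro power_mono) auto
  also have "\<dots> = exp ((1 + s) / 2)" using False by (simp flip: exp_of_nat_mult)
  finally show ?thesis using False by (simp add: power_divide power_mult_distrib field_simps)
qed (use assms in simp)

lemma resolvent_rapidly_decreasing: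
  assumes g: "schwartz g" and v: "norm v = 1"
  shows "rapidly_decreasing (resolvent v g)"
  unfolding rapidly_decreasing_def
proof
  fix k
  obtain B where B: "\<And>x. (1 + norm x) ^ k * norm (g x) \<le> B"
    using schwartzD(1)[OF g] unfolding rapidly_decreasing_def by metis
  have B0: "B \<ge> 0" by (rule order_trans[OF _ B[of 0]]) simp
  \<comment> \<open>\<open>exp (1/2)\<close> is the excess of \<open>exp ((1 + s) / 2)\<close> over
    \<open>exp (s / 2)\<close>; the later factor \<open>2\<close> is the integral of
    \<open>exp (- s / 2)\<close>.\<close>
  define C where "C = (2 * real k) ^ k * exp (1/2) * B"
  have e: "((\<lambda>s::real. C * exp (- (1/2) * s)) has_integral C * 2) {0..}"
    using has_integral_mult_right[OF has_integral_exp_minus_to_infinity[of "1/2" 0], of C] by simp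
  have "(1 + norm x) ^ k * norm (resolvent v g x) \<le> C * 2" for x
  proof -
    have "norm (integral {0..} (\<lambda>s. (1 + norm x) ^ k *\<^sub>R (exp (- s) *\<^sub>R g (x - s *\<^sub>R v))))
        \<le> integral {0..} (\<lambda>s. C * exp (- (1/2) * s))"
    proof (rule Henstock_Kurzweil_Integration.integral_norm_bound_integral)
      show "(\<lambda>s. (1 + norm x) ^ k *\<^sub>R (exp (- s) *\<^sub>R g (x - s *\<^sub>R v))) integrable_on {0..}"
        by (intro integrable_cmul schwartz_resolvent_integrable g)
      show "(\<lambda>s. C * exp (- (1/2) * s)) integrable_on {0..}" using e by blast
      fix s :: real assume "s \<in> {0..}"
      then have s: "s \<ge> 0" by simp
      have "(1 + norm x) ^ k * (exp (- s) * norm (g (x - s *\<^sub>R v)))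
          \<le> ((1 + norm (x - s *\<^sub>R v)) ^ k * (1 + s) ^ k) * (exp (- s) * norm (g (x - s *\<^sub>R v)))"
        using one_plus_norm_power_mult[of "x - s *\<^sub>R v" "s *\<^sub>R v" k] v s
        by (intro mult_right_mono) auto
      also have "\<dots> = exp (- s) * (1 + s) ^ k * ((1 + norm (x - s *\<^sub>R v)) ^ k * norm (g (x - s *\<^sub>R v)))"
        by (simp add: mult_ac)
      also have "\<dots> \<le> exp (- s) * ((2 * real k) ^ k * exp ((1 + s) / 2)) * B"
        using power_le_exp_half[OF s] B s B0 by (intro mult_mono) auto
      also have "\<dots> = C * exp (- (1/2) * s)"
        by (simp add: C_def mult_ac flip: exp_add)
      finally show "norm ((1 + norm x) ^ k *\<^sub>R exp (- s) *\<^sub>R g (x - s *\<^sub>R v)) \<le> C * exp (- (1/2) * s)"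
        by simp
    qed
    then show ?thesis
      unfolding integral_unique[OF e] resolvent_def Henstock_Kurzweil_Integration.integral_cmul by simp
  qed
  then show "\<exists>B. \<forall>x. (1 + norm x) ^ k * norm (resolvent v g x) \<le> B" by blast
qed

lemma schwartz_resolvent:
  assumes "schwartz g" and v: "v \<in> Basis"
  shows "schwartz (resolvent v g)"
proof (rule schwartz_coinduct[where X = "\<lambda>u. \<exists>g. schwartz g \<and> u = resolvent v g"])
  show "\<exists>u'. (\<exists>g. schwartz g \<and> u' = resolvent v g) \<and> has_dir_deriv w u u'"
    if "\<exists>g. schwartz g \<and> u = resolvent v g" "w \<in> Basis" for u w
    using that schwartzD(4) resolvent_has_dir_deriv by metis
  show "rapidly_decreasing u" if "\<exists>g. schwartz g \<and> u = resolvent v g" for u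
    using that v resolvent_rapidly_decreasing by force
qed (use assms in blast)

section \<open>Tempered multipliers\<close>

inductive tempered :: "(real^'n \<Rightarrow> complex) \<Rightarrow> bool" where
  tempered_const: "tempered (\<lambda>x. c)"
| tempered_coord: "tempered (\<lambda>x. of_real (x $ i))"
| tempered_cis: "tempered (\<lambda>x. cis (b \<bullet> x))"
| tempered_inverse: "tempered (\<lambda>x. 1 / (1 - \<i> * of_real (x $ i)))"
| tempered_add: "tempered m \<Longrightarrow> tempered m' \<Longrightarrow> tempered (\<lambda>x. m x + m' x)"
| tempered_mult: "tempered m \<Longrightarrow> tempered m' \<Longrightarrow> tempered (\<lambda>x. m x * m' x)"

lemma one_minus_i_mult_real: "1 - \<i> * of_real s \<noteq> 0" "cmod (1 / (1 - \<i> * of_real s)) \<le> 1"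
proof -
  have "1 \<le> cmod (1 - \<i> * of_real s)"
    using abs_Re_le_cmod[of "1 - \<i> * of_real s"] by simp
  then show "1 - \<i> * of_real s \<noteq> 0" "cmod (1 / (1 - \<i> * of_real s)) \<le> 1"
    by (auto simp: norm_divide divide_simps)
qed

lemma has_vector_derivative_cis_linear:
  "((\<lambda>t. cis (a + t * c)) has_vector_derivative (\<i> * of_real c) * cis (a + s * c)) (at s)"
proof -
  have "((\<lambda>z. exp (\<i> * (of_real a + z * of_real c))) has_field_derivative
      (\<i> * of_real c) * exp (\<i> * (of_real a + of_real s * of_real c))) (at (of_real s))"
    by (auto intro!: derivative_eq_intros simp: mult_ac)
  from has_vector_derivative_real_field[OF this] show ?thesis
    by (simp add: cis_conv_exp)
qed

text \<open>Instead of all slowly growing functions, the class is the algebra generated by the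
  multipliers that occur. The generators are chosen so that it is closed under differentiation; for
  the inverse factor the derivative is a multiple of its square.\<close>

lemma tempered_dir_deriv: "tempered m \<Longrightarrow> \<exists>m'. tempered m' \<and> has_dir_deriv v m m'"
proof (induction rule: tempered.induct)
  case (tempered_const c)
  have "has_dir_deriv v (\<lambda>x. c) (\<lambda>x. 0)" by (simp add: has_dir_deriv_def)
  then show ?case using tempered.tempered_const by blast
next
  case (tempered_coord i)
  have "has_dir_deriv v (\<lambda>x. complex_of_real (x $ i)) (\<lambda>x. of_real (v $ i))"
    unfolding has_dir_deriv_def by (auto intro!: derivative_eq_intros)
  then show ?case using tempered.tempered_const by blast
next
  case (tempered_cis b)
  have "has_dir_deriv v (\<lambda>x. cis (b \<bullet> x)) (\<lambda>x. (\<i> * of_real (b \<bullet> v)) * cis (b \<bullet> x))"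
    unfolding has_dir_deriv_def
    using has_vector_derivative_cis_linear[of "b \<bullet> _" "b \<bullet> v" 0] by (simp add: inner_simps)
  moreover have "tempered (\<lambda>x. (\<i> * of_real (b \<bullet> v)) * cis (b \<bullet> x))"
    by (rule tempered.intros)+
  ultimately show ?case by blast
next
  case (tempered_inverse i)
  have "has_dir_deriv v (\<lambda>x. 1 / (1 - \<i> * of_real (x $ i)))
     (\<lambda>x. (\<i> * of_real (v $ i)) * (1 / (1 - \<i> * of_real (x $ i)) * (1 / (1 - \<i> * of_real (x $ i)))))"
    unfolding has_dir_deriv_def
  proof
    fix x
    have "((\<lambda>t. 1 / (1 - \<i> * (of_real (x $ i) + of_real t * of_real (v $ i)))) has_vector_derivative
      (\<i> * of_real (v $ i)) * (1 / (1 - \<i> * of_real (x $ i)) * (1 / (1 - \<i> * of_real (x $ i))))) (at 0)"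
      using one_minus_i_mult_real(1)[of "x $ i"]
      by (intro has_vector_derivative_real_field)
        (auto intro!: derivative_eq_intros simp: field_simps)
    then show "((\<lambda>t. 1 / (1 - \<i> * complex_of_real ((x + t *\<^sub>R v) $ i))) has_vector_derivative
        (\<i> * of_real (v $ i)) * (1 / (1 - \<i> * of_real (x $ i)) * (1 / (1 - \<i> * of_real (x $ i))))) (at 0)"
      by simp
  qed
  moreover have "tempered (\<lambda>x. (\<i> * of_real (v $ i))
      * (1 / (1 - \<i> * of_real (x $ i)) * (1 / (1 - \<i> * of_real (x $ i)))))"
    by (rule tempered.tempered_mult tempered.tempered_const tempered.tempered_inverse)+
  ultimately show ?case by blast
next
  case (tempered_add m m')
  then show ?case using has_dir_deriv_add tempered.tempered_add by metis
next
  case (tempered_mult m n)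
  then obtain m' n' where *: "tempered m'" "has_dir_deriv v m m'" "tempered n'" "has_dir_deriv v n n'"
    by blast
  have "has_dir_deriv v (\<lambda>x. m x * n x) (\<lambda>x. m x * n' x + m' x * n x)"
    unfolding has_dir_deriv_def
  proof
    fix x
    show "((\<lambda>t. m (x + t *\<^sub>R v) * n (x + t *\<^sub>R v)) has_vector_derivative m x * n' x + m' x * n x) (at 0)"
      using has_vector_derivative_mult[OF has_dir_derivD[OF *(2), of x 0] has_dir_derivD[OF *(4), of x 0]]
      by simp
  qed
  moreover have "tempered (\<lambda>x. m x * n' x + m' x * n x)"
    by (intro tempered.tempered_add tempered.tempered_mult * tempered_mult.hyps)
  ultimately show ?case by blast
qed

lemma tempered_bound: "tempered m \<Longrightarrow> \<exists>B k. \<forall>x. cmod (m x) \<le> B * (1 + norm x) ^ k"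
proof (induction rule: tempered.induct)
  case (tempered_const c)
  show ?case by (rule exI[of _ "cmod c"], rule exI[of _ 0]) simp
next
  case (tempered_coord i)
  have "\<bar>x $ i\<bar> \<le> 1 * (1 + norm x) ^ 1" for x :: "real^'a" using component_le_norm_cart[of x i] by simp
  then show ?case by (intro exI[of _ 1]) simp
next
  case (tempered_cis b)
  show ?case by (rule exI[of _ 1], rule exI[of _ 0]) simp
next
  case (tempered_inverse i)
  show ?case by (rule exI[of _ 1], rule exI[of _ 0]) (use one_minus_i_mult_real in auto)
next
  case (tempered_add m n)
  then obtain A k B l where *: "\<And>x. cmod (m x) \<le> A * (1 + norm x) ^ k" "\<And>x. cmod (n x) \<le> B * (1 + norm x) ^ l"
    by blast
  have "cmod (m x + n x) \<le> (\<bar>A\<bar> + \<bar>B\<bar>) * (1 + norm x) ^ (k + l)" for x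
  proof -
    have "A * (1 + norm x) ^ k \<le> \<bar>A\<bar> * (1 + norm x) ^ (k + l)"
      "B * (1 + norm x) ^ l \<le> \<bar>B\<bar> * (1 + norm x) ^ (k + l)"
      by (intro mult_mono power_increasing; simp)+
    then show ?thesis using *[of x] norm_triangle_ineq[of "m x" "n x"] by (simp add: algebra_simps)
  qed
  then show ?case by blast
next
  case (tempered_mult m n)
  then obtain A k B l where *: "\<And>x. cmod (m x) \<le> A * (1 + norm x) ^ k" "\<And>x. cmod (n x) \<le> B * (1 + norm x) ^ l"
    by blast
  have "cmod (m x * n x) \<le> (A * B) * (1 + norm x) ^ (k + l)" for x
    using mult_mono[OF *[of x]] order_trans[OF norm_ge_zero *(1)]
    by (simp add: norm_mult power_add mult_ac)
  then show ?case by blast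
qed

lemma rapidly_decreasing_tempered_bound:
  assumes f: "rapidly_decreasing f" and m: "tempered m" and h: "\<And>x. norm (h x) \<le> cmod (m x) * norm (f x)"
  shows "rapidly_decreasing h"
  unfolding rapidly_decreasing_def
proof
  fix k
  obtain B l where B: "\<And>x. cmod (m x) \<le> B * (1 + norm x) ^ l" using tempered_bound[OF m] by blast
  have "B \<ge> 0" using order_trans[OF norm_ge_zero B[of 0]] by simp
  obtain A where A: "\<And>x. (1 + norm x) ^ (k + l) * norm (f x) \<le> A"
    using f unfolding rapidly_decreasing_def by metis
  have "(1 + norm x) ^ k * norm (h x) \<le> B * A" for x
  proof -
    have "(1 + norm x) ^ k * norm (h x) \<le> (1 + norm x) ^ k * (B * (1 + norm x) ^ l * norm (f x))"
      by (intro mult_left_mono order_trans[OF h] mult_right_mono B) auto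
    also have "\<dots> = B * ((1 + norm x) ^ (k + l) * norm (f x))" by (simp add: power_add mult_ac)
    also have "\<dots> \<le> B * A" by (intro mult_left_mono A \<open>B \<ge> 0\<close>)
    finally show ?thesis .
  qed
  then show "\<exists>B. \<forall>x. (1 + norm x) ^ k * norm (h x) \<le> B" by blast
qed

context cstar
begin

text \<open>The Leibniz rule leads from one product to a sum of two, so the coinduction runs over
  finite sums of products.\<close>

inductive tempered_schwartz_sum :: "(real^'n \<Rightarrow> 'a) \<Rightarrow> bool" where
  mult: "tempered m \<Longrightarrow> schwartz h \<Longrightarrow> tempered_schwartz_sum (\<lambda>x. csc (m x) (h x))"
| add: "tempered_schwartz_sum f \<Longrightarrow> tempered_schwartz_sum g \<Longrightarrow> tempered_schwartz_sum (\<lambda>x. f x + g x)"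

lemma has_dir_deriv_csc:
  assumes "has_dir_deriv v m m'" "has_dir_deriv v h h'"
  shows "has_dir_deriv v (\<lambda>x. csc (m x) (h x)) (\<lambda>x. csc (m x) (h' x) + csc (m' x) (h x))"
  unfolding has_dir_deriv_def
proof
  fix x
  show "((\<lambda>t. csc (m (x + t *\<^sub>R v)) (h (x + t *\<^sub>R v))) has_vector_derivative
      csc (m x) (h' x) + csc (m' x) (h x)) (at 0)"
    using bounded_bilinear.has_vector_derivative[OF bounded_bilinear_csc
      has_dir_derivD[OF assms(1), of x 0] has_dir_derivD[OF assms(2), of x 0]] by simp
qed

lemma schwartz_tempered_mult:
  assumes m: "tempered m" and h: "schwartz h"
  shows "schwartz (\<lambda>x. csc (m x) (h x))"
proof (rule schwartz_coinduct[where X = tempered_schwartz_sum])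
  show "tempered_schwartz_sum (\<lambda>x. csc (m x) (h x))" using m h by (rule tempered_schwartz_sum.mult)
  show "\<exists>f'. tempered_schwartz_sum f' \<and> has_dir_deriv v f f'"
    if "tempered_schwartz_sum f" "v \<in> Basis" for f and v :: "real^'b"
    using that(1)
  proof induction
    case (mult m h)
    obtain m' where m': "tempered m'" "has_dir_deriv v m m'" using tempered_dir_deriv[OF mult(1)] by blast
    have h': "schwartz (dir_deriv v h)" "has_dir_deriv v h (dir_deriv v h)"
      by (rule schwartzD(4)[OF mult(2) that(2)], rule schwartzD(3)[OF mult(2) that(2)])
    have "tempered_schwartz_sum (\<lambda>x. csc (m x) (dir_deriv v h x) + csc (m' x) (h x))"
      by (rule tempered_schwartz_sum.add[OF tempered_schwartz_sum.mult[OF mult(1) h'(1)]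
          tempered_schwartz_sum.mult[OF m'(1) mult(2)]])
    with has_dir_deriv_csc[OF m'(2) h'(2)] show ?case by blast
  next
    case (add f g)
    then obtain f' g' where *: "tempered_schwartz_sum f'" "has_dir_deriv v f f'"
      "tempered_schwartz_sum g'" "has_dir_deriv v g g'" by blast
    show ?case using tempered_schwartz_sum.add[OF *(1,3)] has_dir_deriv_add[OF *(2,4)] by blast
  qed
  show "rapidly_decreasing f" if "tempered_schwartz_sum f" for f :: "real^'b \<Rightarrow> 'a"
    using that
  proof induction
    case (mult m h)
    show ?case
      by (rule rapidly_decreasing_tempered_bound[OF schwartzD(1)[OF mult(2)] mult(1)]) (simp add: norm_csc)
  qed (rule rapidly_decreasing_add)
qed

lemma schwartz_csc: "schwartz h \<Longrightarrow> schwartz (\<lambda>x. csc c (h x))"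
  using schwartz_tempered_mult[OF tempered_const] .

lemma schwartz_scaleR: "schwartz h \<Longrightarrow> schwartz (\<lambda>x. r *\<^sub>R h x :: 'a)"
  using schwartz_csc[of h "of_real r"] by (simp add: csc_of_real)

lemma schwartz_diff: "schwartz f \<Longrightarrow> schwartz g \<Longrightarrow> schwartz (\<lambda>x. f x - g x :: 'a)"
  using schwartz_add[of f "\<lambda>x. (- 1) *\<^sub>R g x"] schwartz_scaleR[of g "- 1"] by simp

lemma schwartz_heis_act: "schwartz h \<Longrightarrow> schwartz (heis_act csc g h)"
  unfolding heis_act_def
  by (cases g) (simp add: schwartz_tempered_mult[OF tempered_mult[OF tempered_const tempered_cis]]
      schwartz_translate)

end

section \<open>Kernels and integration by parts\<close>

text \<open>A class in which products are integrable and which contains, besides the Schwartz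
  functions, the kernels and mollifiers, which are not Schwartz functions.\<close>

definition l2_dominated :: "(real^'n \<Rightarrow> 'b::real_normed_vector) \<Rightarrow> bool"
  where "l2_dominated f \<longleftrightarrow> continuous_on UNIV f \<and> (\<exists>B. \<forall>x. (norm (f x))\<^sup>2 \<le> B * weight x)"

lemma rapidly_decreasing_weight:
  fixes f :: "real^'n \<Rightarrow> 'b::real_normed_vector"
  assumes "(1 + norm x) ^ (2 * CARD('n)) * norm (f x) \<le> B"
  shows "norm (f x) \<le> B * weight x"
proof -
  have p: "(1 + norm x) ^ (2 * CARD('n)) > 0" by (simp add: add_pos_nonneg)
  have "B \<ge> 0" by (rule order_trans[OF _ assms]) simp
  have "norm (f x) \<le> B * (1 / (1 + norm x) ^ (2 * CARD('n)))"
    using assms p by (simp add: field_simps)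
  also have "\<dots> \<le> B * weight x" by (intro mult_left_mono inverse_power_le_weight \<open>B \<ge> 0\<close>)
  finally show ?thesis .
qed

lemma rapidly_decreasing_weight_square:
  fixes f :: "real^'n \<Rightarrow> 'b::real_normed_vector"
  assumes "(1 + norm x) ^ CARD('n) * norm (f x) \<le> B"
  shows "(norm (f x))\<^sup>2 \<le> B\<^sup>2 * weight x"
proof -
  have "((1 + norm x) ^ CARD('n) * norm (f x))\<^sup>2 \<le> B\<^sup>2" using assms by (intro power_mono) auto
  then have "(1 + norm x) ^ (2 * CARD('n)) * norm ((norm (f x))\<^sup>2) \<le> B\<^sup>2"
    by (simp add: power_mult_distrib flip: power_mult) (simp add: mult.commute)
  from rapidly_decreasing_weight[where f = "\<lambda>x. (norm (f x))\<^sup>2", OF this] show ?thesis by simp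
qed

lemma schwartz_l2_dominated:
  fixes f :: "real^'n \<Rightarrow> 'b::real_normed_vector"
  assumes "schwartz f"
  shows "l2_dominated f"
proof -
  obtain B where "\<And>x. (1 + norm x) ^ CARD('n) * norm (f x) \<le> B"
    using schwartzD(1)[OF assms] unfolding rapidly_decreasing_def by metis
  then have "(norm (f x))\<^sup>2 \<le> B\<^sup>2 * weight x" for x by (rule rapidly_decreasing_weight_square)
  then show ?thesis unfolding l2_dominated_def using schwartzD(2)[OF assms] by blast
qed

lemma schwartz_weight_shift:
  fixes u :: "real^'n \<Rightarrow> 'b::real_normed_vector"
  assumes "schwartz u" and v: "norm v = 1"
  obtains C where "C \<ge> 0" "\<And>x s. \<bar>s\<bar> \<le> 1 \<Longrightarrow> norm (u (x + s *\<^sub>R v)) \<le> C * weight x"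
proof -
  obtain B where B: "\<And>x. (1 + norm x) ^ (2 * CARD('n)) * norm (u x) \<le> B"
    using schwartzD(1)[OF assms(1)] unfolding rapidly_decreasing_def by metis
  \<comment> \<open>Difference quotients involve values at shifted points. A shift of length at most
    \<open>1\<close> costs \<open>2\<close> for each factor of the polynomial weight.\<close>
  define C where "C = 2 ^ (2 * CARD('n)) * B"
  have "norm (u (x + s *\<^sub>R v)) \<le> C * weight x" if "\<bar>s\<bar> \<le> 1" for x s
  proof (rule rapidly_decreasing_weight[where f = "\<lambda>x. u (x + s *\<^sub>R v)"])
    have "(1 + norm x) ^ (2 * CARD('n))
        \<le> (1 + norm (x + s *\<^sub>R v)) ^ (2 * CARD('n)) * (1 + norm (- s *\<^sub>R v)) ^ (2 * CARD('n))"
      using one_plus_norm_power_mult[of "x + s *\<^sub>R v" "- s *\<^sub>R v"] by simp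
    also have "\<dots> \<le> (1 + norm (x + s *\<^sub>R v)) ^ (2 * CARD('n)) * 2 ^ (2 * CARD('n))"
      using that v by (intro mult_left_mono power_mono) auto
    finally have "(1 + norm x) ^ (2 * CARD('n)) * norm (u (x + s *\<^sub>R v))
        \<le> (1 + norm (x + s *\<^sub>R v)) ^ (2 * CARD('n)) * 2 ^ (2 * CARD('n)) * norm (u (x + s *\<^sub>R v))"
      by (intro mult_right_mono) auto
    also have "\<dots> \<le> C"
      unfolding C_def using B[of "x + s *\<^sub>R v"] by (simp add: mult_ac)
    finally show "(1 + norm x) ^ (2 * CARD('n)) * norm (u (x + s *\<^sub>R v)) \<le> C" .
  qed
  moreover have "B \<ge> 0" by (rule order_trans[OF _ B[of 0]]) simp
  ultimately show thesis using that[of C] by (simp add: C_def)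
qed

text \<open>Translation invariance takes the place of Fubini's theorem, which is not available for
  functions with values in a non-separable Banach space.\<close>

lemma integral_dir_deriv_eq_0:
  fixes H :: "real^'n \<Rightarrow> 'b::banach"
  assumes H: "has_dir_deriv v H H'" "continuous_on UNIV H" "continuous_on UNIV H'"
    and b: "\<And>x. norm (H x) \<le> B * weight x" "\<And>x. norm (H' x) \<le> B * weight x"
    and lip: "\<And>x s. \<bar>s\<bar> \<le> 1 \<Longrightarrow> norm (H' (x + s *\<^sub>R v) - H' x) \<le> \<bar>s\<bar> * (C * weight x)"
  shows "integral UNIV H' = 0"
proof -
  let ?W = "integral UNIV (weight :: real^'n \<Rightarrow> real)"
  have intH: "H integrable_on UNIV" "H' integrable_on UNIV"
    using integrable_of_weight_bound H b by blast+
  have C: "C \<ge> 0"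
  proof -
    have "0 \<le> C * weight (0::real^'n)" using order_trans[OF norm_ge_zero lip[of 1 0]] by simp
    then show ?thesis using weight_pos[of "0::real^'n"] by (simp add: zero_le_mult_iff)
  qed
  have "norm (integral UNIV H') \<le> t * (C * ?W)" if t: "0 < t" "t \<le> 1" for t
  proof -
    have "norm (H (x + t *\<^sub>R v) - H x - t *\<^sub>R H' x) \<le> (t * t * C) * weight x" for x
    proof -
      have "norm (H (x + t *\<^sub>R v) - H x - t *\<^sub>R H' x) \<le> (t * (C * weight x)) * \<bar>t\<bar>"
      proof (rule has_dir_deriv_remainder[OF H(1)])
        fix s assume "\<bar>s\<bar> \<le> \<bar>t\<bar>"
        then have "\<bar>s\<bar> \<le> 1" "\<bar>s\<bar> \<le> t" using t by auto
        then show "norm (H' (x + s *\<^sub>R v) - H' x) \<le> t * (C * weight x)"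
          using C weight_pos[of x] by (intro order_trans[OF lip] mult_right_mono) auto
      qed
      then show ?thesis using t by (simp add: mult_ac)
    qed
    moreover have "continuous_on UNIV (\<lambda>x. H (x + t *\<^sub>R v))"
      by (rule continuous_on_compose2[OF H(2)]) (auto intro!: continuous_intros)
    then have "continuous_on UNIV (\<lambda>x. H (x + t *\<^sub>R v) - H x - t *\<^sub>R H' x)"
      by (intro continuous_on_diff continuous_on_scaleR continuous_on_const H)
    ultimately have "norm (integral UNIV (\<lambda>x. H (x + t *\<^sub>R v) - H x - t *\<^sub>R H' x)) \<le> (t * t * C) * ?W"
      by (intro integrable_of_weight_bound)
    \<comment> \<open>By translation invariance the two integrals of \<open>H\<close> cancel, so
      \<open>t\<close> times the integral of \<open>H'\<close> is itself a remainder of second order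
      in \<open>t\<close>.\<close>
    moreover have "((\<lambda>x. H (x + t *\<^sub>R v) - H x - t *\<^sub>R H' x) has_integral
        integral UNIV H - integral UNIV H - t *\<^sub>R integral UNIV H') UNIV"
      by (intro has_integral_diff has_integral_cmul integrable_integral intH has_integral_translate_UNIV)
    ultimately have "norm (- (t *\<^sub>R integral UNIV H')) \<le> (t * t * C) * ?W"
      by (simp add: integral_unique)
    then show ?thesis using t by (simp add: mult.assoc)
  qed
  note bound = this
  have "norm (integral UNIV H') \<le> 0 * (C * ?W)"
  proof (rule tendsto_lowerbound[where F = "at_right (0::real)"])
    show "((\<lambda>t. t * (C * ?W)) \<longlongrightarrow> 0 * (C * ?W)) (at_right 0)" by (intro tendsto_intros)
    show "\<forall>\<^sub>F t in at_right 0. norm (integral UNIV H') \<le> t * (C * ?W)"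
      unfolding eventually_at_right_field by (rule exI[of _ 1]) (auto intro: bound)
  qed simp
  then show ?thesis by simp
qed

lemma integration_by_parts_kernel:
  fixes h :: "real^'n \<Rightarrow> 'b::banach" and m1 m0 :: "real^'n \<Rightarrow> real"
  assumes h: "schwartz h" and v: "v \<in> Basis"
    and m: "continuous_on UNIV m1" "continuous_on UNIV m0" "\<And>x. \<bar>m1 x\<bar> \<le> A" "\<And>x. \<bar>m0 x\<bar> \<le> A"
      "has_dir_deriv v m1 (\<lambda>x. m1 x - m0 x)" "\<And>x s. \<bar>m0 (x + s *\<^sub>R v) - m0 x\<bar> \<le> A * \<bar>s\<bar>"
  shows "integral UNIV (\<lambda>x. m1 x *\<^sub>R (h x + dir_deriv v h x)) = integral UNIV (\<lambda>x. m0 x *\<^sub>R h x)"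
proof -
  have A: "A \<ge> 0" using order_trans[OF abs_ge_zero m(3)] .
  have nv: "norm v = 1" using v by simp
  define h' where "h' = dir_deriv v h"
  have h': "schwartz h'" "has_dir_deriv v h h'"
    unfolding h'_def by (rule schwartzD(4)[OF h v], rule schwartzD(3)[OF h v])
  \<comment> \<open>The Lipschitz constant \<open>2 * A\<close> serves both kernels: it bounds the
    derivative \<open>m1 - m0\<close> of \<open>m1\<close>, and \<open>m0\<close> is
    \<open>A\<close>-Lipschitz along \<open>v\<close>.\<close>
  have prod: "\<exists>C. \<forall>x s. \<bar>s\<bar> \<le> 1 \<longrightarrow>
      norm (m (x + s *\<^sub>R v) *\<^sub>R u (x + s *\<^sub>R v) - m x *\<^sub>R u x) \<le> \<bar>s\<bar> * (C * weight x)"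
    if u: "schwartz u" and mb: "\<And>x. \<bar>m x\<bar> \<le> A" "\<And>x s. \<bar>m (x + s *\<^sub>R v) - m x\<bar> \<le> 2 * A * \<bar>s\<bar>"
    for u :: "real^'n \<Rightarrow> 'b" and m :: "real^'n \<Rightarrow> real"
  proof -
    obtain C where C: "C \<ge> 0" "\<And>x s. \<bar>s\<bar> \<le> 1 \<Longrightarrow> norm (u (x + s *\<^sub>R v)) \<le> C * weight x"
      using schwartz_weight_shift[OF u nv] by blast
    obtain D where D: "D \<ge> 0" "\<And>x s. \<bar>s\<bar> \<le> 1 \<Longrightarrow> norm (dir_deriv v u (x + s *\<^sub>R v)) \<le> D * weight x"
      using schwartz_weight_shift[OF schwartzD(4)[OF u v] nv] by blast
    have "norm (m (x + s *\<^sub>R v) *\<^sub>R u (x + s *\<^sub>R v) - m x *\<^sub>R u x)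
        \<le> \<bar>s\<bar> * ((2 * A * C + A * D) * weight x)" if s: "\<bar>s\<bar> \<le> 1" for x s
    proof -
      have 1: "norm ((m (x + s *\<^sub>R v) - m x) *\<^sub>R u (x + s *\<^sub>R v)) \<le> (2 * A * \<bar>s\<bar>) * (C * weight x)"
        unfolding norm_scaleR using mb(2)[of x s] C(2)[OF s, of x] A by (intro mult_mono) auto
      have "norm (u (x + s *\<^sub>R v) - u x) \<le> (D * weight x) * \<bar>s\<bar>"
        by (rule has_dir_deriv_bound[OF schwartzD(3)[OF u v]]) (use s D in auto)
      then have 2: "norm (m x *\<^sub>R (u (x + s *\<^sub>R v) - u x)) \<le> A * ((D * weight x) * \<bar>s\<bar>)"
        unfolding norm_scaleR using mb(1)[of x] A by (intro mult_mono) auto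
      have "m (x + s *\<^sub>R v) *\<^sub>R u (x + s *\<^sub>R v) - m x *\<^sub>R u x
          = (m (x + s *\<^sub>R v) - m x) *\<^sub>R u (x + s *\<^sub>R v) + m x *\<^sub>R (u (x + s *\<^sub>R v) - u x)"
        by (simp add: algebra_simps)
      from norm_triangle_le[OF add_mono[OF 1 2], folded this]
      show ?thesis by (simp add: algebra_simps)
    qed
    then show ?thesis by blast
  qed
  have m1_lip: "\<bar>m1 (x + s *\<^sub>R v) - m1 x\<bar> \<le> 2 * A * \<bar>s\<bar>" for x s
  proof -
    have "norm (m1 y - m0 y) \<le> 2 * A" for y
      using m(3,4)[of y] by (simp add: abs_triangle_ineq4 order_trans abs_le_iff)
    then show ?thesis using has_dir_deriv_bound[OF m(5), of s x "2 * A"] by simp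
  qed
  have m0_lip: "\<bar>m0 (x + s *\<^sub>R v) - m0 x\<bar> \<le> 2 * A * \<bar>s\<bar>" for x s
    using m(6)[of x s] A mult_right_mono[of A "2 * A" "\<bar>s\<bar>"] by linarith
  define g where "g x = h x + h' x" for x
  have g: "schwartz g" unfolding g_def by (rule schwartz_add[OF h h'(1)])
  obtain C1 where C1: "\<And>x s. \<bar>s\<bar> \<le> 1 \<Longrightarrow>
      norm (m1 (x + s *\<^sub>R v) *\<^sub>R g (x + s *\<^sub>R v) - m1 x *\<^sub>R g x) \<le> \<bar>s\<bar> * (C1 * weight x)"
    using prod[OF g m(3) m1_lip] by blast
  obtain C0 where C0: "\<And>x s. \<bar>s\<bar> \<le> 1 \<Longrightarrow>
      norm (m0 (x + s *\<^sub>R v) *\<^sub>R h (x + s *\<^sub>R v) - m0 x *\<^sub>R h x) \<le> \<bar>s\<bar> * (C0 * weight x)"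
    using prod[OF h m(4) m0_lip] by blast
  obtain D where D: "D \<ge> 0" "\<And>x. norm (h x) \<le> D * weight x"
    using schwartz_weight_shift[OF h nv] by (metis abs_zero add.right_neutral scaleR_zero_left zero_le_one)
  obtain E where E: "E \<ge> 0" "\<And>x. norm (g x) \<le> E * weight x"
    using schwartz_weight_shift[OF g nv] by (metis abs_zero add.right_neutral scaleR_zero_left zero_le_one)
  have mb: "norm (m1 x *\<^sub>R g x) \<le> (A * E) * weight x" "norm (m0 x *\<^sub>R h x) \<le> (A * D) * weight x"
    "norm (m1 x *\<^sub>R h x) \<le> (A * D) * weight x" for x
    unfolding norm_scaleR mult.assoc using m(3,4)[of x] D(2)[of x] E(2)[of x] A
    by (intro mult_mono; simp)+
  have c: "continuous_on UNIV (\<lambda>x. m1 x *\<^sub>R g x)" "continuous_on UNIV (\<lambda>x. m0 x *\<^sub>R h x)"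
    "continuous_on UNIV (\<lambda>x. m1 x *\<^sub>R h x)"
    by (intro continuous_on_scaleR m schwartzD(2)[OF g] schwartzD(2)[OF h])+
  have int: "(\<lambda>x. m1 x *\<^sub>R g x) integrable_on UNIV" "(\<lambda>x. m0 x *\<^sub>R h x) integrable_on UNIV"
    using integrable_of_weight_bound(1)[OF c(1) mb(1)] integrable_of_weight_bound(1)[OF c(2) mb(2)] .
  have "integral UNIV (\<lambda>x. m1 x *\<^sub>R g x - m0 x *\<^sub>R h x) = 0"
  proof (rule integral_dir_deriv_eq_0[where H = "\<lambda>x. m1 x *\<^sub>R h x" and B = "A * E + A * D"])
    show "has_dir_deriv v (\<lambda>x. m1 x *\<^sub>R h x) (\<lambda>x. m1 x *\<^sub>R g x - m0 x *\<^sub>R h x)"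
      unfolding has_dir_deriv_def
    proof
      fix x
      show "((\<lambda>t. m1 (x + t *\<^sub>R v) *\<^sub>R h (x + t *\<^sub>R v)) has_vector_derivative
          m1 x *\<^sub>R g x - m0 x *\<^sub>R h x) (at 0)"
        using bounded_bilinear.has_vector_derivative[OF bounded_bilinear_scaleR
          has_dir_derivD[OF m(5), of x 0] has_dir_derivD[OF h'(2), of x 0]]
        by (simp add: g_def algebra_simps)
    qed
    show "continuous_on UNIV (\<lambda>x. m1 x *\<^sub>R g x - m0 x *\<^sub>R h x)" using c by (intro continuous_on_diff)
    show "norm (m1 x *\<^sub>R h x) \<le> (A * E + A * D) * weight x" for x
      using mb(3)[of x] A E(1) weight_pos[of x] by (simp add: distrib_right add_increasing)
    show "norm (m1 x *\<^sub>R g x - m0 x *\<^sub>R h x) \<le> (A * E + A * D) * weight x" for x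
      unfolding distrib_right
      by (rule order_trans[OF norm_triangle_ineq4 add_mono[OF mb(1) mb(2)]])
    show "norm (m1 (x + s *\<^sub>R v) *\<^sub>R g (x + s *\<^sub>R v) - m0 (x + s *\<^sub>R v) *\<^sub>R h (x + s *\<^sub>R v)
        - (m1 x *\<^sub>R g x - m0 x *\<^sub>R h x)) \<le> \<bar>s\<bar> * ((C1 + C0) * weight x)" if "\<bar>s\<bar> \<le> 1" for x s
    proof -
      have "norm ((m1 (x + s *\<^sub>R v) *\<^sub>R g (x + s *\<^sub>R v) - m1 x *\<^sub>R g x)
          - (m0 (x + s *\<^sub>R v) *\<^sub>R h (x + s *\<^sub>R v) - m0 x *\<^sub>R h x)) \<le> \<bar>s\<bar> * (C1 * weight x) + \<bar>s\<bar> * (C0 * weight x)"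
        using that by (intro order_trans[OF norm_triangle_ineq4] add_mono C1 C0)
      then show ?thesis by (simp add: algebra_simps)
    qed
  qed (fact c)
  then show ?thesis
    unfolding g_def h'_def[symmetric] using int by (simp add: integral_diff g_def)
qed

section \<open>The hat function and its one-dimensional resolvent kernel\<close>

definition tent :: "real \<Rightarrow> real \<Rightarrow> real"
  where "tent e s = max 0 (1 - \<bar>s\<bar> / e) / e"

lemma tent_nonneg: "e > 0 \<Longrightarrow> 0 \<le> tent e s"
  and tent_le: "e > 0 \<Longrightarrow> tent e s \<le> 1 / e"
  and tent_eq_0: "e > 0 \<Longrightarrow> \<bar>s\<bar> \<ge> e \<Longrightarrow> tent e s = 0"
  and tent_ge: "e > 0 \<Longrightarrow> \<bar>s\<bar> \<le> e / 2 \<Longrightarrow> 1 / (2 * e) \<le> tent e s"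
  by (auto simp: tent_def field_simps max_def)

lemma continuous_tent: "continuous_on S (tent e)"
  unfolding tent_def by (cases "e = 0") (auto intro!: continuous_intros)

lemma tent_lipschitz:
  assumes "e > 0"
  shows "\<bar>tent e s - tent e t\<bar> \<le> (1 / e\<^sup>2) * \<bar>s - t\<bar>"
proof -
  have "\<bar>max 0 (1 - \<bar>s\<bar> / e) - max 0 (1 - \<bar>t\<bar> / e)\<bar> \<le> \<bar>\<bar>s\<bar> / e - \<bar>t\<bar> / e\<bar>" by linarith
  also have "\<dots> \<le> \<bar>s - t\<bar> / e" using assms by (auto simp: field_simps)
  finally show ?thesis using assms
    by (simp add: tent_def power2_eq_square divide_right_mono flip: diff_divide_distrib)
       (simp add: field_simps)
qed

lemma tent_weight_bound:
  assumes "0 < e" "e \<le> 1"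
  shows "tent e s \<le> (2 / e) * (1 / (1 + s\<^sup>2))"
proof (cases "\<bar>s\<bar> \<ge> e")
  case False
  then have "s\<^sup>2 \<le> 1" using assms by (simp add: abs_square_le_1)
  then have "1 / e \<le> (2 / e) * (1 / (1 + s\<^sup>2))"
    using assms by (simp add: field_simps add_pos_nonneg)
  then show ?thesis using tent_le[of e s] assms by simp
qed (use assms tent_eq_0 in \<open>auto intro!: divide_nonneg_pos add_pos_nonneg\<close>)

text \<open>\<open>k s\<close> is \<open>exp s\<close> times the integral of
  \<open>exp (- u) * tent e u\<close> over \<open>u \<ge> s\<close>: the solution of
  \<open>k - k' = tent e\<close> that vanishes to the right of the support. To the left it decays
  like \<open>exp s\<close>. All bounds must be independent of \<open>e\<close>, because the Sobolev
  constant has to survive the limit of vanishing \<open>e\<close>.\<close>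

lemma tent_resolvent_kernel:
  assumes e: "0 < e" "e \<le> 1"
  obtains k where "\<And>s. (k has_real_derivative k s - tent e s) (at s)"
    "\<And>s. 0 \<le> k s" "\<And>s. k s \<le> 2 * exp 2" "\<And>s. (k s)\<^sup>2 \<le> (8 * exp 4) * (1 / (1 + s\<^sup>2))"
proof -
  define f where "f u = exp (- u) * tent e u" for u
  have "isCont f u" for u
    unfolding f_def by (intro continuous_intros) (use continuous_tent[of UNIV e] continuous_on_eq_continuous_at in auto)
  then obtain F where "\<And>u. (F has_vector_derivative f u) (at u)"
    using einterval_antiderivative[of "- \<infinity>" \<infinity> f] by auto
  then have F: "(F has_real_derivative f u) (at u)" for u
    by (simp add: has_real_derivative_iff_has_vector_derivative)
  have f0: "f u \<ge> 0" for u using e tent_nonneg by (simp add: f_def)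
  have mono: "F s \<le> F t" if "s \<le> t" for s t
    using that by (rule DERIV_nonneg_imp_nondecreasing) (use F f0 in blast)
  have up: "F s = F e" if "s \<ge> e" for s
  proof (cases "s = e")
    case False
    have "F s = F e"
    proof (rule DERIV_isconst2[of e s F s])
      show "continuous_on {e..s} F" using F by (meson DERIV_isCont continuous_at_imp_continuous_on)
      show "(F has_real_derivative 0) (at x)" if "e < x" "x < s" for x
        using F[of x] tent_eq_0[of e x] e that by (simp add: f_def)
    qed (use that False in auto)
    then show ?thesis .
  qed simp
  have down: "F s = F (- e)" if "s \<le> - e" for s
  proof (cases "s = - e")
    case False
    have "F (- e) = F s"
    proof (rule DERIV_isconst2[of s "- e" F "- e"])
      show "continuous_on {s..- e} F" using F by (meson DERIV_isCont continuous_at_imp_continuous_on)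
      show "(F has_real_derivative 0) (at x)" if "s < x" "x < - e" for x
        using F[of x] tent_eq_0[of e x] e that by (simp add: f_def)
    qed (use that False in auto)
    then show ?thesis by simp
  qed simp
  \<comment> \<open>The interval has length \<open>2 * e\<close> and the integrand is at most
    \<open>exp 1 / e\<close>, so \<open>e\<close> cancels.\<close>
  have "F e - F (- e) \<le> 2 * exp 1"
  proof -
    obtain z where z: "- e < z" "z < e" "F e - F (- e) = (e - - e) * f z"
      using MVT2[of "- e" e F f] F e by auto
    have "f z \<le> exp 1 * (1 / e)"
      unfolding f_def using z e tent_nonneg tent_le by (intro mult_mono) auto
    then have "2 * e * f z \<le> 2 * e * (exp 1 * (1 / e))" using e by (intro mult_left_mono) auto
    also have "\<dots> = 2 * exp 1" using e by simp
    finally show ?thesis using z(3) by simp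
  qed
  then have le: "F e - F s \<le> 2 * exp 1" for s
    using down[of s] mono[of "- e" s] by linarith
  have ge: "F e - F s \<ge> 0" for s using up[of s] mono[of s e] by linarith
  define k where "k s = exp s * (F e - F s)" for s
  have k1: "k s \<le> exp s * (2 * exp 1)" for s unfolding k_def using le by simp
  have k2: "k s = 0" if "s \<ge> 1" for s using up[of s] that e by (simp add: k_def)
  show thesis
  proof
    show "(k has_real_derivative k s - tent e s) (at s)" for s
    proof -
      have "((\<lambda>s. exp s * (F e - F s)) has_real_derivative exp s * (F e - F s) + (0 - f s) * exp s) (at s)"
        by (intro DERIV_mult DERIV_exp DERIV_diff DERIV_const F)
      moreover have "(0 - f s) * exp s = - tent e s" by (simp add: f_def exp_minus)
      ultimately show ?thesis by (simp add: k_def[abs_def])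
    qed
    show k0: "0 \<le> k s" for s unfolding k_def using ge by simp
    show "k s \<le> 2 * exp 2" for s
    proof (cases "s \<ge> 1")
      case False
      then have "exp s * (2 * exp 1) \<le> exp 1 * (2 * exp 1)" by (intro mult_right_mono) auto
      also have "\<dots> = 2 * exp (1 + 1)" by (simp only: exp_add)
      finally show ?thesis using k1[of s] by simp
    qed (simp add: k2)
    \<comment> \<open>\<open>8 * exp 4\<close> is the product of \<open>4 * exp 2\<close>, from
      squaring the bound on \<open>k\<close>, and \<open>2 * exp 2\<close>, which bounds
      \<open>exp (2 * s) * (1 + s\<^sup>2)\<close> for \<open>s < 1\<close>.\<close>
    show "(k s)\<^sup>2 \<le> (8 * exp 4) * (1 / (1 + s\<^sup>2))" for s
    proof (cases "s \<ge> 1")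
      case False
      have "(k s)\<^sup>2 \<le> (exp s * (2 * exp 1))\<^sup>2" using k1 k0 by (intro power_mono)
      also have "\<dots> = 4 * exp 2 * exp (2 * s)"
        by (simp add: power2_eq_square flip: exp_add)
      finally have *: "(k s)\<^sup>2 \<le> 4 * exp 2 * exp (2 * s)" .
      have "exp (2 * s) * (1 + s\<^sup>2) \<le> 2 * exp 2"
      proof (cases "s \<ge> 0")
        case True
        then have "s\<^sup>2 \<le> 1" using False by (simp add: abs_square_le_1)
        then have "exp (2 * s) * (1 + s\<^sup>2) \<le> exp 2 * 2" using False by (intro mult_mono) auto
        then show ?thesis by simp
      next
        case neg: False
        have "1 + s\<^sup>2 \<le> (1 - s)\<^sup>2" using neg by (simp add: power2_eq_square algebra_simps)
        also have "\<dots> \<le> (exp (- s))\<^sup>2"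
          using exp_ge_add_one_self[of "- s"] neg by (intro power_mono) auto
        also have "\<dots> = exp (- (2 * s))" by (simp add: power2_eq_square flip: exp_add)
        finally have "exp (2 * s) * (1 + s\<^sup>2) \<le> exp (2 * s) * exp (- (2 * s))" by simp
        also have "\<dots> = 1" by (simp flip: exp_add)
        also have "1 \<le> 2 * exp (2::real)" using exp_ge_add_one_self[of "2::real"] by simp
        finally show ?thesis .
      qed
      then have "4 * exp 2 * (exp (2 * s) * (1 + s\<^sup>2)) \<le> 4 * exp 2 * (2 * exp 2)"
        by (intro mult_left_mono) auto
      also have "\<dots> = 8 * exp (2 + 2)" by (simp only: exp_add)
      finally have "4 * exp 2 * exp (2 * s) * (1 + s\<^sup>2) \<le> 8 * exp 4" by (simp add: mult.assoc)
      then have "4 * exp 2 * exp (2 * s) \<le> (8 * exp 4) * (1 / (1 + s\<^sup>2))"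
        by (simp add: pos_le_divide_eq add_pos_nonneg)
      then show ?thesis using * by simp
    qed (simp add: k2 divide_nonneg_pos add_pos_nonneg)
  qed
qed

section \<open>Mollification, Cauchy-Schwarz and Sobolev inequalities\<close>

definition mollifier :: "real \<Rightarrow> real^'n \<Rightarrow> real"
  where "mollifier e x = (\<Prod>i\<in>UNIV. tent e (x $ i))"

lemma continuous_tent_component: "continuous_on UNIV (\<lambda>x::real^'n. tent e (x $ i))"
  by (rule continuous_on_compose2[OF continuous_tent[of UNIV]]) (auto intro!: continuous_intros)

lemma continuous_mollifier: "continuous_on UNIV (mollifier e)"
  unfolding mollifier_def by (intro continuous_on_prod continuous_tent_component)

lemma mollifier_nonneg: "e > 0 \<Longrightarrow> 0 \<le> mollifier e x"
  unfolding mollifier_def by (intro prod_nonneg ballI tent_nonneg)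

lemma mollifier_le_weight:
  assumes "0 < e" "e \<le> 1"
  shows "mollifier e (x::real^'n) \<le> (2 / e) ^ CARD('n) * weight x"
proof -
  have "mollifier e x \<le> (\<Prod>i\<in>(UNIV::'n set). (2 / e) * (1 / (1 + (x $ i)\<^sup>2)))"
    unfolding mollifier_def
    by (intro prod_mono conjI tent_nonneg tent_weight_bound assms)
  then show ?thesis by (simp add: weight_def prod.distrib prod_dividef power_divide)
qed

text \<open>On the cube of side \<open>e\<close> each factor is at least half of its maximum. A
  crude lower bound on the mass is enough; it accounts for the factor \<open>2 ^ CARD('n)\<close>
  below.\<close>

lemma integral_mollifier_ge:
  assumes "0 < e" "e \<le> 1"
  shows "(1 / 2) ^ CARD('n) \<le> integral UNIV (mollifier e :: real^'n \<Rightarrow> real)"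
proof -
  let ?Q = "cbox (\<chi> i. - (e / 2)) (\<chi> i. e / 2) :: (real^'n) set"
  have int: "(mollifier e :: real^'n \<Rightarrow> real) integrable_on UNIV"
    by (rule integrable_of_weight_bound(1)[OF continuous_mollifier, of _ "(2 / e) ^ CARD('n)"])
      (simp add: mollifier_nonneg mollifier_le_weight assms)
  have intQ: "(mollifier e :: real^'n \<Rightarrow> real) integrable_on ?Q"
    by (rule integrable_on_subcbox[OF int]) simp
  have "Henstock_Kurzweil_Integration.content ?Q = e ^ CARD('n)"
    using assms by (subst content_cbox_cart) (auto simp: interval_ne_empty_cart)
  then have "((\<lambda>x. (1 / (2 * e)) ^ CARD('n)) has_integral e ^ CARD('n) * (1 / (2 * e)) ^ CARD('n)) ?Q"
    using has_integral_const[of "(1 / (2 * e)) ^ CARD('n)" "\<chi> i. - (e / 2)" "(\<chi> i. e / 2) :: real^'n"] by simp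
  moreover have "e ^ CARD('n) * (1 / (2 * e)) ^ CARD('n) = (1 / 2) ^ CARD('n)"
    using assms by (simp flip: power_mult_distrib)
  ultimately have "((\<lambda>x. (1 / (2 * e)) ^ CARD('n)) has_integral (1 / 2) ^ CARD('n)) ?Q" by simp
  then have "(1 / 2) ^ CARD('n) \<le> integral ?Q (mollifier e)"
  proof (rule has_integral_le[OF _ integrable_integral[OF intQ]])
    fix x assume x: "x \<in> ?Q"
    have "(\<Prod>i\<in>(UNIV::'n set). 1 / (2 * e)) \<le> mollifier e x"
      unfolding mollifier_def
    proof (rule prod_mono)
      fix i
      have "\<bar>x $ i\<bar> \<le> e / 2" using x by (auto simp: mem_box_cart abs_le_iff dest: spec[of _ i])
      then show "0 \<le> 1 / (2 * e) \<and> 1 / (2 * e) \<le> tent e (x $ i)"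
        using tent_ge[of e "x $ i"] assms by simp
    qed
    then show "(1 / (2 * e)) ^ CARD('n) \<le> mollifier e x" by simp
  qed
  also have "\<dots> \<le> integral UNIV (mollifier e :: real^'n \<Rightarrow> real)"
    by (rule integral_subset_le[OF _ intQ int]) (auto simp: mollifier_nonneg assms)
  finally show ?thesis .
qed

lemma mollifier_eq_0:
  fixes e :: real
  assumes "e > 0" "norm (x::real^'n) \<ge> CARD('n) * e"
  shows "mollifier e x = 0"
proof -
  have "\<exists>i. \<bar>x $ i\<bar> \<ge> e"
  proof (rule ccontr)
    assume "\<nexists>i. \<bar>x $ i\<bar> \<ge> e"
    then have "(\<Sum>i\<in>UNIV. \<bar>x $ i\<bar>) < (\<Sum>i\<in>(UNIV::'n set). e)"
      by (intro sum_strict_mono) (auto simp: not_le)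
    then show False using norm_le_l1_cart[of x] assms by simp
  qed
  then show ?thesis using tent_eq_0[OF assms(1)] unfolding mollifier_def by (auto intro!: prod_zero)
qed

text \<open>As the mollifiers concentrate at \<open>0\<close>, a bound on the averages that is
  uniform in \<open>e\<close> passes to the value there. It is used with a norm bound in the Sobolev
  inequality, and with \<open>A = 0\<close> to show that a limit function vanishes.\<close>

lemma norm_at_0_le_of_mollified:
  fixes d :: "real^'n \<Rightarrow> 'b::banach"
  assumes d: "continuous_on UNIV d" "\<And>x. norm (d x) \<le> M"
    and A: "\<And>e. 0 < e \<Longrightarrow> e \<le> 1 \<Longrightarrow> norm (integral UNIV (\<lambda>x. mollifier e x *\<^sub>R d x)) \<le> A"
  shows "norm (d 0) \<le> 2 ^ CARD('n) * A"
proof (rule field_le_epsilon)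
  fix \<eta> :: real assume "\<eta> > 0"
  have "A \<ge> 0" by (rule order_trans[OF norm_ge_zero A[of 1]]) simp_all
  have M: "M \<ge> 0" by (rule order_trans[OF norm_ge_zero d(2)])
  obtain \<delta> where \<delta>: "\<delta> > 0" "\<And>x. norm x < \<delta> \<Longrightarrow> norm (d x - d 0) < \<eta>"
    using d(1) \<open>\<eta> > 0\<close> unfolding continuous_on_iff by (metis UNIV_I diff_zero dist_norm)
  \<comment> \<open>The mollifier lives where \<open>norm x < CARD('n) * e\<close>; this choice puts
    its support inside the ball of radius \<open>\<delta>\<close>.\<close>
  define e where "e = min 1 (\<delta> / (2 * CARD('n)))"
  have e: "0 < e" "e \<le> 1" using \<delta> by (auto simp: e_def)
  have small: "CARD('n) * e < \<delta>"
  proof -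
    have "CARD('n) * e \<le> CARD('n) * (\<delta> / (2 * CARD('n)))" by (intro mult_left_mono) (auto simp: e_def)
    then show ?thesis using \<delta> by simp
  qed
  let ?\<rho> = "mollifier e :: real^'n \<Rightarrow> real"
  have r: "\<bar>?\<rho> x\<bar> \<le> (2 / e) ^ CARD('n) * weight x" for x
    using mollifier_nonneg[OF e(1), of x] mollifier_le_weight[OF e, of x] by simp
  have int\<rho>: "?\<rho> integrable_on UNIV"
    by (rule integrable_of_weight_bound(1)[OF continuous_mollifier]) (use r in simp)
  have bnd: "(\<lambda>x. ?\<rho> x *\<^sub>R u x) integrable_on UNIV"
    if u: "continuous_on UNIV u" "\<And>x. norm (u x) \<le> N" "N \<ge> 0" for u :: "real^'n \<Rightarrow> 'b" and N
  proof (rule integrable_of_weight_bound(1))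
    show "continuous_on UNIV (\<lambda>x. ?\<rho> x *\<^sub>R u x)" by (intro continuous_on_scaleR continuous_mollifier u)
    show "norm (?\<rho> x *\<^sub>R u x) \<le> ((2 / e) ^ CARD('n) * N) * weight x" for x
    proof -
      have "norm (?\<rho> x *\<^sub>R u x) \<le> ((2 / e) ^ CARD('n) * weight x) * N"
        unfolding norm_scaleR using r[of x] u by (intro mult_mono) (auto intro: order_trans[OF abs_ge_zero])
      then show ?thesis by (simp add: mult_ac)
    qed
  qed
  define c where "c = integral UNIV ?\<rho>"
  have c: "(1 / 2) ^ CARD('n) \<le> c" unfolding c_def by (rule integral_mollifier_ge[OF e])
  then have "c > 0" by (rule less_le_trans[rotated]) simp
  have int1: "(\<lambda>x. ?\<rho> x *\<^sub>R d x) integrable_on UNIV" by (rule bnd[OF d M])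
  have int2: "(\<lambda>x. ?\<rho> x *\<^sub>R (d x - d 0)) integrable_on UNIV"
  proof (rule bnd)
    show "norm (d x - d 0) \<le> M + M" for x by (rule order_trans[OF norm_triangle_ineq4 add_mono[OF d(2) d(2)]])
  qed (use d M in \<open>auto intro: continuous_on_diff\<close>)
  have "norm (integral UNIV (\<lambda>x. ?\<rho> x *\<^sub>R (d x - d 0))) \<le> integral UNIV (\<lambda>x. ?\<rho> x * \<eta>)"
  proof (rule Henstock_Kurzweil_Integration.integral_norm_bound_integral[OF int2])
    show "(\<lambda>x. ?\<rho> x * \<eta>) integrable_on UNIV" by (rule integrable_on_mult_left[OF int\<rho>])
    show "norm (?\<rho> x *\<^sub>R (d x - d 0)) \<le> ?\<rho> x * \<eta>" for x
    proof (cases "norm x \<ge> CARD('n) * e")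
      case False
      then have "norm (d x - d 0) \<le> \<eta>" using \<delta>(2)[of x] small by auto
      then show ?thesis using mollifier_nonneg[OF e(1), of x] by (simp add: mult_left_mono)
    qed (simp add: mollifier_eq_0 e)
  qed
  then have 1: "norm (integral UNIV (\<lambda>x. ?\<rho> x *\<^sub>R (d x - d 0))) \<le> c * \<eta>" by (simp add: c_def)
  have "((\<lambda>x. ?\<rho> x *\<^sub>R d 0) has_integral c *\<^sub>R d 0) UNIV"
    unfolding c_def by (rule has_integral_scaleR_left[OF integrable_integral[OF int\<rho>]])
  moreover have "((\<lambda>x. ?\<rho> x *\<^sub>R d x - ?\<rho> x *\<^sub>R (d x - d 0)) has_integral
      integral UNIV (\<lambda>x. ?\<rho> x *\<^sub>R d x) - integral UNIV (\<lambda>x. ?\<rho> x *\<^sub>R (d x - d 0))) UNIV"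
    by (intro has_integral_diff integrable_integral int1 int2)
  then have "((\<lambda>x. ?\<rho> x *\<^sub>R d 0) has_integral
      integral UNIV (\<lambda>x. ?\<rho> x *\<^sub>R d x) - integral UNIV (\<lambda>x. ?\<rho> x *\<^sub>R (d x - d 0))) UNIV"
    by (simp add: algebra_simps)
  ultimately have "c *\<^sub>R d 0 = integral UNIV (\<lambda>x. ?\<rho> x *\<^sub>R d x) - integral UNIV (\<lambda>x. ?\<rho> x *\<^sub>R (d x - d 0))"
    by (rule has_integral_unique)
  then have "norm (c *\<^sub>R d 0) \<le> A + c * \<eta>"
    by (simp only:) (rule order_trans[OF norm_triangle_ineq4 add_mono[OF A[OF e] 1]])
  then have "norm (d 0) \<le> A / c + \<eta>" using \<open>c > 0\<close> by (simp add: field_simps)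
  moreover have "A / c \<le> A / (1 / 2) ^ CARD('n)" using c \<open>A \<ge> 0\<close> \<open>c > 0\<close> by (intro divide_left_mono) auto
  ultimately show "norm (d 0) \<le> 2 ^ CARD('n) * A + \<eta>" by (simp add: power_divide mult.commute)
qed

section \<open>Product kernels\<close>

text \<open>\<open>J\<close> records the coordinates in which the hat has been replaced by its
  resolvent kernel, so that \<open>{}\<close> gives the mollifier and \<open>UNIV\<close> the full
  kernel, with all intermediate stages between them.\<close>

definition tensor_kernel :: "(real \<Rightarrow> real) \<Rightarrow> (real \<Rightarrow> real) \<Rightarrow> 'n set \<Rightarrow> real^'n \<Rightarrow> real"
  where "tensor_kernel k l J x = (\<Prod>i\<in>UNIV. if i \<in> J then k (x $ i) else l (x $ i))"

lemma tensor_kernel_split: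
  "tensor_kernel k l J x = (if j \<in> J then k (x $ j) else l (x $ j))
    * (\<Prod>i\<in>UNIV - {j}. if i \<in> J then k (x $ i) else l (x $ i))"
  unfolding tensor_kernel_def by (rule prod.remove) auto

fun iter_one_plus_deriv :: "'n list \<Rightarrow> (real^'n \<Rightarrow> 'b::real_normed_vector) \<Rightarrow> real^'n \<Rightarrow> 'b" where
  "iter_one_plus_deriv [] f = f"
| "iter_one_plus_deriv (j # js) f = iter_one_plus_deriv js (\<lambda>x. f x + dir_deriv (axis j 1) f x)"

lemma axis_Basis: "axis j (1::real) \<in> Basis"
  by (simp add: axis_in_Basis_iff)

lemma schwartz_one_plus_deriv: "schwartz f \<Longrightarrow> schwartz (\<lambda>x. f x + dir_deriv (axis j 1) f x)"
  by (rule schwartz_add[OF _ schwartzD(4)[OF _ axis_Basis]])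

lemma schwartz_iter_one_plus_deriv: "schwartz f \<Longrightarrow> schwartz (iter_one_plus_deriv js f)"
  by (induction js arbitrary: f) (simp_all add: schwartz_one_plus_deriv)

lemma iter_one_plus_deriv_translate:
  "iter_one_plus_deriv js (\<lambda>x. f (x - a)) = (\<lambda>x. iter_one_plus_deriv js f (x - a))"
proof (induction js arbitrary: f)
  case (Cons j js)
  have "dir_deriv (axis j 1) (\<lambda>x. f (x - a)) = (\<lambda>x. dir_deriv (axis j 1) f (x - a))"
    unfolding dir_deriv_def by (simp add: algebra_simps)
  then show ?case using Cons[of "\<lambda>x. f x + dir_deriv (axis j 1) f x"] by simp
qed simp

text \<open>Each integration by parts removes one factor \<open>1 + \<partial>_j\<close> from the
  function and turns the resolvent kernel in coordinate \<open>j\<close> back into the hat. The set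
  \<open>S\<close> is arbitrary so that the tail of the list can be treated while \<open>j\<close>
  is still in it.\<close>

lemma tensor_kernel_integral:
  fixes f :: "real^'n \<Rightarrow> 'b::banach"
  assumes e: "0 < e" "e \<le> 1"
    and k: "\<And>s. (k has_real_derivative k s - tent e s) (at s)" "\<And>s. 0 \<le> k s" "\<And>s. k s \<le> 2 * exp 2"
    and js: "distinct js" "S \<inter> set js = {}" and f: "schwartz f"
  shows "integral UNIV (\<lambda>x. tensor_kernel k (tent e) (S \<union> set js) x *\<^sub>R iter_one_plus_deriv js f x)
    = integral UNIV (\<lambda>x. tensor_kernel k (tent e) S x *\<^sub>R f x)"
  using js f
proof (induction js arbitrary: S f)
  case (Cons j js)
  let ?K = "tensor_kernel k (tent e) :: 'n set \<Rightarrow> _"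
  \<comment> \<open>\<open>1 \<le> L\<close> lets products over fewer coordinates be bounded by the
    full power. The two summands of \<open>A\<close> are a bound for the kernels and a Lipschitz
    constant along one axis.\<close>
  define L where "L = max 1 (max (2 * exp 2) (1 / e))"
  define A where "A = L ^ CARD('n) + (1 / e\<^sup>2) * L ^ CARD('n)"
  have L: "1 \<le> L" "2 * exp 2 \<le> L" "1 / e \<le> L" by (auto simp: L_def)
  have fac: "\<bar>k s\<bar> \<le> L" "\<bar>tent e s\<bar> \<le> L" for s
    using k(2,3)[of s] tent_nonneg[OF e(1), of s] tent_le[OF e(1), of s] L by auto
  have pb: "\<bar>\<Prod>i\<in>I. if i \<in> J then k (x $ i) else tent e (x $ i)\<bar> \<le> L ^ CARD('n)" for I J and x :: "real^'n"
  proof -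
    have "\<bar>\<Prod>i\<in>I. if i \<in> J then k (x $ i) else tent e (x $ i)\<bar> \<le> (\<Prod>i\<in>I. L)"
      unfolding abs_prod using fac by (intro prod_mono) auto
    also have "\<dots> \<le> L ^ CARD('n)" using L(1) by (simp add: power_increasing card_mono)
    finally show ?thesis .
  qed
  have L0: "L ^ CARD('n) \<ge> 0" using L(1) by simp
  have Kb: "\<bar>?K J x\<bar> \<le> A" for J x
  proof -
    have "\<bar>?K J x\<bar> \<le> L ^ CARD('n)" unfolding tensor_kernel_def by (rule pb)
    then show ?thesis using L0 by (simp add: A_def add_increasing2)
  qed
  have cont_k: "continuous_on UNIV k"
    using k(1) by (meson DERIV_isCont continuous_at_imp_continuous_on)
  have Kc: "continuous_on UNIV (?K J)" for J
  proof -
    have "continuous_on UNIV (\<lambda>x::real^'n. if i \<in> J then k (x $ i) else tent e (x $ i))" for i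
    proof (cases "i \<in> J")
      case True
      have "continuous_on UNIV (\<lambda>x::real^'n. k (x $ i))"
        by (rule continuous_on_compose2[OF cont_k]) (auto intro!: continuous_intros)
      then show ?thesis using True by simp
    qed (simp add: continuous_tent_component)
    then show ?thesis unfolding tensor_kernel_def by (intro continuous_on_prod)
  qed
  have j: "j \<notin> S" "j \<notin> set js" using Cons.prems by auto
  \<comment> \<open>The factors of the other coordinates are constant along the axis
    \<open>j\<close>, so the derivative sees a one-dimensional kernel only.\<close>
  define R where "R x = (\<Prod>i\<in>UNIV - {j}. if i \<in> S then k (x $ i) else tent e (x $ i))" for x :: "real^'n"
  have R: "R (x + t *\<^sub>R axis j 1) = R x" for x t
    unfolding R_def by (rule prod.cong) (auto simp: axis_def)
  have Rb: "\<bar>R x\<bar> \<le> L ^ CARD('n)" for x unfolding R_def by (rule pb)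
  have K1: "?K (insert j S) x = k (x $ j) * R x" for x
    unfolding tensor_kernel_split[of _ _ _ x j] R_def by (auto intro!: prod.cong)
  have K0: "?K S x = tent e (x $ j) * R x" for x
    unfolding tensor_kernel_split[of _ _ _ x j] R_def using j by auto
  have "integral UNIV (\<lambda>x. ?K (S \<union> set (j # js)) x *\<^sub>R iter_one_plus_deriv (j # js) f x)
      = integral UNIV (\<lambda>x. ?K (insert j S \<union> set js) x *\<^sub>R iter_one_plus_deriv js (\<lambda>x. f x + dir_deriv (axis j 1) f x) x)"
    by simp
  also have "\<dots> = integral UNIV (\<lambda>x. ?K (insert j S) x *\<^sub>R (f x + dir_deriv (axis j 1) f x))"
    using Cons.prems j by (intro Cons.IH schwartz_one_plus_deriv) auto
  also have "\<dots> = integral UNIV (\<lambda>x. ?K S x *\<^sub>R f x)"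
  proof (rule integration_by_parts_kernel[OF Cons.prems(3) axis_Basis Kc Kc Kb Kb])
    show "has_dir_deriv (axis j 1) (?K (insert j S)) (\<lambda>x. ?K (insert j S) x - ?K S x)"
      unfolding has_dir_deriv_def
    proof
      fix x :: "real^'n"
      have "((\<lambda>t. x $ j + t) has_real_derivative 1) (at 0)" by (auto intro!: derivative_eq_intros)
      moreover have "(k has_real_derivative k (x $ j) - tent e (x $ j)) (at (x $ j + 0))" using k(1) by simp
      ultimately have "((\<lambda>t. k (x $ j + t)) has_real_derivative (k (x $ j) - tent e (x $ j)) * 1) (at 0)"
        by (rule DERIV_chain2[rotated])
      then have "((\<lambda>t. k (x $ j + t) * R x) has_real_derivative ((k (x $ j) - tent e (x $ j)) * 1) * R x) (at 0)"
        by (rule DERIV_cmult_right)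
      then show "((\<lambda>t. ?K (insert j S) (x + t *\<^sub>R axis j 1)) has_vector_derivative
          ?K (insert j S) x - ?K S x) (at 0)"
        unfolding K1 K0 R by (simp add: has_real_derivative_iff_has_vector_derivative algebra_simps axis_def)
    qed
    show "\<bar>?K S (x + s *\<^sub>R axis j 1) - ?K S x\<bar> \<le> A * \<bar>s\<bar>" for x s
    proof -
      have "\<bar>?K S (x + s *\<^sub>R axis j 1) - ?K S x\<bar> = \<bar>tent e (x $ j + s) - tent e (x $ j)\<bar> * \<bar>R x\<bar>"
        unfolding K0 R by (simp add: axis_def left_diff_distrib[symmetric] abs_mult)
      also have "\<dots> \<le> ((1 / e\<^sup>2) * \<bar>s\<bar>) * L ^ CARD('n)"
        using tent_lipschitz[OF e(1), of "x $ j + s" "x $ j"] Rb[of x] by (intro mult_mono) auto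
      also have "\<dots> \<le> A * \<bar>s\<bar>" using L0 by (simp add: A_def algebra_simps)
      finally show ?thesis .
    qed
  qed
  finally show ?case .
qed simp

section \<open>Cauchy-Schwarz in the module and the Sobolev bound\<close>

context cstar
begin

lemma st_of_real: "st (of_real r) = of_real r"
  by (simp add: of_real_def st_scaleR st_1)

lemma l2_dominated_integrable:
  fixes f g :: "real^'n \<Rightarrow> 'a"
  assumes "l2_dominated f" "l2_dominated g"
  shows "(\<lambda>x. st (f x) * g x) integrable_on UNIV"
proof -
  obtain A B where A: "\<And>x. (norm (f x))\<^sup>2 \<le> A * weight x" and B: "\<And>x. (norm (g x))\<^sup>2 \<le> B * weight x"
    using assms unfolding l2_dominated_def by blast
  show ?thesis
  proof (rule integrable_of_weight_bound(1))
    show "continuous_on UNIV (\<lambda>x. st (f x) * g x)"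
      using assms unfolding l2_dominated_def
      by (intro continuous_on_mult bounded_linear.continuous_on[OF bounded_linear_st]) auto
    show "norm (st (f x) * g x) \<le> (A + B) * weight x" for x
    proof -
      have "norm (st (f x) * g x) \<le> norm (f x) * norm (g x)"
        using norm_mult_ineq[of "st (f x)" "g x"] by (simp add: norm_st)
      also have "\<dots> \<le> (norm (f x))\<^sup>2 + (norm (g x))\<^sup>2"
        using sum_squares_bound[of "norm (f x)" "norm (g x)"]
          mult_nonneg_nonneg[OF norm_ge_zero[of "f x"] norm_ge_zero[of "g x"]] by linarith
      also have "\<dots> \<le> (A + B) * weight x" using A[of x] B[of x] by (simp add: distrib_right)
      finally show ?thesis .
    qed
  qed
qed

lemma l2norm_le:
  fixes f :: "real^'n \<Rightarrow> 'a"
  assumes "continuous_on UNIV f" "\<And>x. (norm (f x))\<^sup>2 \<le> B * weight x"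
  shows "l2norm st f \<le> sqrt (B * integral UNIV (weight :: real^'n \<Rightarrow> real))"
  unfolding l2norm_def
proof (intro real_sqrt_le_mono integrable_of_weight_bound(2))
  show "continuous_on UNIV (\<lambda>x. st (f x) * f x)"
    using assms(1) by (intro continuous_on_mult bounded_linear.continuous_on[OF bounded_linear_st])
  show "norm (st (f x) * f x) \<le> B * weight x" for x using assms(2) by (simp add: norm_st_mult_self)
qed

lemma psd_integral:
  assumes "((\<lambda>x::real^'n. st (f x) * f x) has_integral y) UNIV"
  shows "psd y"
  using has_integral_closed_cone[of "{h. psd h}", OF closed_psd _ _ _ _ assms]
  by (simp add: psd_0 psd_add psd_scaleR psd_star_mult_self)

text \<open>The classical argument with an algebra-valued coefficient: expand the positive integral
  of \<open>st (f x - g x * c) * (f x - g x * c)\<close> for \<open>c = a / s\<close>, and replace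
  the Gram element \<open>G\<close> by the scalar \<open>s\<close>, which dominates it. Then
  \<open>st a * a\<close> lies below \<open>s *\<^sub>R F\<close>, and the norm is monotone on
  positive elements.\<close>

lemma l2_cauchy_schwarz:
  fixes f g :: "real^'n \<Rightarrow> 'a"
  assumes f: "l2_dominated f" and g: "l2_dominated g"
  shows "norm (integral UNIV (\<lambda>x. st (g x) * f x)) \<le> l2norm st g * l2norm st f"
proof -
  define a where "a = integral UNIV (\<lambda>x. st (g x) * f x)"
  define F where "F = integral UNIV (\<lambda>x. st (f x) * f x)"
  define G where "G = integral UNIV (\<lambda>x. st (g x) * g x)"
  have a: "((\<lambda>x. st (g x) * f x) has_integral a) UNIV"
    unfolding a_def by (intro integrable_integral l2_dominated_integrable f g)
  have F: "((\<lambda>x. st (f x) * f x) has_integral F) UNIV"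
    unfolding F_def by (intro integrable_integral l2_dominated_integrable f)
  have G: "((\<lambda>x. st (g x) * g x) has_integral G) UNIV"
    unfolding G_def by (intro integrable_integral l2_dominated_integrable g)
  have sta: "((\<lambda>x. st (f x) * g x) has_integral st a) UNIV"
    using has_integral_linear[OF a bounded_linear_st] by (simp add: o_def st_simps)
  have bound: "norm (st a * a) \<le> s * norm F" if s: "s > 0" "norm G \<le> s" for s
  proof -
    define c where "c = (1 / s) *\<^sub>R a"
    have "((\<lambda>x. st (f x) * f x - st (f x) * g x * c - st c * (st (g x) * f x) + st c * (st (g x) * g x) * c)
        has_integral F - st a * c - st c * a + st c * G * c) UNIV"
      by (intro has_integral_add has_integral_diff F has_integral_mult_left has_integral_mult_right a G sta)
    moreover have "st (f x - g x * c) * (f x - g x * c)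
        = st (f x) * f x - st (f x) * g x * c - st c * (st (g x) * f x) + st c * (st (g x) * g x) * c" for x
      by (simp add: st_simps algebra_simps)
    ultimately have "((\<lambda>x. st (f x - g x * c) * (f x - g x * c))
        has_integral F - st a * c - st c * a + st c * G * c) UNIV" by simp
    then have 1: "psd (F - st a * c - st c * a + st c * G * c)" by (rule psd_integral)
    \<comment> \<open>Positivity of \<open>s - G\<close> is conjugated by \<open>c\<close> through
      its square root \<open>k\<close>.\<close>
    have "psd (s *\<^sub>R 1 - G)" using psd_selfadjoint[OF psd_integral[OF G]] s by (intro psd_norm_minus)
    then obtain k where k: "psd k" "k * k = s *\<^sub>R 1 - G" using psd_sqrt by blast
    have "st (k * c) * (k * c) = st c * (k * k) * c"
      using k(1) by (simp add: st_simps psd_selfadjoint mult.assoc)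
    also have "\<dots> = s *\<^sub>R (st c * c) - st c * G * c" by (simp add: k(2) algebra_simps)
    finally have 2: "psd (s *\<^sub>R (st c * c) - st c * G * c)"
      using psd_star_mult_self[of "k * c"] by simp
    have "psd (F - (1 / s) *\<^sub>R (st a * a))"
      using psd_add[OF 1 2] s by (simp add: c_def st_simps algebra_simps)
    then have "norm ((1 / s) *\<^sub>R (st a * a)) \<le> norm F"
      using s by (intro psd_norm_mono psd_scaleR psd_star_mult_self) auto
    then show ?thesis using s by (simp add: field_simps)
  qed
  have "(norm a)\<^sup>2 \<le> norm G * norm F"
  proof (rule field_le_epsilon)
    fix e :: real assume e: "e > 0"
    \<comment> \<open>The surplus keeps \<open>s\<close> positive even if \<open>G = 0\<close> and
      costs at most \<open>e\<close> after multiplication by \<open>norm F\<close>.\<close>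
    define s where "s = norm G + e / (norm F + 1)"
    have "e / (norm F + 1) > 0" using e by (simp add: add_nonneg_pos)
    then have "s > 0" "norm G \<le> s" by (auto simp: s_def add_nonneg_pos)
    from bound[OF this] have "(norm a)\<^sup>2 \<le> norm G * norm F + e / (norm F + 1) * norm F"
      by (simp add: norm_st_mult_self s_def distrib_right)
    also have "e / (norm F + 1) * norm F \<le> e"
      using e by (simp add: divide_simps add_nonneg_pos)
    finally show "(norm a)\<^sup>2 \<le> norm G * norm F + e" by simp
  qed
  then have "norm a \<le> sqrt (norm G * norm F)" by (rule real_le_rsqrt)
  then show ?thesis by (simp add: a_def F_def G_def l2norm_def real_sqrt_mult)
qed

lemma norm_kernel_integral_le:
  fixes f :: "real^'n \<Rightarrow> 'a"
  assumes K: "continuous_on UNIV K" "\<And>x. (K x)\<^sup>2 \<le> B * weight x" and f: "l2_dominated f"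
  shows "norm (integral UNIV (\<lambda>x. K x *\<^sub>R f x))
    \<le> sqrt (B * integral UNIV (weight :: real^'n \<Rightarrow> real)) * l2norm st f"
proof -
  let ?g = "\<lambda>x. of_real (K x) :: 'a"
  have g: "l2_dominated ?g"
    unfolding l2_dominated_def using K by (auto intro!: continuous_intros)
  have "norm (integral UNIV (\<lambda>x. st (?g x) * f x)) \<le> l2norm st ?g * l2norm st f"
    by (rule l2_cauchy_schwarz[OF f g])
  also have "\<dots> \<le> sqrt (B * integral UNIV (weight :: real^'n \<Rightarrow> real)) * l2norm st f"
    using K by (intro mult_right_mono l2norm_le) (auto intro!: continuous_intros simp: l2norm_def)
  finally show ?thesis unfolding st_of_real by (simp add: of_real_def)
qed

lemma l2norm_translate:
  fixes f :: "real^'n \<Rightarrow> 'a"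
  assumes "schwartz f"
  shows "l2norm st (\<lambda>x. f (x - a)) = l2norm st f"
  unfolding l2norm_def
  using integral_translate_UNIV[OF l2_dominated_integrable[OF
    schwartz_l2_dominated[OF assms] schwartz_l2_dominated[OF assms]], of "- a"] by simp

text \<open>The kernel identity is applied in mollified form, with a kernel depending on
  \<open>e\<close> but a bound that does not. Translation invariance carries the estimate from
  \<open>0\<close> to any point.\<close>

lemma sobolev:
  fixes js :: "'n::finite list"
  assumes js: "distinct js" "set js = UNIV"
  obtains C where "C \<ge> 0"
    "\<And>f x. schwartz f \<Longrightarrow> norm (f x :: 'a) \<le> C * l2norm st (iter_one_plus_deriv js f)"
proof -
  let ?W = "integral UNIV (weight :: real^'n \<Rightarrow> real)"
  \<comment> \<open>The product over all coordinates of the one-dimensional square bounds, times the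
    mass of the weight, bounds the square of the kernel norm.\<close>
  define C where "C = sqrt ((8 * exp 4) ^ CARD('n) * ?W)"
  have at0: "norm (f 0) \<le> 2 ^ CARD('n) * (C * l2norm st (iter_one_plus_deriv js f))"
    if f: "schwartz f" for f :: "real^'n \<Rightarrow> 'a"
  proof -
    obtain M where M: "\<And>x. norm (f x) \<le> M" using schwartz_bounded[OF f] by blast
    show ?thesis
    proof (rule norm_at_0_le_of_mollified[OF schwartzD(2)[OF f] M])
      fix e :: real assume e: "0 < e" "e \<le> 1"
      obtain k where k: "\<And>s. (k has_real_derivative k s - tent e s) (at s)"
        "\<And>s. 0 \<le> k s" "\<And>s. k s \<le> 2 * exp 2" "\<And>s. (k s)\<^sup>2 \<le> (8 * exp 4) * (1 / (1 + s\<^sup>2))"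
        using tent_resolvent_kernel[OF e] by blast
      let ?K = "\<lambda>x::real^'n. \<Prod>i\<in>UNIV. k (x $ i)"
      have "integral UNIV (\<lambda>x. mollifier e x *\<^sub>R f x) = integral UNIV (\<lambda>x. ?K x *\<^sub>R iter_one_plus_deriv js f x)"
        using tensor_kernel_integral[OF e k(1-3) js(1), of "{}" f] f js(2)
        by (simp add: tensor_kernel_def mollifier_def)
      also have "norm \<dots> \<le> C * l2norm st (iter_one_plus_deriv js f)"
        unfolding C_def
      proof (rule norm_kernel_integral_le[OF _ _ schwartz_l2_dominated[OF schwartz_iter_one_plus_deriv[OF f]]])
        have ck: "continuous_on UNIV k" using k(1) by (meson DERIV_isCont continuous_at_imp_continuous_on)
        show "continuous_on UNIV ?K"
          by (intro continuous_on_prod continuous_on_compose2[OF ck]) (auto intro!: continuous_intros)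
        show "(?K x)\<^sup>2 \<le> (8 * exp 4) ^ CARD('n) * weight x" for x
        proof -
          have "(\<Prod>i\<in>UNIV. (k (x $ i))\<^sup>2) \<le> (\<Prod>i\<in>UNIV. (8 * exp 4) * (1 / (1 + (x $ i)\<^sup>2)))"
            using k(4) by (intro prod_mono) auto
          then show ?thesis
            by (simp add: weight_def prod.distrib prod_dividef prod_power_distrib power_mult_distrib)
        qed
      qed
      finally show "norm (integral UNIV (\<lambda>x. mollifier e x *\<^sub>R f x)) \<le> C * l2norm st (iter_one_plus_deriv js f)" .
    qed
  qed
  show thesis
  proof
    show "2 ^ CARD('n) * C \<ge> 0" by (simp add: C_def integral_weight_nonneg)
    fix f :: "real^'n \<Rightarrow> 'a" and x assume f: "schwartz f"
    have "norm (f (0 - - x)) \<le> 2 ^ CARD('n) * (C * l2norm st (iter_one_plus_deriv js (\<lambda>y. f (y - - x))))"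
      by (rule at0[OF schwartz_translate[OF f]])
    then show "norm (f x) \<le> 2 ^ CARD('n) * C * l2norm st (iter_one_plus_deriv js f)"
      unfolding iter_one_plus_deriv_translate l2norm_translate[OF schwartz_iter_one_plus_deriv[OF f]]
      by (simp add: mult.assoc)
  qed
qed

end

section \<open>The Heisenberg representation\<close>

text \<open>Dissipativity of the generator of an isometric flow, without an inner product: the
  reflected point \<open>2 *\<^sub>R f 0 - f t\<close> has norm at least \<open>norm (f 0)\<close>,
  and to first order it is a convex combination of \<open>f 0\<close> and
  \<open>f 0 - D\<close>.\<close>

lemma norm_le_norm_minus_derivative:
  fixes f :: "real \<Rightarrow> 'e::real_normed_vector"
  assumes f: "(f has_vector_derivative D) (at 0)" and iso: "\<And>t. norm (f t) = norm (f 0)"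
  shows "norm (f 0) \<le> norm (f 0 - D)"
proof (rule field_le_epsilon)
  fix e :: real assume "e > 0"
  then obtain d where d: "d > 0" "\<And>t. norm t < d \<Longrightarrow> norm (f t - f 0 - t *\<^sub>R D) \<le> e * norm t"
    using f unfolding has_vector_derivative_def has_derivative_at_alt by auto
  define t where "t = min 1 (d / 2)"
  have t: "0 < t" "t \<le> 1" "norm t < d" using d(1) by (auto simp: t_def)
  have "norm (f 0) = norm (2 *\<^sub>R f 0) - norm (f t)" by (simp add: iso[of t])
  also have "\<dots> \<le> norm (2 *\<^sub>R f 0 - f t)" by (rule norm_triangle_ineq2)
  also have "2 *\<^sub>R f 0 - f t = (1 - t) *\<^sub>R f 0 + t *\<^sub>R (f 0 - D) - (f t - f 0 - t *\<^sub>R D)"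
    by (simp add: algebra_simps scaleR_2)
  also have "norm \<dots> \<le> norm ((1 - t) *\<^sub>R f 0 + t *\<^sub>R (f 0 - D)) + norm (f t - f 0 - t *\<^sub>R D)"
    by (rule norm_triangle_ineq4)
  also have "\<dots> \<le> (norm ((1 - t) *\<^sub>R f 0) + norm (t *\<^sub>R (f 0 - D))) + e * norm t"
    using t d(2)[of t] by (intro add_mono norm_triangle_ineq)
  also have "\<dots> = (1 - t) * norm (f 0) + t * norm (f 0 - D) + e * t" using t by simp
  finally have "t * norm (f 0) \<le> t * (norm (f 0 - D) + e)" by (simp add: algebra_simps)
  then show "norm (f 0) \<le> norm (f 0 - D) + e" using t(1) by simp
qed

lemma smooth_map_scaleR:
  fixes f :: "'v::euclidean_space \<Rightarrow> 'b::real_normed_vector"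
  assumes "smooth_map f"
  shows "smooth_map (\<lambda>x. r *\<^sub>R f x)"
proof (rule smooth_map_coinduct[where X = "\<lambda>h. \<exists>f. smooth_map f \<and> h = (\<lambda>x. r *\<^sub>R f x)"])
  fix h :: "'v \<Rightarrow> 'b" and v :: 'v assume "\<exists>f. smooth_map f \<and> h = (\<lambda>x. r *\<^sub>R f x)" "v \<in> Basis"
  then obtain f where f: "smooth_map f" "h = (\<lambda>x. r *\<^sub>R f x)" "has_dir_deriv v f (dir_deriv v f)"
    "smooth_map (dir_deriv v f)" using smooth_mapD by blast
  have "has_dir_deriv v h (\<lambda>x. r *\<^sub>R dir_deriv v f x)"
    using f(3) unfolding has_dir_deriv_def f(2)
    by (intro allI bounded_linear.has_vector_derivative[OF bounded_linear_scaleR_right]) blast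
  with f(4) show "\<exists>h'. (\<exists>f. smooth_map f \<and> h' = (\<lambda>x. r *\<^sub>R f x)) \<and> has_dir_deriv v h h'" by blast
qed (use assms smooth_map_continuous in \<open>auto intro!: continuous_on_scaleR continuous_on_const\<close>)

text \<open>Needed for the linear coefficient in the orbit map of \<open>gen_b\<close>.
  Differentiating the linear factor gives a constant, so functions
  \<open>l x *\<^sub>R f x + g x\<close> form a class closed under derivatives.\<close>

lemma smooth_map_linear_mult:
  fixes f :: "'v::euclidean_space \<Rightarrow> 'b::real_normed_vector" and l :: "'v \<Rightarrow> real"
  assumes l: "bounded_linear l" and "smooth_map f"
  shows "smooth_map (\<lambda>x. l x *\<^sub>R f x)"
proof (rule smooth_map_coinduct[where
      X = "\<lambda>h. \<exists>f g. smooth_map f \<and> smooth_map g \<and> h = (\<lambda>x. l x *\<^sub>R f x + g x)"])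
  have "smooth_map (\<lambda>x. 0 *\<^sub>R f x)" by (rule smooth_map_scaleR[OF assms(2)])
  with assms(2) show "\<exists>f' g. smooth_map f' \<and> smooth_map g \<and> (\<lambda>x. l x *\<^sub>R f x) = (\<lambda>x. l x *\<^sub>R f' x + g x)"
    by force
next
  fix h :: "'v \<Rightarrow> 'b" and v :: 'v
  assume "\<exists>f g. smooth_map f \<and> smooth_map g \<and> h = (\<lambda>x. l x *\<^sub>R f x + g x)" and v: "v \<in> Basis"
  then obtain f g where fg: "smooth_map f" "smooth_map g" "h = (\<lambda>x. l x *\<^sub>R f x + g x)" by blast
  note f = smooth_mapD[OF fg(1) v] and g = smooth_mapD[OF fg(2) v]
  have "has_dir_deriv v h (\<lambda>x. l x *\<^sub>R dir_deriv v f x + (l v *\<^sub>R f x + dir_deriv v g x))"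
    unfolding has_dir_deriv_def fg(3)
  proof
    fix x
    have "((\<lambda>t. l (x + t *\<^sub>R v)) has_vector_derivative l v) (at 0)"
      unfolding linear_add[OF bounded_linear.linear[OF l]] linear_scale[OF bounded_linear.linear[OF l]]
      by (auto intro!: derivative_eq_intros)
    from has_vector_derivative_add[OF bounded_bilinear.has_vector_derivative[OF bounded_bilinear_scaleR this
        has_dir_derivD[OF f(1), of x 0]] has_dir_derivD[OF g(1), of x 0]]
    show "((\<lambda>t. l (x + t *\<^sub>R v) *\<^sub>R f (x + t *\<^sub>R v) + g (x + t *\<^sub>R v)) has_vector_derivative
        l x *\<^sub>R dir_deriv v f x + (l v *\<^sub>R f x + dir_deriv v g x)) (at 0)"
      by (simp add: algebra_simps)
  qed
  moreover have "smooth_map (\<lambda>x. l v *\<^sub>R f x + dir_deriv v g x)"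
    by (rule smooth_map_add[OF smooth_map_scaleR[OF fg(1)] g(2)])
  ultimately show "\<exists>h'. (\<exists>f g. smooth_map f \<and> smooth_map g \<and> h' = (\<lambda>x. l x *\<^sub>R f x + g x)) \<and> has_dir_deriv v h h'"
    using f(2) by blast
next
  fix h :: "'v \<Rightarrow> 'b" assume "\<exists>f g. smooth_map f \<and> smooth_map g \<and> h = (\<lambda>x. l x *\<^sub>R f x + g x)"
  then obtain f g where "smooth_map f" "smooth_map g" "h = (\<lambda>x. l x *\<^sub>R f x + g x)" by blast
  then show "continuous_on UNIV h"
    by (simp add: continuous_on_add continuous_on_scaleR smooth_map_continuous linear_continuous_on[OF l])
qed

locale heis_rep = cstar csc st
  for csc :: "complex \<Rightarrow> 'a::{real_normed_algebra_1,banach} \<Rightarrow> 'a" and st +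
  fixes \<iota> :: "(real^'n \<Rightarrow> 'a) \<Rightarrow> 'e::banach"
    and U :: "(real^'n) \<times> (real^'n) \<times> real \<Rightarrow> 'e \<Rightarrow> 'e"
  assumes completion: "is_completion st \<iota>"
    and U_continuous: "continuous_on UNIV (U g)"
    and U_iota: "schwartz f \<Longrightarrow> U g (\<iota> f) = \<iota> (heis_act csc g f)"
begin

lemma iota_add: "schwartz f \<Longrightarrow> schwartz g \<Longrightarrow> \<iota> (\<lambda>x. f x + g x) = \<iota> f + \<iota> g"
  and iota_scaleR: "schwartz f \<Longrightarrow> \<iota> (\<lambda>x. r *\<^sub>R f x) = r *\<^sub>R \<iota> f"
  and norm_iota: "schwartz f \<Longrightarrow> norm (\<iota> f) = l2norm st f"
  and iota_dense: "closure (\<iota> ` {f. schwartz f}) = UNIV"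
  using completion unfolding is_completion_def by metis+

lemma iota_diff: "schwartz f \<Longrightarrow> schwartz g \<Longrightarrow> \<iota> (\<lambda>x. f x - g x) = \<iota> f - \<iota> g"
  using iota_add[of f "\<lambda>x. (- 1) *\<^sub>R g x"] iota_scaleR[of g "- 1"] schwartz_scaleR[of g "- 1"] by simp

lemma iota_approx:
  assumes "e > 0"
  obtains f where "schwartz f" "norm (\<phi> - \<iota> f) < e"
proof -
  have "\<phi> \<in> closure (\<iota> ` {f. schwartz f})" by (simp add: iota_dense)
  then show thesis using assms that unfolding closure_approachable
    by (auto simp: dist_norm norm_minus_commute)
qed

lemma norm_iota_le:
  assumes f: "schwartz f" and B: "\<And>x. (1 + norm x) ^ CARD('n) * norm (f x) \<le> B"
  shows "norm (\<iota> f) \<le> B * sqrt (integral UNIV (weight :: real^'n \<Rightarrow> real))"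
proof -
  have "B \<ge> 0" by (rule order_trans[OF _ B[of 0]]) simp
  have "l2norm st f \<le> sqrt (B\<^sup>2 * integral UNIV (weight :: real^'n \<Rightarrow> real))"
    by (intro l2norm_le schwartzD(2)[OF f] rapidly_decreasing_weight_square B)
  then show ?thesis using \<open>B \<ge> 0\<close> by (simp add: norm_iota[OF f] real_sqrt_mult)
qed

text \<open>This density principle transfers linearity, isometry and the group law from the formulas
  on functions to \<open>U\<close>, about which only continuity is assumed beyond those
  formulas.\<close>

lemma eq_on_iota_imp_eq:
  fixes F G :: "'e \<Rightarrow> 'b::t2_space"
  assumes "continuous_on UNIV F" "continuous_on UNIV G" "\<And>f. schwartz f \<Longrightarrow> F (\<iota> f) = G (\<iota> f)"
  shows "F \<phi> = G \<phi>"
proof -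
  have "closed {\<phi>. F \<phi> = G \<phi>}" using assms(1,2) by (rule closed_Collect_eq)
  moreover have "\<iota> ` {f. schwartz f} \<subseteq> {\<phi>. F \<phi> = G \<phi>}" using assms(3) by auto
  ultimately have "closure (\<iota> ` {f. schwartz f}) \<subseteq> {\<phi>. F \<phi> = G \<phi>}" by (rule closure_minimal[rotated])
  then show ?thesis by (auto simp: iota_dense)
qed

lemma continuous_U: "continuous_on UNIV F \<Longrightarrow> continuous_on UNIV (\<lambda>x. U g (F x))"
  by (rule continuous_on_compose2[OF U_continuous]) auto

lemma heis_act_add: "heis_act csc g (\<lambda>x. f x + h x) = (\<lambda>x. heis_act csc g f x + heis_act csc g h x)"
  by (cases g) (simp add: heis_act_def csc_add_right)

lemma heis_act_scaleR: "heis_act csc g (\<lambda>x. r *\<^sub>R f x) = (\<lambda>x. r *\<^sub>R heis_act csc g f x)"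
  by (cases g) (simp add: heis_act_def csc_scaleR)

lemma U_add: "U g (\<phi> + \<psi>) = U g \<phi> + U g \<psi>"
proof -
  have 1: "U g (\<iota> f + \<iota> h) = U g (\<iota> f) + U g (\<iota> h)" if "schwartz f" "schwartz h" for f h
    using that
    by (simp add: iota_add[symmetric] U_iota schwartz_add heis_act_add schwartz_heis_act)
  \<comment> \<open>Density is used in one variable at a time.\<close>
  have 2: "U g (\<phi> + \<iota> h) = U g \<phi> + U g (\<iota> h)" if "schwartz h" for \<phi> h
    by (rule eq_on_iota_imp_eq[where F = "\<lambda>\<phi>. U g (\<phi> + \<iota> h)"])
      (auto intro!: continuous_U continuous_intros 1 that)
  show ?thesis
    by (rule eq_on_iota_imp_eq[where F = "\<lambda>\<psi>. U g (\<phi> + \<psi>)"])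
      (auto intro!: continuous_U continuous_intros 2)
qed

lemma U_scaleR: "U g (r *\<^sub>R \<phi>) = r *\<^sub>R U g \<phi>"
  by (rule eq_on_iota_imp_eq[where F = "\<lambda>\<phi>. U g (r *\<^sub>R \<phi>)"])
    (auto intro!: continuous_U continuous_intros
      simp: iota_scaleR[symmetric] U_iota schwartz_scaleR heis_act_scaleR schwartz_heis_act)

lemma l2norm_heis_act:
  assumes "schwartz f"
  shows "l2norm st (heis_act csc g f) = l2norm st (f :: real^'n \<Rightarrow> 'a)"
proof (cases g)
  case (fields a b c)
  have "st (heis_act csc g f x) * heis_act csc g f x = st (f (x - a)) * f (x - a)" for x
  proof -
    let ?u = "cis c * cis (b \<bullet> x)"
    have u: "?u * cnj ?u = 1" by (simp add: cis_cnj cis_mult)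
    have "st (heis_act csc g f x) * heis_act csc g f x = csc (?u * cnj ?u) (st (f (x - a)) * f (x - a))"
      by (simp add: fields heis_act_def st_csc csc_mult_left csc_mult_right csc_csc)
    then show ?thesis unfolding u csc_1 .
  qed
  then have "l2norm st (heis_act csc g f) = l2norm st (\<lambda>x. f (x - a))" by (simp add: l2norm_def)
  then show ?thesis by (simp add: l2norm_translate[OF assms])
qed

lemma norm_U: "norm (U g \<phi>) = norm \<phi>"
  by (rule eq_on_iota_imp_eq[where F = "\<lambda>\<phi>. norm (U g \<phi>)"])
    (auto intro!: continuous_U continuous_intros
      simp: U_iota norm_iota schwartz_heis_act l2norm_heis_act)

lemma bounded_linear_U: "bounded_linear (U g)"
  by (rule bounded_linear_intro[where K = 1]) (simp_all add: U_add U_scaleR norm_U)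

lemma U_diff: "U g (\<phi> - \<psi>) = U g \<phi> - U g \<psi>"
  by (rule linear_diff[OF bounded_linear.linear[OF bounded_linear_U]])

text \<open>The phase \<open>- (b' \<bullet> a)\<close> appears because the inner modulation is
  evaluated at the translated point \<open>x - a\<close>.\<close>

lemma heis_act_heis_act:
  "heis_act csc (a, b, c) (heis_act csc (a', b', c') f) = heis_act csc (a + a', b + b', c + c' - b' \<bullet> a) f"
  by (auto simp: heis_act_def csc_csc cis_mult algebra_simps)

lemma U_U: "U (a, b, c) (U (a', b', c') \<phi>) = U (a + a', b + b', c + c' - b' \<bullet> a) \<phi>"
  by (rule eq_on_iota_imp_eq[where F = "\<lambda>\<phi>. U (a, b, c) (U (a', b', c') \<phi>)"])
    (auto intro!: continuous_U continuous_intros simp: U_iota schwartz_heis_act heis_act_heis_act)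

lemma U_0: "U 0 \<phi> = \<phi>"
proof -
  have "heis_act csc (0, 0, 0) f = f" for f :: "real^'n \<Rightarrow> 'a" by (simp add: heis_act_def csc_1)
  then show ?thesis
    by - (rule eq_on_iota_imp_eq[where F = "U 0" and G = "\<lambda>\<phi>. \<phi>"],
      simp_all add: U_iota U_continuous zero_prod_def)
qed

text \<open>The centre acts through the complex structure \<open>U (0, 0, pi / 2)\<close>.\<close>

lemma U_central: "U (0, 0, s) \<phi> = cos s *\<^sub>R \<phi> + sin s *\<^sub>R U (0, 0, pi / 2) \<phi>"
proof (rule eq_on_iota_imp_eq[where F = "\<lambda>\<phi>. U (0, 0, s) \<phi>"])
  fix f :: "real^'n \<Rightarrow> 'a" assume f: "schwartz f"
  have "heis_act csc (0, 0, s) f = (\<lambda>x. cos s *\<^sub>R f x + sin s *\<^sub>R heis_act csc (0, 0, pi / 2) f x)"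
  proof
    fix x
    have "cis s = of_real (cos s) + of_real (sin s) * \<i>" by (simp add: complex_eq_iff)
    then show "heis_act csc (0, 0, s) f x = cos s *\<^sub>R f x + sin s *\<^sub>R heis_act csc (0, 0, pi / 2) f x"
      by (simp add: heis_act_def csc_add_left csc_of_real csc_real_mult)
  qed
  then show "U (0, 0, s) (\<iota> f) = cos s *\<^sub>R \<iota> f + sin s *\<^sub>R U (0, 0, pi / 2) (\<iota> f)"
    by (simp add: U_iota f iota_add iota_scaleR schwartz_scaleR schwartz_heis_act)
qed (auto intro!: continuous_U continuous_intros)

section \<open>Orbit maps of Schwartz functions\<close>

definition act :: "(real^'n \<Rightarrow> complex) \<Rightarrow> (real^'n \<Rightarrow> 'a) \<Rightarrow> (real^'n) \<times> (real^'n) \<times> real \<Rightarrow> real^'n \<Rightarrow> 'a"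
  where "act m h g x = csc (m x) (heis_act csc g h x)"

lemma schwartz_act: "tempered m \<Longrightarrow> schwartz h \<Longrightarrow> schwartz (act m h g)"
  unfolding act_def by (intro schwartz_tempered_mult schwartz_heis_act)

lemma norm_act: "norm (act m h g x) = cmod (m x) * norm (h (x - fst g))"
  by (cases g) (simp add: act_def heis_act_def norm_csc norm_mult)

text \<open>Uniformity over bounded sets of \<open>g\<close> is what turns Taylor remainders at each
  \<open>x\<close> into remainders in the module norm.\<close>

lemma act_bound:
  assumes m: "tempered m" and h: "schwartz h"
  shows "\<exists>B. \<forall>g x. norm g \<le> R \<longrightarrow> (1 + norm x) ^ k * norm (act m h g x) \<le> B"
proof -
  obtain A l where A: "\<And>x. cmod (m x) \<le> A * (1 + norm x) ^ l" using tempered_bound[OF m] by blast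
  have A0: "A \<ge> 0" using order_trans[OF norm_ge_zero A[of 0]] by simp
  obtain B where B: "\<And>x. (1 + norm x) ^ (k + l) * norm (h x) \<le> B"
    using schwartzD(1)[OF h] unfolding rapidly_decreasing_def by metis
  have B0: "B \<ge> 0" by (rule order_trans[OF _ B[of 0]]) simp
  have "(1 + norm x) ^ k * norm (act m h g x) \<le> A * ((1 + \<bar>R\<bar>) ^ (k + l) * B)" if "norm g \<le> R" for g x
  proof -
    let ?a = "fst g"
    have "norm ?a \<le> \<bar>R\<bar>" using norm_fst_le[of ?a "snd g"] that by simp
    then have a: "(1 + norm ?a) ^ (k + l) \<le> (1 + \<bar>R\<bar>) ^ (k + l)" by (intro power_mono) auto
    have "(1 + norm x) ^ k * norm (act m h g x) \<le> (1 + norm x) ^ k * ((A * (1 + norm x) ^ l) * norm (h (x - ?a)))"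
      unfolding norm_act by (intro mult_left_mono mult_right_mono A) auto
    also have "\<dots> = A * ((1 + norm (?a + (x - ?a))) ^ (k + l) * norm (h (x - ?a)))"
      by (simp add: power_add mult_ac)
    also have "\<dots> \<le> A * (((1 + norm ?a) ^ (k + l) * (1 + norm (x - ?a)) ^ (k + l)) * norm (h (x - ?a)))"
      by (intro mult_left_mono mult_right_mono one_plus_norm_power_mult A0) auto
    also have "\<dots> = A * ((1 + norm ?a) ^ (k + l) * ((1 + norm (x - ?a)) ^ (k + l) * norm (h (x - ?a))))"
      by (simp add: mult_ac)
    also have "\<dots> \<le> A * ((1 + \<bar>R\<bar>) ^ (k + l) * B)"
      by (intro mult_left_mono mult_mono a B A0) auto
    finally show ?thesis .
  qed
  then show ?thesis by blast
qed

lemma act_deriv_translation: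
  assumes h: "schwartz h" and e: "e \<in> Basis"
  shows "has_dir_deriv (e, 0, 0) (\<lambda>g. act m h g x) (\<lambda>g. act m (\<lambda>x. - dir_deriv e h x) g x)"
  unfolding has_dir_deriv_def
proof
  fix g :: "(real^'n) \<times> (real^'n) \<times> real"
  obtain a b c where g: "g = (a, b, c)" by (cases g)
  have "((\<lambda>t. - t) has_vector_derivative - 1) (at (0::real))" by (auto intro!: derivative_eq_intros)
  from vector_diff_chain_at[OF this, OF has_dir_derivD[OF schwartzD(3)[OF h e], of "x - a" "- 0"]]
  have "((\<lambda>t. h (x - a - t *\<^sub>R e)) has_vector_derivative - dir_deriv e h (x - a)) (at 0)"
    by (simp add: o_def)
  from bounded_linear.has_vector_derivative[OF bounded_linear_csc[of "m x * (cis c * cis (b \<bullet> x))"] this]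
  show "((\<lambda>t. act m h (g + t *\<^sub>R (e, 0, 0)) x) has_vector_derivative act m (\<lambda>x. - dir_deriv e h x) g x) (at 0)"
    by (simp add: act_def heis_act_def g csc_csc algebra_simps)
qed

lemma act_deriv_modulation:
  "has_dir_deriv (0, e, 0) (\<lambda>g. act m h g x) (\<lambda>g. act (\<lambda>x. (\<i> * of_real (e \<bullet> x)) * m x) h g x)"
  unfolding has_dir_deriv_def
proof
  fix g :: "(real^'n) \<times> (real^'n) \<times> real"
  obtain a b c where g: "g = (a, b, c)" by (cases g)
  have "((\<lambda>t. m x * (cis c * cis (b \<bullet> x + t * (e \<bullet> x)))) has_vector_derivative
      m x * (cis c * ((\<i> * of_real (e \<bullet> x)) * cis (b \<bullet> x + 0 * (e \<bullet> x))))) (at 0)"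
    by (intro has_vector_derivative_mult_right has_vector_derivative_cis_linear)
  from bounded_linear.has_vector_derivative[OF bounded_bilinear.bounded_linear_left[OF bounded_bilinear_csc] this]
  show "((\<lambda>t. act m h (g + t *\<^sub>R (0, e, 0)) x) has_vector_derivative
      act (\<lambda>x. (\<i> * of_real (e \<bullet> x)) * m x) h g x) (at 0)"
    by (simp add: act_def heis_act_def g csc_csc inner_add_left mult_ac)
qed

lemma act_deriv_central:
  "has_dir_deriv (0, 0, 1) (\<lambda>g. act m h g x) (\<lambda>g. act (\<lambda>x. \<i> * m x) h g x)"
  unfolding has_dir_deriv_def
proof
  fix g :: "(real^'n) \<times> (real^'n) \<times> real"
  obtain a b c where g: "g = (a, b, c)" by (cases g)
  have "((\<lambda>t. m x * (cis (c + t * 1) * cis (b \<bullet> x))) has_vector_derivative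
      m x * (((\<i> * of_real 1) * cis (c + 0 * 1)) * cis (b \<bullet> x))) (at 0)"
    by (intro has_vector_derivative_mult_right has_vector_derivative_mult_left has_vector_derivative_cis_linear)
  from bounded_linear.has_vector_derivative[OF bounded_bilinear.bounded_linear_left[OF bounded_bilinear_csc] this]
  show "((\<lambda>t. act m h (g + t *\<^sub>R (0, 0, 1)) x) has_vector_derivative act (\<lambda>x. \<i> * m x) h g x) (at 0)"
    by (simp add: act_def heis_act_def g csc_csc mult_ac)
qed

lemma tempered_i_coord: "tempered m \<Longrightarrow> tempered (\<lambda>x. (\<i> * of_real (axis j 1 \<bullet> x)) * m x)"
  using tempered_mult[OF tempered_mult[OF tempered_const tempered_coord], of m \<i> j]
  by (simp add: inner_axis' )

text \<open>Because the multiplier stands outside the group action, a translation derivative changes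
  only \<open>h\<close>, while modulation and central derivatives change only \<open>m\<close>. The
  result is again a single \<open>act\<close>.\<close>

lemma act_deriv:
  assumes m: "tempered m" and h: "schwartz h" and v: "v \<in> Basis"
  obtains m' h' where "tempered m'" "schwartz h'"
    "\<And>x. has_dir_deriv v (\<lambda>g. act m h g x) (\<lambda>g. act m' h' g x)"
proof -
  consider e where "e \<in> Basis" "v = (e, 0, 0)" | e where "e \<in> Basis" "v = (0, e, 0)" | "v = (0, 0, 1)"
    using v by (auto simp: Basis_prod_def zero_prod_def)
  then show thesis
  proof cases
    case 1
    have "schwartz (\<lambda>x. - dir_deriv e h x)" using schwartz_scaleR[OF schwartzD(4)[OF h 1(1)], of "- 1"] by simp
    then show thesis using that[OF m] act_deriv_translation[OF h 1(1)] 1(2) by blast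
  next
    case 2
    then obtain j where "e = axis j 1" by (auto simp: Basis_vec_def)
    then show thesis using that[OF tempered_i_coord[OF m] h] act_deriv_modulation 2(2) by blast
  next
    case 3
    show thesis using that[OF tempered_mult[OF tempered_const m] h] act_deriv_central 3 by blast
  qed
qed

text \<open>At each \<open>x\<close> the remainder is controlled by the second derivative, which is
  once more an \<open>act\<close>. Its weighted bound gives both decay in \<open>x\<close> and the
  factor \<open>t\<^sup>2\<close>.\<close>

lemma iota_act_deriv:
  assumes m: "tempered m" and h: "schwartz h" and m': "tempered m'" and h': "schwartz h'" and v: "v \<in> Basis"
    and d: "\<And>x. has_dir_deriv v (\<lambda>g. act m h g x) (\<lambda>g. act m' h' g x)"
  shows "has_dir_deriv v (\<lambda>g. \<iota> (act m h g)) (\<lambda>g. \<iota> (act m' h' g))"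
  unfolding has_dir_deriv_def
proof
  fix g :: "(real^'n) \<times> (real^'n) \<times> real"
  obtain m2 h2 where 2: "tempered m2" "schwartz h2"
    "\<And>x. has_dir_deriv v (\<lambda>g. act m' h' g x) (\<lambda>g. act m2 h2 g x)"
    using act_deriv[OF m' h' v] by blast
  \<comment> \<open>The segment from \<open>g\<close> to \<open>g + t *\<^sub>R v\<close> stays in
    this ball for all \<open>t\<close> of modulus at most \<open>1\<close>.\<close>
  obtain B where B: "\<And>g' x. norm g' \<le> norm g + norm v \<Longrightarrow> (1 + norm x) ^ CARD('n) * norm (act m2 h2 g' x) \<le> B"
    using act_bound[OF 2(1,2), of "norm g + norm v" "CARD('n)"] by blast
  let ?W = "sqrt (integral UNIV (weight :: real^'n \<Rightarrow> real))"
  have "norm (\<iota> (act m h (g + t *\<^sub>R v)) - \<iota> (act m h (g + 0 *\<^sub>R v)) - t *\<^sub>R \<iota> (act m' h' g)) \<le> (B * ?W) * t\<^sup>2"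
    if t: "\<bar>t\<bar> \<le> 1" for t
  proof -
    define u where "u x = act m h (g + t *\<^sub>R v) x - act m h g x - t *\<^sub>R act m' h' g x" for x
    have u: "schwartz u" unfolding u_def
      by (intro schwartz_diff schwartz_scaleR schwartz_act m h m' h')
    have "\<iota> u = \<iota> (act m h (g + t *\<^sub>R v)) - \<iota> (act m h g) - t *\<^sub>R \<iota> (act m' h' g)"
      unfolding u_def by (simp add: iota_diff iota_scaleR schwartz_diff schwartz_scaleR schwartz_act m h m' h')
    moreover have "norm (\<iota> u) \<le> (B * t\<^sup>2) * ?W"
    proof (rule norm_iota_le[OF u])
      fix x
      have "norm (u x) \<le> (B / (1 + norm x) ^ CARD('n)) * t\<^sup>2"
        unfolding u_def
      proof (rule has_dir_deriv_taylor[OF d 2(3)])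
        fix s assume "\<bar>s\<bar> \<le> \<bar>t\<bar>"
        then have "\<bar>s\<bar> * norm v \<le> 1 * norm v" using t by (intro mult_right_mono) auto
        then have "norm (g + s *\<^sub>R v) \<le> norm g + norm v"
          by (intro order_trans[OF norm_triangle_ineq]) simp
        from B[OF this, of x] show "norm (act m2 h2 (g + s *\<^sub>R v) x) \<le> B / (1 + norm x) ^ CARD('n)"
          by (simp add: pos_le_divide_eq add_pos_nonneg mult.commute)
      qed
      then have "(1 + norm x) ^ CARD('n) * norm (u x)
          \<le> (1 + norm x) ^ CARD('n) * ((B / (1 + norm x) ^ CARD('n)) * t\<^sup>2)"
        by (intro mult_left_mono) auto
      also have "\<dots> = B * t\<^sup>2"
      proof -
        have "(1 + norm x) ^ CARD('n) \<noteq> 0" using norm_ge_zero[of x] by (simp del: norm_ge_zero)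
        then show ?thesis by simp
      qed
      finally show "(1 + norm x) ^ CARD('n) * norm (u x) \<le> B * t\<^sup>2" .
    qed
    ultimately show ?thesis by (simp add: mult_ac)
  qed
  then show "((\<lambda>t. \<iota> (act m h (g + t *\<^sub>R v))) has_vector_derivative \<iota> (act m' h' g)) (at 0)"
    by (rule has_vector_derivative_quadratic)
qed

lemma smooth_iota_act:
  assumes "tempered m" "schwartz h"
  shows "smooth_map (\<lambda>g. \<iota> (act m h g))"
proof (rule smooth_map_coinduct[where X = "\<lambda>F. \<exists>m h. tempered m \<and> schwartz h \<and> F = (\<lambda>g. \<iota> (act m h g))"])
  let ?X = "\<lambda>F. \<exists>m h. tempered m \<and> schwartz h \<and> F = (\<lambda>g. \<iota> (act m h g))"
  show deriv: "\<exists>F'. ?X F' \<and> has_dir_deriv v F F'" if F: "?X F" and v: "v \<in> Basis" for F v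
  proof -
    from F obtain m h where mh: "tempered m" "schwartz h" "F = (\<lambda>g. \<iota> (act m h g))" by blast
    obtain m' h' where mh': "tempered m'" "schwartz h'"
      "\<And>x. has_dir_deriv v (\<lambda>g. act m h g x) (\<lambda>g. act m' h' g x)"
      using act_deriv[OF mh(1,2) v] by blast
    from iota_act_deriv[OF mh(1,2) mh'(1,2) v mh'(3)] show ?thesis using mh(3) mh'(1,2) by blast
  qed
  show "continuous_on UNIV F" if F: "?X F" for F
  proof (rule continuous_of_dir_derivs)
    fix v :: "(real^'n) \<times> (real^'n) \<times> real" assume "v \<in> Basis"
    then obtain m' h' where F': "tempered m'" "schwartz h'" "has_dir_deriv v F (\<lambda>g. \<iota> (act m' h' g))"
      using deriv[OF F] by blast
    have "\<exists>B. \<forall>g. norm g \<le> R \<longrightarrow> norm (\<iota> (act m' h' g)) \<le> B" for R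
    proof -
      obtain B where B: "\<And>g x. norm g \<le> R \<Longrightarrow> (1 + norm x) ^ CARD('n) * norm (act m' h' g x) \<le> B"
        using act_bound[OF F'(1,2)] by blast
      have "norm (\<iota> (act m' h' g)) \<le> B * sqrt (integral UNIV (weight :: real^'n \<Rightarrow> real))" if "norm g \<le> R" for g
        by (intro norm_iota_le schwartz_act F' B that)
      then show ?thesis by blast
    qed
    with F'(3) show "\<exists>F'. has_dir_deriv v F F' \<and> (\<forall>R. \<exists>B. \<forall>y. norm y \<le> R \<longrightarrow> norm (F' y) \<le> B)" by blast
  qed
qed (use assms in blast)

lemma U_iota_act: "schwartz f \<Longrightarrow> U g (\<iota> f) = \<iota> (act (\<lambda>x. 1) f g)"
  by (simp add: U_iota act_def[abs_def] csc_1)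

section \<open>Smooth vectors and the generators of the representation\<close>

definition smooth_vector :: "'e \<Rightarrow> bool"
  where "smooth_vector \<phi> \<longleftrightarrow> smooth_map (\<lambda>g. U g \<phi>)"

lemma smooth_vector_iota: "schwartz f \<Longrightarrow> smooth_vector (\<iota> f)"
  unfolding smooth_vector_def by (simp add: U_iota_act smooth_iota_act tempered_const)

lemma smooth_vector_diff: "smooth_vector \<phi> \<Longrightarrow> smooth_vector \<psi> \<Longrightarrow> smooth_vector (\<phi> - \<psi>)"
  unfolding smooth_vector_def
  using smooth_map_add[of "\<lambda>g. U g \<phi>" "\<lambda>g. (- 1) *\<^sub>R U g \<psi>"] smooth_map_scaleR[of "\<lambda>g. U g \<psi>" "- 1"]
  by (simp add: U_diff)

definition gen_a :: "'n \<Rightarrow> 'e \<Rightarrow> 'e"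
  where "gen_a j \<phi> = dir_deriv (axis j 1, 0, 0) (\<lambda>g. U g \<phi>) 0"

definition gen_b :: "'n \<Rightarrow> 'e \<Rightarrow> 'e"
  where "gen_b j \<phi> = dir_deriv (0, axis j 1, 0) (\<lambda>g. U g \<phi>) 0"

lemma Basis_heis:
  fixes j :: 'n
  defines "B \<equiv> Basis :: ((real^'n) \<times> (real^'n) \<times> real) set"
  shows "(axis j 1, 0, 0) \<in> B" "(0, axis j 1, 0) \<in> B" "(0, 0, 1) \<in> B"
  unfolding B_def Basis_prod_def using axis_Basis[of j] by (auto simp: zero_prod_def image_iff)

lemma has_vector_derivative_gen_a:
  assumes "smooth_vector \<phi>"
  shows "((\<lambda>t. U (t *\<^sub>R axis j 1, 0, 0) \<phi>) has_vector_derivative gen_a j \<phi>) (at 0)"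
  using has_dir_derivD[OF smooth_mapD(1)[OF assms[unfolded smooth_vector_def] Basis_heis(1)], of 0 j 0]
  by (simp add: gen_a_def zero_prod_def)

lemma has_vector_derivative_gen_b:
  assumes "smooth_vector \<phi>"
  shows "((\<lambda>t. U (0, t *\<^sub>R axis j 1, 0) \<phi>) has_vector_derivative gen_b j \<phi>) (at 0)"
  using has_dir_derivD[OF smooth_mapD(1)[OF assms[unfolded smooth_vector_def] Basis_heis(2)], of 0 j 0]
  by (simp add: gen_b_def zero_prod_def)

text \<open>Right multiplication by a pure translation produces no phase, so it adds to the first
  coordinate. Hence the orbit map of \<open>gen_a j \<phi>\<close> is a partial derivative of the
  orbit map of \<open>\<phi>\<close>.\<close>

lemma smooth_vector_gen_a:
  assumes "smooth_vector \<phi>"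
  shows "smooth_vector (gen_a j \<phi>)"
proof -
  have d: "has_dir_deriv (axis j 1, 0, 0) (\<lambda>g. U g \<phi>) (\<lambda>g. U g (gen_a j \<phi>))"
    unfolding has_dir_deriv_def
  proof
    fix g :: "(real^'n) \<times> (real^'n) \<times> real"
    obtain a b c where g: "g = (a, b, c)" by (cases g)
    from bounded_linear.has_vector_derivative[OF bounded_linear_U has_vector_derivative_gen_a[OF assms], of g j]
    show "((\<lambda>t. U (g + t *\<^sub>R (axis j 1, 0, 0)) \<phi>) has_vector_derivative U g (gen_a j \<phi>)) (at 0)"
      by (simp add: g U_U)
  qed
  from smooth_mapD(2)[OF assms[unfolded smooth_vector_def] Basis_heis(1)[of j]] show ?thesis
    unfolding has_dir_deriv_dir_deriv[OF d] smooth_vector_def .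
qed

text \<open>The complex structure applied to the orbit map is its central partial derivative, and
  therefore smooth.\<close>

lemma smooth_map_U_central:
  assumes "smooth_vector \<phi>"
  shows "smooth_map (\<lambda>g. U (0, 0, pi / 2) (U g \<phi>))"
proof -
  have d: "has_dir_deriv (0, 0, 1) (\<lambda>g. U g \<phi>) (\<lambda>g. U (0, 0, pi / 2) (U g \<phi>))"
    unfolding has_dir_deriv_def
  proof
    fix g :: "(real^'n) \<times> (real^'n) \<times> real"
    obtain a b c where g: "g = (a, b, c)" by (cases g)
    have "U (g + t *\<^sub>R (0, 0, 1)) \<phi> = cos t *\<^sub>R U g \<phi> + sin t *\<^sub>R U (0, 0, pi / 2) (U g \<phi>)" for t
      unfolding U_central[of t, symmetric] by (simp add: g U_U add.commute)
    moreover have "((\<lambda>t. cos t *\<^sub>R U g \<phi> + sin t *\<^sub>R U (0, 0, pi / 2) (U g \<phi>)) has_vector_derivative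
        U (0, 0, pi / 2) (U g \<phi>)) (at 0)"
      by (auto intro!: derivative_eq_intros)
    ultimately show "((\<lambda>t. U (g + t *\<^sub>R (0, 0, 1)) \<phi>) has_vector_derivative U (0, 0, pi / 2) (U g \<phi>)) (at 0)"
      by simp
  qed
  from smooth_mapD(2)[OF assms[unfolded smooth_vector_def] Basis_heis(3)] show ?thesis
    unfolding has_dir_deriv_dir_deriv[OF d] .
qed

text \<open>Modulations do not commute with translations, hence the additional term.\<close>

lemma U_gen_b:
  assumes "smooth_vector \<phi>"
  shows "U g (gen_b j \<phi>)
    = dir_deriv (0, axis j 1, 0) (\<lambda>g. U g \<phi>) g - (fst g $ j) *\<^sub>R U (0, 0, pi / 2) (U g \<phi>)"
proof -
  obtain a b c where g: "g = (a, b, c)" by (cases g)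
  let ?e = "(0, axis j 1, 0) :: (real^'n) \<times> (real^'n) \<times> real"
  let ?J = "U (0, 0, pi / 2)"
  let ?D = "dir_deriv ?e (\<lambda>g. U g \<phi>) g"
  have X: "((\<lambda>t. U (g + t *\<^sub>R ?e) \<phi>) has_vector_derivative ?D) (at 0)"
    using has_dir_derivD[OF smooth_mapD(1)[OF assms[unfolded smooth_vector_def] Basis_heis(2)], of g j 0]
    by (simp only: scaleR_zero_left add_0_right)
  \<comment> \<open>The group law leaves the phase \<open>- t * a $ j\<close>. Writing it as a
    central element exposes the plain orbit at \<open>g + t *\<^sub>R ?e\<close>.\<close>
  have "U g (U (0, t *\<^sub>R axis j 1, 0) \<phi>)
      = cos (- t * a $ j) *\<^sub>R U (g + t *\<^sub>R ?e) \<phi> + sin (- t * a $ j) *\<^sub>R ?J (U (g + t *\<^sub>R ?e) \<phi>)" for t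
    unfolding U_central[of "- t * a $ j", symmetric] by (simp add: g U_U inner_axis' algebra_simps)
  moreover have "((\<lambda>t. cos (- t * a $ j) *\<^sub>R U (g + t *\<^sub>R ?e) \<phi> + sin (- t * a $ j) *\<^sub>R ?J (U (g + t *\<^sub>R ?e) \<phi>))
      has_vector_derivative ?D - (a $ j) *\<^sub>R ?J (U g \<phi>)) (at 0)"
  proof -
    have c: "((\<lambda>t. cos (- t * a $ j)) has_vector_derivative 0) (at 0)"
      and s: "((\<lambda>t. sin (- t * a $ j)) has_vector_derivative - (a $ j)) (at 0)"
      unfolding has_real_derivative_iff_has_vector_derivative[symmetric]
      by (auto intro!: derivative_eq_intros)
    have JX: "((\<lambda>t. ?J (U (g + t *\<^sub>R ?e) \<phi>)) has_vector_derivative ?J ?D) (at 0)"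
      by (rule bounded_linear.has_vector_derivative[OF bounded_linear_U X])
    from has_vector_derivative_add[OF bounded_bilinear.has_vector_derivative[OF bounded_bilinear_scaleR c X]
        bounded_bilinear.has_vector_derivative[OF bounded_bilinear_scaleR s JX]]
    show ?thesis by (simp add: g)
  qed
  ultimately have "((\<lambda>t. U g (U (0, t *\<^sub>R axis j 1, 0) \<phi>)) has_vector_derivative
      ?D - (a $ j) *\<^sub>R ?J (U g \<phi>)) (at 0)" by simp
  moreover have "((\<lambda>t. U g (U (0, t *\<^sub>R axis j 1, 0) \<phi>)) has_vector_derivative U g (gen_b j \<phi>)) (at 0)"
    by (rule bounded_linear.has_vector_derivative[OF bounded_linear_U has_vector_derivative_gen_b[OF assms]])
  ultimately show ?thesis by (simp add: g vector_derivative_unique_at)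
qed

lemma smooth_vector_gen_b:
  assumes "smooth_vector \<phi>"
  shows "smooth_vector (gen_b j \<phi>)"
proof -
  have "bounded_linear (\<lambda>g :: (real^'n) \<times> (real^'n) \<times> real. - (fst g $ j))"
    by (intro bounded_linear_minus bounded_linear_compose[OF bounded_linear_vec_nth bounded_linear_fst])
  then have "smooth_map (\<lambda>g. dir_deriv (0, axis j 1, 0) (\<lambda>g. U g \<phi>) g + (- (fst g $ j)) *\<^sub>R U (0, 0, pi / 2) (U g \<phi>))"
    using assms
    by (intro smooth_map_add smooth_map_linear_mult smooth_map_U_central smooth_mapD(2) Basis_heis)
      (simp_all add: smooth_vector_def)
  then show ?thesis unfolding smooth_vector_def U_gen_b[OF assms] by simp
qed

lemma gen_a_iota:
  assumes "schwartz u"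
  shows "gen_a j (\<iota> u) = - \<iota> (dir_deriv (axis j 1) u)"
proof -
  have s: "schwartz (dir_deriv (axis j 1) u)" by (rule schwartzD(4)[OF assms axis_Basis])
  then have s': "schwartz (\<lambda>x. - dir_deriv (axis j 1) u x)" using schwartz_scaleR[of _ "- 1"] by fastforce
  have "has_dir_deriv (axis j 1, 0, 0) (\<lambda>g. \<iota> (act (\<lambda>x. 1) u g)) (\<lambda>g. \<iota> (act (\<lambda>x. 1) (\<lambda>x. - dir_deriv (axis j 1) u x) g))"
    by (rule iota_act_deriv[OF tempered_const assms tempered_const s' Basis_heis(1) act_deriv_translation[OF assms axis_Basis]])
  then have "gen_a j (\<iota> u) = U 0 (\<iota> (\<lambda>x. - dir_deriv (axis j 1) u x))"
    unfolding gen_a_def U_iota_act[OF assms] U_iota_act[OF s'] by (simp add: has_dir_deriv_dir_deriv)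
  then show ?thesis using iota_scaleR[OF s, of "- 1"] by (simp add: U_0)
qed

lemma gen_b_iota:
  assumes "schwartz u"
  shows "gen_b j (\<iota> u) = \<iota> (\<lambda>x. csc (\<i> * of_real (x $ j)) (u x))"
proof -
  have "has_dir_deriv (0, axis j 1, 0) (\<lambda>g. \<iota> (act (\<lambda>x. 1) u g))
      (\<lambda>g. \<iota> (act (\<lambda>x. (\<i> * of_real (axis j 1 \<bullet> x)) * 1) u g))"
    by (rule iota_act_deriv[OF tempered_const assms tempered_i_coord[OF tempered_const] assms Basis_heis(2)
        act_deriv_modulation])
  then have "gen_b j (\<iota> u) = \<iota> (act (\<lambda>x. (\<i> * of_real (axis j 1 \<bullet> x)) * 1) u 0)"
    unfolding gen_b_def U_iota_act[OF assms] by (simp add: has_dir_deriv_dir_deriv)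
  then show ?thesis by (simp add: act_def[abs_def] heis_act_def zero_prod_def csc_csc inner_axis' csc_1)
qed

lemma gen_diff:
  assumes "smooth_vector \<phi>" "smooth_vector \<psi>"
  shows "gen_a j (\<phi> - \<psi>) = gen_a j \<phi> - gen_a j \<psi>" "gen_b j (\<phi> - \<psi>) = gen_b j \<phi> - gen_b j \<psi>"
proof -
  note d = smooth_vector_diff[OF assms]
  show "gen_a j (\<phi> - \<psi>) = gen_a j \<phi> - gen_a j \<psi>"
    using has_vector_derivative_gen_a[OF d, of j]
      has_vector_derivative_diff[OF assms[THEN has_vector_derivative_gen_a[where j = j]]]
    by (simp add: U_diff vector_derivative_unique_at)
  show "gen_b j (\<phi> - \<psi>) = gen_b j \<phi> - gen_b j \<psi>"
    using has_vector_derivative_gen_b[OF d, of j]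
      has_vector_derivative_diff[OF assms[THEN has_vector_derivative_gen_b[where j = j]]]
    by (simp add: U_diff vector_derivative_unique_at)
qed

lemma norm_le_gen:
  assumes "smooth_vector \<psi>"
  shows "norm \<psi> \<le> norm (\<psi> - gen_a j \<psi>)" "norm \<psi> \<le> norm (\<psi> - gen_b j \<psi>)"
  using norm_le_norm_minus_derivative[OF has_vector_derivative_gen_a[OF assms, of j]]
    norm_le_norm_minus_derivative[OF has_vector_derivative_gen_b[OF assms, of j]]
    U_0[of \<psi>] by (simp_all add: norm_U zero_prod_def)

text \<open>The a priori estimate behind all approximations: if \<open>(1 + \<partial>_j) u\<close>
  is close to \<open>\<phi> - gen_a j \<phi>\<close>, then \<open>u\<close> is close to
  \<open>\<phi>\<close>. It is the lower bound for \<open>1 - A_j\<close> applied to the smooth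
  vector \<open>\<phi> - \<iota> u\<close>.\<close>

lemma norm_diff_iota_le_gen_a:
  assumes \<phi>: "smooth_vector \<phi>" and u: "schwartz u"
  shows "norm (\<phi> - \<iota> u) \<le> norm ((\<phi> - gen_a j \<phi>) - \<iota> (\<lambda>x. u x + dir_deriv (axis j 1) u x))"
  using norm_le_gen(1)[OF smooth_vector_diff[OF \<phi> smooth_vector_iota[OF u]], of j]
  by (simp add: gen_diff \<phi> smooth_vector_iota u gen_a_iota iota_add schwartzD(4) axis_Basis algebra_simps)

lemma norm_diff_iota_le_gen_b:
  assumes \<phi>: "smooth_vector \<phi>" and u: "schwartz u"
  shows "norm (\<phi> - \<iota> u) \<le> norm ((\<phi> - gen_b j \<phi>) - \<iota> (\<lambda>x. csc (1 - \<i> * of_real (x $ j)) (u x)))"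
proof -
  have "schwartz (\<lambda>x. csc (\<i> * of_real (x $ j)) (u x))"
    by (intro schwartz_tempered_mult tempered_mult tempered_const tempered_coord u)
  then have "\<iota> (\<lambda>x. csc (1 - \<i> * of_real (x $ j)) (u x)) = \<iota> u - gen_b j (\<iota> u)"
    by (simp add: csc_diff_left csc_1 iota_diff gen_b_iota u)
  moreover have "\<phi> - \<iota> u - gen_b j (\<phi> - \<iota> u) = (\<phi> - gen_b j \<phi>) - (\<iota> u - gen_b j (\<iota> u))"
    by (simp add: gen_diff(2)[OF \<phi> smooth_vector_iota[OF u]])
  ultimately show ?thesis
    using norm_le_gen(2)[OF smooth_vector_diff[OF \<phi> smooth_vector_iota[OF u]], of j] by (simp only:)
qed

end

section \<open>Functions representing smooth vectors\<close>

lemma has_dir_deriv_uniform_limit: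
  fixes u :: "nat \<Rightarrow> 'v::euclidean_space \<Rightarrow> 'b::banach"
  assumes d: "\<And>k. has_dir_deriv v (u k) (w k)"
    and u: "uniform_limit UNIV u f sequentially" and w: "uniform_limit UNIV w f' sequentially"
  shows "has_dir_deriv v f f'"
  unfolding has_dir_deriv_def
proof
  fix x
  have lim: "(\<lambda>k. u k y) \<longlonglongrightarrow> f y" for y using tendsto_uniform_limitI[OF u] by simp
  have "\<exists>g. \<forall>t\<in>UNIV. (\<lambda>k. u k (x + t *\<^sub>R v)) \<longlonglongrightarrow> g t
      \<and> (g has_derivative (\<lambda>h. h *\<^sub>R f' (x + t *\<^sub>R v))) (at t within UNIV)"
  proof (rule has_derivative_sequence[where f = "\<lambda>k t. u k (x + t *\<^sub>R v)"
        and f' = "\<lambda>k t h. h *\<^sub>R w k (x + t *\<^sub>R v)" and ?x0.0 = 0])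
    show "((\<lambda>t. u k (x + t *\<^sub>R v)) has_derivative (\<lambda>h. h *\<^sub>R w k (x + t *\<^sub>R v))) (at t within UNIV)" for k t
      using has_dir_derivD[OF d] by (simp add: has_vector_derivative_def)
    show "\<forall>\<^sub>F k in sequentially. \<forall>t\<in>UNIV. \<forall>h. norm (h *\<^sub>R w k (x + t *\<^sub>R v) - h *\<^sub>R f' (x + t *\<^sub>R v)) \<le> e * norm h"
      if "e > 0" for e
      using uniform_limitD[OF w that]
    proof eventually_elim
      case (elim k)
      have "norm (h *\<^sub>R w k (x + t *\<^sub>R v) - h *\<^sub>R f' (x + t *\<^sub>R v)) \<le> e * norm h" for t h
      proof -
        have "norm (w k (x + t *\<^sub>R v) - f' (x + t *\<^sub>R v)) \<le> e"
          using elim by (auto simp: dist_norm intro: less_imp_le)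
        then show ?thesis
          unfolding scaleR_diff_right[symmetric] by (simp add: mult.commute[of e] mult_left_mono)
      qed
      then show ?case by blast
    qed
    show "(\<lambda>k. u k (x + 0 *\<^sub>R v)) \<longlonglongrightarrow> f (x + 0 *\<^sub>R v)" by (rule lim)
  qed auto
  then obtain g where g: "\<And>t. (\<lambda>k. u k (x + t *\<^sub>R v)) \<longlonglongrightarrow> g t"
    "(g has_derivative (\<lambda>h. h *\<^sub>R f' (x + 0 *\<^sub>R v))) (at 0)" by blast
  have "g = (\<lambda>t. f (x + t *\<^sub>R v))" using LIMSEQ_unique[OF g(1) lim] by auto
  then show "((\<lambda>t. f (x + t *\<^sub>R v)) has_vector_derivative f' x) (at 0)"
    using g(2) by (simp add: has_vector_derivative_def)
qed

lemma uniform_limit_of_Cauchy_bound: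
  fixes u :: "nat \<Rightarrow> 'v \<Rightarrow> 'b::banach" and s :: "nat \<Rightarrow> nat \<Rightarrow> real"
  assumes "\<And>k m x. norm (u k x - u m x) \<le> s k m"
    and "\<And>e. e > 0 \<Longrightarrow> \<exists>N. \<forall>k\<ge>N. \<forall>m\<ge>N. s k m < e"
  obtains f where "uniform_limit UNIV u f sequentially"
proof -
  have "uniformly_Cauchy_on UNIV u"
    unfolding uniformly_Cauchy_on_def dist_norm using assms by (meson UNIV_I le_less_trans)
  then have "uniformly_convergent_on UNIV u" by (rule Cauchy_uniformly_convergent)
  then show thesis using that by (auto simp: uniformly_convergent_on_def)
qed

lemma resolvent_diff_bound:
  fixes f g :: "real^'n \<Rightarrow> 'b::banach"
  assumes f: "schwartz f" and g: "schwartz g" and M: "\<And>x. norm (f x - g x) \<le> M"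
  shows "norm (resolvent v f x - resolvent v g x) \<le> M"
proof -
  have "resolvent v (\<lambda>x. f x - g x) x = resolvent v f x - resolvent v g x"
    unfolding resolvent_def scaleR_diff_right
    by (intro Henstock_Kurzweil_Integration.integral_diff schwartz_resolvent_integrable f g)
  then show ?thesis
    using resolvent_integrable(2)[of "\<lambda>x. f x - g x" M v x] M schwartzD(2)[OF f] schwartzD(2)[OF g]
    by (simp add: continuous_on_diff)
qed

lemma iter_one_plus_deriv_diff:
  fixes f g :: "real^'n \<Rightarrow> 'b::real_normed_vector"
  assumes "schwartz f" "schwartz g"
  shows "iter_one_plus_deriv js (\<lambda>x. f x - g x) = (\<lambda>x. iter_one_plus_deriv js f x - iter_one_plus_deriv js g x)"
  using assms
proof (induction js arbitrary: f g)
  case (Cons j js)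
  let ?e = "axis j 1 :: real^'n"
  have "has_dir_deriv ?e (\<lambda>x. f x - g x) (\<lambda>x. dir_deriv ?e f x - dir_deriv ?e g x)"
    using schwartzD(3)[OF Cons.prems(1) axis_Basis[of j]] schwartzD(3)[OF Cons.prems(2) axis_Basis[of j]]
    unfolding has_dir_deriv_def by (simp add: has_vector_derivative_diff)
  then have "dir_deriv ?e (\<lambda>x. f x - g x) = (\<lambda>x. dir_deriv ?e f x - dir_deriv ?e g x)"
    by (rule has_dir_deriv_dir_deriv)
  then show ?case
    using Cons.IH[OF schwartz_one_plus_deriv[OF Cons.prems(1), of j] schwartz_one_plus_deriv[OF Cons.prems(2), of j]]
    by (simp add: algebra_simps)
qed simp

text \<open>Surjectivity allows arbitrary Schwartz approximants of the image of
  \<open>\<phi>\<close> to be pulled back exactly, by one resolvent per coordinate.\<close>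

lemma iter_one_plus_deriv_surj:
  fixes g :: "real^'n \<Rightarrow> 'b::banach"
  assumes "schwartz g"
  shows "\<exists>u. schwartz u \<and> iter_one_plus_deriv js u = g"
proof (induction js)
  case (Cons j js)
  then obtain w where w: "schwartz w" "iter_one_plus_deriv js w = g" by blast
  let ?e = "axis j 1 :: real^'n"
  have "dir_deriv ?e (resolvent ?e w) = resolvent ?e (dir_deriv ?e w)"
    by (rule has_dir_deriv_dir_deriv[OF resolvent_has_dir_deriv[OF w(1) axis_Basis]])
  then have "(\<lambda>x. resolvent ?e w x + dir_deriv ?e (resolvent ?e w) x) = w"
    by (simp add: resolvent_inverse[OF w(1) axis_Basis])
  then have "iter_one_plus_deriv (j # js) (resolvent ?e w) = g" using w(2) by simp
  then show ?case using schwartz_resolvent[OF w(1) axis_Basis] by blast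
qed (use assms in auto)

section \<open>Compatibility of module convergence and uniform convergence\<close>

context cstar
begin

text \<open>Averages of \<open>d k\<close> against a fixed mollifier tend to \<open>0\<close> by
  Cauchy-Schwarz and to the averages of \<open>D\<close> by uniform convergence. So all averages of
  \<open>D\<close> vanish, and with them its values.\<close>

lemma l2_null_uniform_limit:
  fixes d :: "nat \<Rightarrow> real^'n \<Rightarrow> 'a"
  assumes d: "\<And>k. schwartz (d k)" and l: "(\<lambda>k. l2norm st (d k)) \<longlonglongrightarrow> 0"
    and D: "uniform_limit UNIV d D sequentially"
  shows "D y = 0"
proof -
  \<comment> \<open>Translation moves the point of interest to the origin, where the mollifiers are
    centred.\<close>
  define E where "E x = D (x + y)" for x
  define c where "c k x = d k (x - - y)" for k x
  have c: "schwartz (c k)" for k unfolding c_def by (rule schwartz_translate[OF d])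
  have cl: "(\<lambda>k. l2norm st (c k)) \<longlonglongrightarrow> 0" unfolding c_def l2norm_translate[OF d] by (rule l)
  have E: "uniform_limit UNIV c E sequentially"
  proof (rule uniform_limitI)
    fix e :: real assume "e > 0"
    from uniform_limitD[OF D this] show "\<forall>\<^sub>F k in sequentially. \<forall>x\<in>UNIV. dist (c k x) (E x) < e"
      by eventually_elim (simp add: c_def E_def)
  qed
  have contE: "continuous_on UNIV E"
    by (rule uniform_limit_theorem[OF _ E]) (auto intro: always_eventually schwartzD(2)[OF c])
  obtain k0 where k0: "\<And>x. dist (c k0 x) (E x) < 1"
    using uniform_limitD[OF E zero_less_one] by (auto simp: eventually_sequentially)
  obtain M0 where M0: "\<And>x. norm (c k0 x) \<le> M0" using schwartz_bounded[OF c] by blast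
  have M: "norm (E x) \<le> M0 + 1" for x
    using k0[of x] M0[of x] norm_triangle_ineq4[of "c k0 x" "c k0 x - E x"] by (simp add: dist_norm)
  have "norm (E 0) \<le> 2 ^ CARD('n) * 0"
  proof (rule norm_at_0_le_of_mollified[OF contE M])
    fix e :: real assume e: "0 < e" "e \<le> 1"
    let ?\<rho> = "mollifier e :: real^'n \<Rightarrow> real"
    let ?W = "integral UNIV (weight :: real^'n \<Rightarrow> real)"
    define A where "A = (2 / e) ^ CARD('n)"
    have A0: "A \<ge> 0" using e by (simp add: A_def)
    have r: "\<bar>?\<rho> x\<bar> \<le> A * weight x" for x
      using mollifier_nonneg[OF e(1), of x] mollifier_le_weight[OF e, of x] by (simp add: A_def)
    have sq: "(?\<rho> x)\<^sup>2 \<le> A\<^sup>2 * weight x" for x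
    proof -
      have "weight x \<le> 1" unfolding weight_def by (intro prod_le_1) (simp add: add_pos_nonneg)
      have "(?\<rho> x)\<^sup>2 \<le> (A * weight x)\<^sup>2" using r[of x] by (simp add: abs_le_square_iff[symmetric])
      also have "\<dots> = A\<^sup>2 * (weight x * weight x)" by (simp add: power2_eq_square mult_ac)
      also have "\<dots> \<le> A\<^sup>2 * (1 * weight x)"
        using \<open>weight x \<le> 1\<close> less_imp_le[OF weight_pos[of x]] by (intro mult_left_mono mult_right_mono) auto
      finally show ?thesis by simp
    qed
    have b: "norm (?\<rho> x *\<^sub>R u) \<le> (A * N) * weight x" if "norm u \<le> N" "N \<ge> 0" for x N and u :: 'a
      using mult_mono[OF r[of x] that(1)] order_trans[OF abs_ge_zero r[of x]]
      by (simp add: mult_ac)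
    have intE: "(\<lambda>x. ?\<rho> x *\<^sub>R E x) integrable_on UNIV"
      by (rule integrable_of_weight_bound(1)[OF continuous_on_scaleR[OF continuous_mollifier contE] b[OF M]])
        (rule order_trans[OF norm_ge_zero M])
    have lim0: "(\<lambda>k. integral UNIV (\<lambda>x. ?\<rho> x *\<^sub>R c k x)) \<longlonglongrightarrow> 0"
    proof (rule Lim_null_comparison)
      show "\<forall>\<^sub>F k in sequentially. norm (integral UNIV (\<lambda>x. ?\<rho> x *\<^sub>R c k x)) \<le> sqrt (A\<^sup>2 * ?W) * l2norm st (c k)"
        by (intro always_eventually allI norm_kernel_integral_le continuous_mollifier sq schwartz_l2_dominated c)
      show "(\<lambda>k. sqrt (A\<^sup>2 * ?W) * l2norm st (c k)) \<longlonglongrightarrow> 0"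
        using tendsto_mult_right_zero[OF cl] by simp
    qed
    have "(\<lambda>k. integral UNIV (\<lambda>x. ?\<rho> x *\<^sub>R c k x)) \<longlonglongrightarrow> integral UNIV (\<lambda>x. ?\<rho> x *\<^sub>R E x)"
    proof (rule metric_LIMSEQ_I)
      fix \<eta> :: real assume \<eta>: "\<eta> > 0"
      define \<delta> where "\<delta> = \<eta> / (A * ?W + 1)"
      have AW: "A * ?W \<ge> 0" using A0 integral_weight_nonneg by (rule mult_nonneg_nonneg)
      then have "\<delta> > 0" using \<eta> by (simp add: \<delta>_def)
      then obtain N where N: "\<And>k x. k \<ge> N \<Longrightarrow> norm (c k x - E x) < \<delta>"
        using uniform_limitD[OF E \<open>\<delta> > 0\<close>] by (auto simp: eventually_sequentially dist_norm)
      have "dist (integral UNIV (\<lambda>x. ?\<rho> x *\<^sub>R c k x)) (integral UNIV (\<lambda>x. ?\<rho> x *\<^sub>R E x)) < \<eta>" if "k \<ge> N" for k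
      proof -
        obtain Mk where Mk: "\<And>x. norm (c k x) \<le> Mk" using schwartz_bounded[OF c] by blast
        have intc: "(\<lambda>x. ?\<rho> x *\<^sub>R c k x) integrable_on UNIV"
          by (rule integrable_of_weight_bound(1)[OF continuous_on_scaleR[OF continuous_mollifier schwartzD(2)[OF c]] b[OF Mk]])
            (rule order_trans[OF norm_ge_zero Mk])
        have "integral UNIV (\<lambda>x. ?\<rho> x *\<^sub>R c k x) - integral UNIV (\<lambda>x. ?\<rho> x *\<^sub>R E x)
            = integral UNIV (\<lambda>x. ?\<rho> x *\<^sub>R (c k x - E x))"
          unfolding scaleR_diff_right by (rule Henstock_Kurzweil_Integration.integral_diff[OF intc intE, symmetric])
        also have "norm \<dots> \<le> (A * \<delta>) * ?W"
          using N[OF that] \<open>\<delta> > 0\<close>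
          by (intro integrable_of_weight_bound(2) b continuous_on_scaleR continuous_mollifier
              continuous_on_diff schwartzD(2)[OF c] contE) (auto intro: less_imp_le)
        also have "\<dots> = \<delta> * (A * ?W)" by (simp add: mult_ac)
        also have "\<dots> < \<delta> * (A * ?W + 1)" using \<open>\<delta> > 0\<close> by simp
        also have "\<dots> = \<eta>" using AW by (simp add: \<delta>_def)
        finally show ?thesis by (simp add: dist_norm)
      qed
      then show "\<exists>N. \<forall>k\<ge>N. dist (integral UNIV (\<lambda>x. ?\<rho> x *\<^sub>R c k x)) (integral UNIV (\<lambda>x. ?\<rho> x *\<^sub>R E x)) < \<eta>"
        by blast
    qed
    with lim0 have "integral UNIV (\<lambda>x. ?\<rho> x *\<^sub>R E x) = 0" by (rule LIMSEQ_unique[symmetric])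
    then show "norm (integral UNIV (\<lambda>x. ?\<rho> x *\<^sub>R E x)) \<le> 0" by simp
  qed
  then show ?thesis by (simp add: E_def)
qed

text \<open>On a space of infinite measure uniform convergence does not control the module norm,
  hence the Cauchy hypothesis. For fixed \<open>k\<close> the inner product of \<open>d k\<close>
  with itself splits into one with \<open>d m\<close>, which becomes small for large
  \<open>m\<close> because \<open>d k\<close> is integrable, and one with \<open>d k - d m\<close>,
  which Cauchy-Schwarz bounds.\<close>

lemma uniform_null_l2_limit:
  fixes d :: "nat \<Rightarrow> real^'n \<Rightarrow> 'a"
  assumes d: "\<And>k. schwartz (d k)" and u: "uniform_limit UNIV d (\<lambda>_. 0) sequentially"
    and C: "\<And>e. e > 0 \<Longrightarrow> \<exists>N. \<forall>k\<ge>N. \<forall>m\<ge>N. l2norm st (\<lambda>x. d k x - d m x) < e"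
  shows "(\<lambda>k. l2norm st (d k)) \<longlonglongrightarrow> 0"
proof (rule metric_LIMSEQ_I)
  fix e :: real assume e: "e > 0"
  then obtain N where N: "\<And>k m. k \<ge> N \<Longrightarrow> m \<ge> N \<Longrightarrow> l2norm st (\<lambda>x. d k x - d m x) < e / 2"
    using C[of "e / 2"] by auto
  have "l2norm st (d k) < e" if k: "k \<ge> N" for k
  proof -
    let ?W = "integral UNIV (weight :: real^'n \<Rightarrow> real)"
    let ?l = "l2norm st (d k)"
    have l0: "?l \<ge> 0" by (simp add: l2norm_def)
    obtain B where B: "\<And>x. (1 + norm x) ^ (2 * CARD('n)) * norm (d k x) \<le> B"
      using schwartzD(1)[OF d] unfolding rapidly_decreasing_def by metis
    have B0: "B \<ge> 0" by (rule order_trans[OF _ B[of 0]]) simp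
    have Bw: "norm (d k x) \<le> B * weight x" for x by (rule rapidly_decreasing_weight[OF B])
    have dom: "l2_dominated (d j)" for j by (rule schwartz_l2_dominated[OF d])
    have "?l\<^sup>2 \<le> ?l * (e / 2)"
    proof (rule field_le_epsilon)
      fix \<eta> :: real assume \<eta>: "\<eta> > 0"
      define \<delta> where "\<delta> = \<eta> / (B * ?W + 1)"
      have BW: "B * ?W \<ge> 0" using B0 integral_weight_nonneg by (rule mult_nonneg_nonneg)
      then have "\<delta> > 0" using \<eta> by (simp add: \<delta>_def)
      then obtain N' where N': "\<And>k x. k \<ge> N' \<Longrightarrow> norm (d k x) < \<delta>"
        using uniform_limitD[OF u \<open>\<delta> > 0\<close>] by (auto simp: eventually_sequentially dist_norm)
      \<comment> \<open>Beyond \<open>N\<close> the Cauchy bound holds, beyond \<open>N'\<close> the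
        uniform one; \<open>k\<close> stays fixed, so \<open>N'\<close> may depend on its decay
        constant \<open>B\<close>.\<close>
      define m where "m = max N N'"
      have dm: "schwartz (\<lambda>x. d k x - d m x)" by (rule schwartz_diff[OF d d])
      have "integral UNIV (\<lambda>x. st (d k x) * d k x)
          = integral UNIV (\<lambda>x. st (d k x) * d m x + st (d k x) * (d k x - d m x))"
        by (simp add: algebra_simps)
      also have "\<dots> = integral UNIV (\<lambda>x. st (d k x) * d m x) + integral UNIV (\<lambda>x. st (d k x) * (d k x - d m x))"
        by (intro Henstock_Kurzweil_Integration.integral_add l2_dominated_integrable dom schwartz_l2_dominated[OF dm])
      finally have "norm (integral UNIV (\<lambda>x. st (d k x) * d k x))
          \<le> norm (integral UNIV (\<lambda>x. st (d k x) * d m x)) + norm (integral UNIV (\<lambda>x. st (d k x) * (d k x - d m x)))"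
        by (simp add: norm_triangle_ineq)
      also have "norm (integral UNIV (\<lambda>x. st (d k x) * (d k x - d m x))) \<le> ?l * l2norm st (\<lambda>x. d k x - d m x)"
        by (rule l2_cauchy_schwarz[OF schwartz_l2_dominated[OF dm] dom])
      also have "\<dots> \<le> ?l * (e / 2)"
        using N[OF k, of m] l0 by (intro mult_left_mono) (auto simp: m_def)
      also have "norm (integral UNIV (\<lambda>x. st (d k x) * d m x)) \<le> (B * \<delta>) * ?W"
      proof (rule integrable_of_weight_bound(2))
        show "continuous_on UNIV (\<lambda>x. st (d k x) * d m x)"
          by (intro continuous_on_mult bounded_linear.continuous_on[OF bounded_linear_st] schwartzD(2)[OF d])
        show "norm (st (d k x) * d m x) \<le> (B * \<delta>) * weight x" for x
        proof -
          have "norm (st (d k x) * d m x) \<le> norm (d k x) * norm (d m x)"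
            using norm_mult_ineq[of "st (d k x)" "d m x"] by (simp add: norm_st)
          also have "\<dots> \<le> (B * weight x) * \<delta>"
            using Bw[of x] N'[of m x] order_trans[OF norm_ge_zero Bw[of x]] by (intro mult_mono) (auto simp: m_def)
          finally show ?thesis by (simp add: mult_ac)
        qed
      qed
      also have "(B * \<delta>) * ?W \<le> \<eta>"
      proof -
        have "(B * \<delta>) * ?W = \<delta> * (B * ?W)" by (simp add: mult_ac)
        also have "\<dots> \<le> \<delta> * (B * ?W + 1)" using \<open>\<delta> > 0\<close> by simp
        also have "\<dots> = \<eta>" using BW by (simp add: \<delta>_def)
        finally show ?thesis .
      qed
      finally show "?l\<^sup>2 \<le> ?l * (e / 2) + \<eta>" by (simp add: l2norm_def)
    qed
    then have "?l \<le> e / 2" using l0 e by (cases "?l = 0") (auto simp: power2_eq_square)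
    then show ?thesis using e by simp
  qed
  then show "\<exists>N. \<forall>k\<ge>N. dist (l2norm st (d k)) 0 < e" by (intro exI[of _ N]) (simp add: l2norm_def)
qed

end

section \<open>Existence, uniqueness and regularity of the representing function\<close>

context heis_rep
begin

text \<open>The graph of the partially defined map that sends a vector of the completion to the
  function representing it.\<close>

definition represents :: "(real^'n \<Rightarrow> 'a) \<Rightarrow> 'e \<Rightarrow> bool"
  where "represents f \<phi> \<longleftrightarrow> (\<exists>h. (\<forall>k. schwartz (h k)) \<and> (\<lambda>k. \<iota> (h k)) \<longlonglongrightarrow> \<phi> \<and> uniform_limit UNIV h f sequentially)"

lemma represents_iota: "schwartz f \<Longrightarrow> represents f (\<iota> f)"
  unfolding represents_def by (rule exI[of _ "\<lambda>_. f"]) (simp add: uniform_limit_const)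

lemma represents_diff:
  assumes "represents f \<phi>" "represents g \<psi>"
  shows "represents (\<lambda>x. f x - g x) (\<phi> - \<psi>)"
proof -
  obtain h where h: "\<And>k. schwartz (h k)" "(\<lambda>k. \<iota> (h k)) \<longlonglongrightarrow> \<phi>" "uniform_limit UNIV h f sequentially"
    using assms(1) unfolding represents_def by blast
  obtain h' where h': "\<And>k. schwartz (h' k)" "(\<lambda>k. \<iota> (h' k)) \<longlonglongrightarrow> \<psi>" "uniform_limit UNIV h' g sequentially"
    using assms(2) unfolding represents_def by blast
  have "(\<lambda>k. \<iota> (\<lambda>x. h k x - h' k x)) \<longlonglongrightarrow> \<phi> - \<psi>"
    unfolding iota_diff[OF h(1) h'(1)] by (rule tendsto_diff[OF h(2) h'(2)])
  moreover have "uniform_limit UNIV (\<lambda>k x. h k x - h' k x) (\<lambda>x. f x - g x) sequentially"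
    by (rule uniform_limit_minus[OF h(3) h'(3)])
  ultimately show ?thesis
    unfolding represents_def using schwartz_diff[OF h(1) h'(1)] by (intro exI[of _ "\<lambda>k x. h k x - h' k x"]) blast
qed

text \<open>By linearity this reduces to the zero vector, where a uniform limit of module-null
  approximants vanishes.\<close>

lemma represents_fun_unique:
  assumes "represents f \<phi>" "represents g \<phi>"
  shows "f = g"
proof
  fix y
  obtain h where h: "\<And>k. schwartz (h k)" "(\<lambda>k. \<iota> (h k)) \<longlonglongrightarrow> \<phi> - \<phi>"
    "uniform_limit UNIV h (\<lambda>x. f x - g x) sequentially"
    using represents_diff[OF assms] unfolding represents_def by blast
  have "(\<lambda>k. l2norm st (h k)) \<longlonglongrightarrow> 0"
    using tendsto_norm[OF h(2)] by (simp add: norm_iota h(1))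
  from l2_null_uniform_limit[OF h(1) this h(3)] show "f y = g y" by simp
qed

text \<open>The converse uniqueness identifies a smooth vector with the image of its representing
  function once that function is known to be Schwartz.\<close>

lemma represents_vector_unique:
  assumes "represents f \<phi>" "represents f \<psi>"
  shows "\<phi> = \<psi>"
proof -
  obtain h where h: "\<And>k. schwartz (h k)" "(\<lambda>k. \<iota> (h k)) \<longlonglongrightarrow> \<phi> - \<psi>"
    "uniform_limit UNIV h (\<lambda>x. f x - f x) sequentially"
    using represents_diff[OF assms] unfolding represents_def by blast
  have "(\<lambda>k. l2norm st (h k)) \<longlonglongrightarrow> 0"
  proof (rule uniform_null_l2_limit[OF h(1)])
    show "uniform_limit UNIV h (\<lambda>_. 0) sequentially" using h(3) by simp
    fix e :: real assume "e > 0"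
    then show "\<exists>N. \<forall>k\<ge>N. \<forall>m\<ge>N. l2norm st (\<lambda>x. h k x - h m x) < e"
      using metric_CauchyD[OF LIMSEQ_imp_Cauchy[OF h(2)]]
      by (simp add: dist_norm norm_iota[symmetric] schwartz_diff iota_diff h(1))
  qed
  then have "(\<lambda>k. \<iota> (h k)) \<longlonglongrightarrow> 0"
    by (simp add: norm_iota[symmetric] h(1) tendsto_norm_zero_iff)
  with h(2) have "\<phi> - \<psi> = 0" by (rule LIMSEQ_unique)
  then show ?thesis by simp
qed

lemma represents_bounded:
  assumes "represents f \<phi>"
  shows "\<exists>B. \<forall>x. norm (f x) \<le> B"
proof -
  obtain h where h: "\<And>k. schwartz (h k)" "uniform_limit UNIV h f sequentially"
    using assms unfolding represents_def by blast
  obtain k where k: "\<And>x. norm (h k x - f x) < 1"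
    using uniform_limitD[OF h(2) zero_less_one] by (auto simp: eventually_sequentially dist_norm)
  obtain M where M: "\<And>x. norm (h k x) \<le> M" using schwartz_bounded[OF h(1)] by blast
  have "norm (f x) \<le> M + 1" for x
    using k[of x] M[of x] norm_triangle_ineq4[of "h k x" "h k x - f x"] by simp
  then show ?thesis by blast
qed

fun iter_one_minus_gen :: "'n list \<Rightarrow> 'e \<Rightarrow> 'e" where
  "iter_one_minus_gen [] \<phi> = \<phi>"
| "iter_one_minus_gen (j # js) \<phi> = iter_one_minus_gen js (\<phi> - gen_a j \<phi>)"

lemma norm_diff_iota_le_iter:
  assumes "smooth_vector \<phi>" "schwartz u"
  shows "norm (\<phi> - \<iota> u) \<le> norm (iter_one_minus_gen js \<phi> - \<iota> (iter_one_plus_deriv js u))"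
  using assms
proof (induction js arbitrary: \<phi> u)
  case (Cons j js)
  have "norm (\<phi> - \<iota> u) \<le> norm ((\<phi> - gen_a j \<phi>) - \<iota> (\<lambda>x. u x + dir_deriv (axis j 1) u x))"
    by (rule norm_diff_iota_le_gen_a[OF Cons.prems])
  also have "\<dots> \<le> norm (iter_one_minus_gen js (\<phi> - gen_a j \<phi>)
      - \<iota> (iter_one_plus_deriv js (\<lambda>x. u x + dir_deriv (axis j 1) u x)))"
    by (intro Cons.IH smooth_vector_diff smooth_vector_gen_a Cons.prems schwartz_one_plus_deriv)
  finally show ?case by simp
qed simp

text \<open>Approximating \<open>\<psi>\<close> instead of \<open>\<phi>\<close> controls two norms
  of the pull-backs at once: the lower bounds give
  \<open>\<iota> (u k) \<longlonglongrightarrow> \<phi>\<close>, and the Sobolev bound turns the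
  module distance of \<open>g k\<close> and \<open>g m\<close> into the uniform distance of
  \<open>u k\<close> and \<open>u m\<close>.\<close>

lemma ex_represents:
  assumes \<phi>: "smooth_vector \<phi>"
  shows "\<exists>f. represents f \<phi>"
proof -
  obtain js :: "'n list" where js: "distinct js" "set js = UNIV"
    using finite_distinct_list[of "UNIV :: 'n set"] by auto
  obtain C where C: "C \<ge> 0" "\<And>f x. schwartz f \<Longrightarrow> norm (f x :: 'a) \<le> C * l2norm st (iter_one_plus_deriv js f)"
    using sobolev[OF js] by blast
  define \<psi> where "\<psi> = iter_one_minus_gen js \<phi>"
  have "\<exists>u. schwartz u \<and> norm (\<psi> - \<iota> (iter_one_plus_deriv js u)) < inverse (real (Suc k))" for k
  proof -
    obtain g where "schwartz g" "norm (\<psi> - \<iota> g) < inverse (real (Suc k))"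
      using iota_approx[of "inverse (real (Suc k))" \<psi>] by auto
    then show ?thesis using iter_one_plus_deriv_surj[of g js] by auto
  qed
  then obtain u where u: "\<And>k. schwartz (u k)"
    "\<And>k. norm (\<psi> - \<iota> (iter_one_plus_deriv js (u k))) < inverse (real (Suc k))" by metis
  define g where "g k = iter_one_plus_deriv js (u k)" for k
  have g: "schwartz (g k)" for k unfolding g_def by (rule schwartz_iter_one_plus_deriv[OF u(1)])
  have "(\<lambda>k. \<iota> (g k) - \<psi>) \<longlonglongrightarrow> 0"
    by (rule Lim_null_comparison[OF _ LIMSEQ_inverse_real_of_nat])
      (use u(2) in \<open>auto simp: g_def norm_minus_commute intro!: always_eventually less_imp_le\<close>)
  then have g_lim: "(\<lambda>k. \<iota> (g k)) \<longlonglongrightarrow> \<psi>" by (simp add: LIM_zero_iff)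
  have "(\<lambda>k. \<iota> (u k) - \<phi>) \<longlonglongrightarrow> 0"
  proof (rule Lim_null_comparison[OF _ LIMSEQ_inverse_real_of_nat], intro always_eventually allI)
    fix k
    have "norm (\<phi> - \<iota> (u k)) \<le> norm (\<psi> - \<iota> (g k))"
      unfolding \<psi>_def g_def by (rule norm_diff_iota_le_iter[OF \<phi> u(1)])
    then show "norm (\<iota> (u k) - \<phi>) \<le> inverse (real (Suc k))"
      using u(2)[of k] by (simp add: g_def norm_minus_commute)
  qed
  then have u_lim: "(\<lambda>k. \<iota> (u k)) \<longlonglongrightarrow> \<phi>" by (simp add: LIM_zero_iff)
  have sup: "norm (u k x - u m x) \<le> C * norm (\<iota> (g k) - \<iota> (g m))" for k m x
    using C(2)[OF schwartz_diff[OF u(1)[of k] u(1)[of m]], of x]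
    unfolding iter_one_plus_deriv_diff[OF u(1) u(1)] g_def[symmetric]
    by (simp add: norm_iota[symmetric] schwartz_diff g iota_diff)
  have cauchy: "\<exists>N. \<forall>k\<ge>N. \<forall>m\<ge>N. C * norm (\<iota> (g k) - \<iota> (g m)) < e" if "e > 0" for e
  proof -
    \<comment> \<open>\<open>C + 1\<close> avoids a division by zero when the Sobolev constant
      vanishes.\<close>
    have "e / (C + 1) > 0" using that C(1) by simp
    then obtain N where N: "\<And>k m. k \<ge> N \<Longrightarrow> m \<ge> N \<Longrightarrow> norm (\<iota> (g k) - \<iota> (g m)) < e / (C + 1)"
      using metric_CauchyD[OF LIMSEQ_imp_Cauchy[OF g_lim]] by (metis dist_norm)
    have "C * norm (\<iota> (g k) - \<iota> (g m)) < e" if "k \<ge> N" "m \<ge> N" for k m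
    proof -
      have "C * norm (\<iota> (g k) - \<iota> (g m)) \<le> C * (e / (C + 1))"
        using N[OF that] C(1) by (intro mult_left_mono) auto
      also have "\<dots> < e" using C(1) \<open>e > 0\<close> by (simp add: field_simps)
      finally show ?thesis .
    qed
    then show ?thesis by blast
  qed
  obtain f where "uniform_limit UNIV u f sequentially"
    using uniform_limit_of_Cauchy_bound[of u "\<lambda>k m. C * norm (\<iota> (g k) - \<iota> (g m))"] sup cauchy by blast
  then show ?thesis unfolding represents_def using u(1) u_lim by blast
qed

text \<open>The multiplier has modulus at most \<open>1\<close>, so it preserves uniform
  convergence; convergence in the module follows from the lower bound for
  \<open>1 - B_j\<close>.\<close>

lemma represents_gen_b:
  assumes \<phi>: "smooth_vector \<phi>" and f: "represents f (\<phi> - gen_b j \<phi>)"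
  shows "represents (\<lambda>x. csc (1 / (1 - \<i> * of_real (x $ j))) (f x)) \<phi>"
proof -
  obtain h where h: "\<And>k. schwartz (h k)" "(\<lambda>k. \<iota> (h k)) \<longlonglongrightarrow> \<phi> - gen_b j \<phi>" "uniform_limit UNIV h f sequentially"
    using f unfolding represents_def by blast
  let ?m = "\<lambda>x :: real^'n. 1 / (1 - \<i> * of_real (x $ j))"
  define u where "u k x = csc (?m x) (h k x)" for k x
  have u: "schwartz (u k)" for k
    unfolding u_def by (rule schwartz_tempered_mult[OF tempered_inverse h(1)])
  have hu: "h k = (\<lambda>x. csc (1 - \<i> * of_real (x $ j)) (u k x))" for k
    unfolding u_def by (simp add: csc_csc csc_1 one_minus_i_mult_real)
  have bnd: "norm (\<iota> (u k) - \<phi>) \<le> norm (\<iota> (h k) - (\<phi> - gen_b j \<phi>))" for k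
    using norm_diff_iota_le_gen_b[OF \<phi> u, of k j] unfolding hu[symmetric] by (simp add: norm_minus_commute)
  have null: "(\<lambda>k. norm (\<iota> (h k) - (\<phi> - gen_b j \<phi>))) \<longlonglongrightarrow> 0"
    using h(2) by (simp add: LIM_zero tendsto_norm_zero)
  have "(\<lambda>k. \<iota> (u k) - \<phi>) \<longlonglongrightarrow> 0"
    by (rule Lim_null_comparison[OF always_eventually[OF allI[OF bnd]] null])
  then have lim: "(\<lambda>k. \<iota> (u k)) \<longlonglongrightarrow> \<phi>" by (simp add: LIM_zero_iff)
  have "uniform_limit UNIV u (\<lambda>x. csc (?m x) (f x)) sequentially"
  proof (rule uniform_limitI)
    fix e :: real assume "e > 0"
    from uniform_limitD[OF h(3) this]
    show "\<forall>\<^sub>F k in sequentially. \<forall>x\<in>UNIV. dist (u k x) (csc (?m x) (f x)) < e"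
    proof eventually_elim
      case (elim k)
      have "dist (u k x) (csc (?m x) (f x)) \<le> dist (h k x) (f x)" for x
      proof -
        have "dist (u k x) (csc (?m x) (f x)) = cmod (?m x) * norm (h k x - f x)"
          unfolding u_def dist_norm by (simp add: csc_simps(3)[symmetric] norm_csc)
        also have "\<dots> \<le> 1 * norm (h k x - f x)" by (intro mult_right_mono one_minus_i_mult_real) auto
        finally show ?thesis by (simp add: dist_norm)
      qed
      then show ?case using elim le_less_trans by blast
    qed
  qed
  then show ?thesis unfolding represents_def using u lim by blast
qed

text \<open>The resolvent contracts the supremum norm, so the functions \<open>u k\<close> converge
  uniformly. Their derivatives are \<open>h k - u k\<close> and converge uniformly too, which makes
  the limit differentiable.\<close>

lemma represents_gen_a:
  assumes \<phi>: "smooth_vector \<phi>" and f: "represents f' (\<phi> - gen_a j \<phi>)"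
  shows "\<exists>f. represents f \<phi> \<and> has_dir_deriv (axis j 1) f (\<lambda>x. f' x - f x)"
proof -
  obtain h where h: "\<And>k. schwartz (h k)" "(\<lambda>k. \<iota> (h k)) \<longlonglongrightarrow> \<phi> - gen_a j \<phi>" "uniform_limit UNIV h f' sequentially"
    using f unfolding represents_def by blast
  let ?e = "axis j 1 :: real^'n"
  define u where "u k = resolvent ?e (h k)" for k
  have u: "schwartz (u k)" for k unfolding u_def by (rule schwartz_resolvent[OF h(1) axis_Basis])
  have du: "has_dir_deriv ?e (u k) (\<lambda>x. h k x - u k x)" for k
  proof -
    have "resolvent ?e (dir_deriv ?e (h k)) = (\<lambda>x. h k x - u k x)"
      unfolding u_def by (rule ext, rule resolvent_inverse[OF h(1) axis_Basis])
    then show ?thesis using resolvent_has_dir_deriv[OF h(1)[of k] axis_Basis[of j], of ?e] by (simp add: u_def)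
  qed
  have hu: "(\<lambda>x. u k x + dir_deriv ?e (u k) x) = h k" for k
    using has_dir_deriv_dir_deriv[OF du] by simp
  have bnd: "norm (\<iota> (u k) - \<phi>) \<le> norm (\<iota> (h k) - (\<phi> - gen_a j \<phi>))" for k
    using norm_diff_iota_le_gen_a[OF \<phi> u, of k j] unfolding hu by (simp add: norm_minus_commute)
  have null: "(\<lambda>k. norm (\<iota> (h k) - (\<phi> - gen_a j \<phi>))) \<longlonglongrightarrow> 0"
    using h(2) by (simp add: LIM_zero tendsto_norm_zero)
  have "(\<lambda>k. \<iota> (u k) - \<phi>) \<longlonglongrightarrow> 0"
    by (rule Lim_null_comparison[OF always_eventually[OF allI[OF bnd]] null])
  then have lim: "(\<lambda>k. \<iota> (u k)) \<longlonglongrightarrow> \<phi>" by (simp add: LIM_zero_iff)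
  have "uniformly_convergent_on UNIV h" using h(3) by (auto simp: uniformly_convergent_on_def)
  then have hC: "uniformly_Cauchy_on UNIV h" by (rule uniformly_convergent_Cauchy)
  have "uniformly_Cauchy_on UNIV u"
    unfolding uniformly_Cauchy_on_def
  proof (intro allI impI)
    fix e :: real assume e: "e > 0"
    then obtain N where N: "\<And>x m k. m \<ge> N \<Longrightarrow> k \<ge> N \<Longrightarrow> dist (h m x) (h k x) < e / 2"
      using hC unfolding uniformly_Cauchy_on_def by (meson UNIV_I half_gt_zero)
    have "dist (u m x) (u k x) < e" if "m \<ge> N" "k \<ge> N" for x m k
    proof -
      have "norm (u m x - u k x) \<le> e / 2"
        unfolding u_def by (rule resolvent_diff_bound[OF h(1) h(1)])
          (use N[OF that] in \<open>auto simp: dist_norm intro: less_imp_le\<close>)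
      then show ?thesis using e by (simp add: dist_norm)
    qed
    then show "\<exists>M. \<forall>x\<in>UNIV. \<forall>m\<ge>M. \<forall>n\<ge>M. dist (u m x) (u n x) < e" by blast
  qed
  then obtain f where ul: "uniform_limit UNIV u f sequentially"
    using Cauchy_uniformly_convergent by (auto simp: uniformly_convergent_on_def)
  have "has_dir_deriv ?e f (\<lambda>x. f' x - f x)"
    by (rule has_dir_deriv_uniform_limit[OF du ul uniform_limit_minus[OF h(3) ul]])
  moreover have "represents f \<phi>" unfolding represents_def using u lim ul by blast
  ultimately show ?thesis by blast
qed

lemma represents_rapidly_decreasing:
  assumes "smooth_vector \<phi>" "represents f \<phi>"
  shows "rapidly_decreasing f"
  unfolding rapidly_decreasing_def
proof
  fix k
  show "\<exists>B. \<forall>x. (1 + norm x) ^ k * norm (f x) \<le> B"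
    using assms
  \<comment> \<open>Generalising over \<open>\<phi>\<close> allows the induction hypothesis for
    \<open>\<phi> - gen_b j \<phi>\<close>, whose function is \<open>f\<close> times
    \<open>1 - \<i> x_j\<close>; this gains one power of the coordinate \<open>x_j\<close>.\<close>
  proof (induction k arbitrary: \<phi> f)
    case 0
    then show ?case using represents_bounded by simp
  next
    case (Suc k)
    have "\<exists>B. \<forall>x. (1 + norm x) ^ k * (\<bar>x $ j\<bar> * norm (f x)) \<le> B" for j
    proof -
      have s: "smooth_vector (\<phi> - gen_b j \<phi>)"
        by (intro smooth_vector_diff smooth_vector_gen_b Suc.prems)
      then obtain f' where f': "represents f' (\<phi> - gen_b j \<phi>)" using ex_represents by blast
      have "f = (\<lambda>x. csc (1 / (1 - \<i> * of_real (x $ j))) (f' x))"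
        by (rule represents_fun_unique[OF Suc.prems(2) represents_gen_b[OF Suc.prems(1) f']])
      then have ff': "f' x = csc (1 - \<i> * of_real (x $ j)) (f x)" for x
        by (simp add: csc_csc csc_1 one_minus_i_mult_real)
      obtain B where B: "\<And>x. (1 + norm x) ^ k * norm (f' x) \<le> B" using Suc.IH[OF s f'] by blast
      have "(1 + norm x) ^ k * (\<bar>x $ j\<bar> * norm (f x)) \<le> B" for x
      proof -
        have "\<bar>x $ j\<bar> \<le> cmod (1 - \<i> * of_real (x $ j))"
          using abs_Im_le_cmod[of "1 - \<i> * of_real (x $ j)"] by simp
        then have "\<bar>x $ j\<bar> * norm (f x) \<le> norm (f' x)" unfolding ff' norm_csc by (intro mult_right_mono) auto
        then have "(1 + norm x) ^ k * (\<bar>x $ j\<bar> * norm (f x)) \<le> (1 + norm x) ^ k * norm (f' x)"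
          by (intro mult_left_mono) auto
        then show ?thesis using B[of x] by simp
      qed
      then show ?thesis by blast
    qed
    then obtain B where B: "\<And>j x. (1 + norm x) ^ k * (\<bar>x $ j\<bar> * norm (f x)) \<le> B j" by metis
    obtain A where A: "\<And>x. (1 + norm x) ^ k * norm (f x) \<le> A" using Suc.IH[OF Suc.prems] by blast
    have "(1 + norm x) ^ Suc k * norm (f x) \<le> A + (\<Sum>j\<in>UNIV. B j)" for x
    proof -
      \<comment> \<open>The new factor \<open>1 + norm x\<close> is split; \<open>norm x\<close> is
        bounded by the sum of the coordinate moduli, each treated above.\<close>
      have "(1 + norm x) ^ Suc k * norm (f x)
          = (1 + norm x) ^ k * norm (f x) + norm x * ((1 + norm x) ^ k * norm (f x))"
        by (simp add: algebra_simps)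
      also have "norm x * ((1 + norm x) ^ k * norm (f x)) \<le> (\<Sum>j\<in>UNIV. \<bar>x $ j\<bar>) * ((1 + norm x) ^ k * norm (f x))"
        by (intro mult_right_mono norm_le_l1_cart) auto
      also have "\<dots> = (\<Sum>j\<in>UNIV. (1 + norm x) ^ k * (\<bar>x $ j\<bar> * norm (f x)))"
        unfolding sum_distrib_right by (simp add: mult_ac)
      also have "\<dots> \<le> (\<Sum>j\<in>UNIV. B j)" by (intro sum_mono B)
      finally show ?thesis using A[of x] by simp
    qed
    then show ?case by blast
  qed
qed

text \<open>Functions representing smooth vectors form a class closed under derivatives:
  \<open>\<partial>_j f\<close> is \<open>f' - f\<close>, which represents
  \<open>\<phi> - gen_a j \<phi> - \<phi>\<close>. Uniqueness of the representing function ensures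
  that the derivative belongs to the given \<open>f\<close>.\<close>

lemma represents_schwartz:
  assumes "smooth_vector \<phi>" "represents f \<phi>"
  shows "schwartz f"
proof (rule schwartz_coinduct[where X = "\<lambda>f. \<exists>\<phi>. smooth_vector \<phi> \<and> represents f \<phi>"])
  fix f :: "real^'n \<Rightarrow> 'a" and v :: "real^'n"
  assume "\<exists>\<phi>. smooth_vector \<phi> \<and> represents f \<phi>" and v: "v \<in> Basis"
  then obtain \<phi> where \<phi>: "smooth_vector \<phi>" "represents f \<phi>" by blast
  obtain j where j: "v = axis j 1" using v by (auto simp: Basis_vec_def)
  have s: "smooth_vector (\<phi> - gen_a j \<phi>)" by (intro smooth_vector_diff smooth_vector_gen_a \<phi>)
  then obtain f' where f': "represents f' (\<phi> - gen_a j \<phi>)" using ex_represents by blast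
  obtain f2 where f2: "represents f2 \<phi>" "has_dir_deriv (axis j 1) f2 (\<lambda>x. f' x - f2 x)"
    using represents_gen_a[OF \<phi>(1) f'] by blast
  have "f2 = f" by (rule represents_fun_unique[OF f2(1) \<phi>(2)])
  then have "has_dir_deriv v f (\<lambda>x. f' x - f x)" using f2(2) j by simp
  moreover have "represents (\<lambda>x. f' x - f x) (\<phi> - gen_a j \<phi> - \<phi>)" by (rule represents_diff[OF f' \<phi>(2)])
  moreover have "smooth_vector (\<phi> - gen_a j \<phi> - \<phi>)" by (intro smooth_vector_diff s \<phi>)
  ultimately show "\<exists>f'. (\<exists>\<phi>. smooth_vector \<phi> \<and> represents f' \<phi>) \<and> has_dir_deriv v f f'" by blast
qed (use assms represents_rapidly_decreasing in blast)+

lemma smooth_vector_iff: "smooth_vector \<phi> \<longleftrightarrow> \<phi> \<in> \<iota> ` {f. schwartz f}"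
proof
  assume \<phi>: "smooth_vector \<phi>"
  then obtain f where f: "represents f \<phi>" using ex_represents by blast
  have "schwartz f" by (rule represents_schwartz[OF \<phi> f])
  moreover have "\<phi> = \<iota> f" by (rule represents_vector_unique[OF f represents_iota[OF \<open>schwartz f\<close>]])
  ultimately show "\<phi> \<in> \<iota> ` {f. schwartz f}" by blast
qed (auto simp: smooth_vector_iota)

end

theorem theorem2p2:
  fixes csc :: "complex \<Rightarrow> 'a::{real_normed_algebra_1,banach} \<Rightarrow> 'a"
    and st :: "'a \<Rightarrow> 'a"
    and \<iota> :: "(real^'n \<Rightarrow> 'a) \<Rightarrow> 'e::banach"
    and U :: "(real^'n) \<times> (real^'n) \<times> real \<Rightarrow> 'e \<Rightarrow> 'e"
  assumes "cstar_algebra csc st"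
    and "is_completion st \<iota>"
    and "\<forall>g. continuous_on UNIV (U g)"
    and "\<forall>g f. schwartz f \<longrightarrow> U g (\<iota> f) = \<iota> (heis_act csc g f)"
  shows "{\<phi>. smooth_map (\<lambda>g. U g \<phi>)} = \<iota> ` {f. schwartz f}"
proof -
  interpret heis_rep csc st \<iota> U using assms by unfold_locales auto
  show ?thesis using smooth_vector_iff unfolding smooth_vector_def by blast
qed

end
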